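(* Let $G$ be a profinite group and $M$ a finite $G$-module, and consider $\varphi^q:H^q_c(G,M^* )\to H^q_d(G,M^* )$ and $\varphi_q:H_q^d(G,M)\to H_q^c(G,M)$. Then: (i) if $\varphi^q$ is surjective then $\varphi_q$ is injective, and if $\varphi_q$ is surjective then $\varphi^q$ is injective; (ii) any two of the following three conditions imply the third: $\varphi_q$ is an isomorphism; $\varphi^q$ is an isomorphism; $H_q^c(G,M)$ is finite.
   Context: For a profinite group $G$ and a discrete $G$-module $M$, $H^q_c(G,M)$ is continuous cohomology (continuous cochains), $H^q_d(G,M)$ is abstract group cohomology (all cochains), and $\varphi^q:H^q_c\to H^q_d$ is induced by inclusion of cochains. For a profinite $G$-module $M$, $H_q^d(G,M)$ is abstract group homology, $H_q^c(G,M)$ is profinite homology (projective resolution of $\hat{\mathbb{Z}}$ by profinite $\hat{\mathbb{Z}}[[G]]$-modules and completed tensor product), and $\varphi_q:H_q^d\to H_q^c$ is induced by a comparison chain map between the resolutions. $M^*=\mathrm{Hom}(M,\mathbb{Q}/\mathbb{Z})$ with the contragredient (left) $G$-action. *)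

theory Defs
  imports "HOL-Algebra.Group" "HOL-Analysis.Analysis"
begin

definition profinite_group :: "'g monoid \<Rightarrow> 'g topology \<Rightarrow> bool" where
  "profinite_group G T \<longleftrightarrow> group G \<and> topspace T = carrier G \<and>
     continuous_map (prod_topology T T) T (\<lambda>(x, y). x \<otimes>\<^bsub>G\<^esub> y) \<and>
     continuous_map T T (\<lambda>x. inv\<^bsub>G\<^esub> x) \<and>
     compact_space T \<and> Hausdorff_space T \<and>
     (\<forall>x\<in>topspace T. {y. connected_component_of T x y} = {x})"

text \<open>A finite G-module: the module is a finite type, the action is a continuous
  (i.e. all stabilisers open) left action by additive automorphisms.\<close>
definition finite_G_module ::
  "'g monoid \<Rightarrow> 'g topology \<Rightarrow> ('g \<Rightarrow> 'm::{ab_group_add,finite} \<Rightarrow> 'm) \<Rightarrow> bool" where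
  "finite_G_module G T act \<longleftrightarrow>
     (\<forall>g\<in>carrier G. \<forall>x y. act g (x + y) = act g x + act g y) \<and>
     (\<forall>x. act \<one>\<^bsub>G\<^esub> x = x) \<and>
     (\<forall>g\<in>carrier G. \<forall>h\<in>carrier G. \<forall>x. act (g \<otimes>\<^bsub>G\<^esub> h) x = act g (act h x)) \<and>
     (\<forall>x. openin T {g\<in>carrier G. act g x = x})"

definition gtuples :: "'g monoid \<Rightarrow> nat \<Rightarrow> 'g list set" where
  "gtuples G q = {gs. length gs = q \<and> set gs \<subseteq> carrier G}"

text \<open>Face maps of the inhomogeneous bar complex, for i = 0..length gs.\<close>
definition face :: "'g monoid \<Rightarrow> nat \<Rightarrow> 'g list \<Rightarrow> 'g list" where
  "face G i gs = (if i = 0 then tl gs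
     else if i < length gs then take (i - 1) gs @ [gs ! (i - 1) \<otimes>\<^bsub>G\<^esub> gs ! i] @ drop (i + 1) gs
     else butlast gs)"

definition tup :: "nat \<Rightarrow> (nat \<Rightarrow> 'g) \<Rightarrow> 'g list" where
  "tup q v = map v [0..<q]"

definition openL :: "'g topology \<Rightarrow> nat \<Rightarrow> 'g list set \<Rightarrow> bool" where
  "openL T q U \<longleftrightarrow> U \<subseteq> {gs. length gs = q \<and> set gs \<subseteq> topspace T} \<and>
     openin (product_topology (\<lambda>_. T) {..<q})
       {v \<in> topspace (product_topology (\<lambda>_. T) {..<q}). tup q v \<in> U}"

definition clopenL :: "'g topology \<Rightarrow> nat \<Rightarrow> 'g list set \<Rightarrow> bool" where
  "clopenL T q V \<longleftrightarrow> openL T q V \<and>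
     openL T q ({gs. length gs = q \<and> set gs \<subseteq> topspace T} - V)"

definition alt :: "nat \<Rightarrow> 'm::ab_group_add \<Rightarrow> 'm" where
  "alt i x = (if even i then x else - x)"

section \<open>Abstract homology H_q^d(G,M) (standard bar complex M \<otimes> Z[G^q])\<close>

definition dchains :: "'g monoid \<Rightarrow> nat \<Rightarrow> ('g list \<Rightarrow> 'm::ab_group_add) set" where
  "dchains G q = {c. finite {gs. c gs \<noteq> 0} \<and> (\<forall>gs. c gs \<noteq> 0 \<longrightarrow> gs \<in> gtuples G q)}"

text \<open>Boundary C_q \<rightarrow> C_{q-1}; the right action is m\<cdot>g = g^{-1} m.\<close>
definition dbd :: "'g monoid \<Rightarrow> ('g \<Rightarrow> 'm \<Rightarrow> 'm) \<Rightarrow> nat \<Rightarrow> ('g list \<Rightarrow> 'm::ab_group_add) \<Rightarrow> ('g list \<Rightarrow> 'm)" where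
  "dbd G act q c = (if q = 0 then (\<lambda>_. 0) else (\<lambda>hs.
     \<Sum>gs\<in>{gs. c gs \<noteq> 0}. \<Sum>i\<in>{0..q}.
       (if face G i gs = hs
        then alt i (if i = 0 then act (inv\<^bsub>G\<^esub> (hd gs)) (c gs) else c gs) else 0)))"

definition dcycles :: "'g monoid \<Rightarrow> ('g \<Rightarrow> 'm \<Rightarrow> 'm) \<Rightarrow> nat \<Rightarrow> ('g list \<Rightarrow> 'm::ab_group_add) set" where
  "dcycles G act q = {c \<in> dchains G q. dbd G act q c = (\<lambda>_. 0)}"

definition dboundaries :: "'g monoid \<Rightarrow> ('g \<Rightarrow> 'm \<Rightarrow> 'm) \<Rightarrow> nat \<Rightarrow> ('g list \<Rightarrow> 'm::ab_group_add) set" where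
  "dboundaries G act q = dbd G act (Suc q) ` dchains G (Suc q)"

definition dhrel :: "'g monoid \<Rightarrow> ('g \<Rightarrow> 'm \<Rightarrow> 'm) \<Rightarrow> nat \<Rightarrow> (('g list \<Rightarrow> 'm::ab_group_add) \<times> ('g list \<Rightarrow> 'm)) set" where
  "dhrel G act q = {(c, c'). c \<in> dcycles G act q \<and> c' \<in> dcycles G act q \<and> c - c' \<in> dboundaries G act q}"

definition Hd_hom :: "'g monoid \<Rightarrow> ('g \<Rightarrow> 'm \<Rightarrow> 'm) \<Rightarrow> nat \<Rightarrow> ('g list \<Rightarrow> 'm::ab_group_add) set set" where
  "Hd_hom G act q = dcycles G act q // dhrel G act q"

text \<open>For finite M, the chain group \<open>Z[[G^q]] \<hat>\<otimes> M = lim_U M[(G/U)^q]\<close> of the profinite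
  bar resolution is the group of finitely additive M-valued measures on the clopen
  subsets of G^q.\<close>
definition cchains :: "'g topology \<Rightarrow> nat \<Rightarrow> ('g list set \<Rightarrow> 'm::ab_group_add) set" where
  "cchains T q = {\<mu>. (\<forall>V. \<not> clopenL T q V \<longrightarrow> \<mu> V = 0) \<and>
     (\<forall>V W. clopenL T q V \<and> clopenL T q W \<and> V \<inter> W = {} \<longrightarrow> \<mu> (V \<union> W) = \<mu> V + \<mu> W)}"

definition cbd :: "'g monoid \<Rightarrow> 'g topology \<Rightarrow> ('g \<Rightarrow> 'm \<Rightarrow> 'm) \<Rightarrow> nat
     \<Rightarrow> ('g list set \<Rightarrow> 'm::ab_group_add) \<Rightarrow> ('g list set \<Rightarrow> 'm)" where
  "cbd G T act q \<mu> = (\<lambda>V. if q = 0 \<or> \<not> clopenL T (q - 1) V then 0 else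
     \<Sum>i\<in>{0..q}. alt i
       (if i = 0 then
          (\<Sum>\<phi>\<in>(\<lambda>g. act (inv\<^bsub>G\<^esub> g)) ` carrier G.
             \<phi> (\<mu> {gs \<in> gtuples G q. act (inv\<^bsub>G\<^esub> (hd gs)) = \<phi> \<and> tl gs \<in> V}))
        else \<mu> {gs \<in> gtuples G q. face G i gs \<in> V}))"

definition ccycles :: "'g monoid \<Rightarrow> 'g topology \<Rightarrow> ('g \<Rightarrow> 'm \<Rightarrow> 'm) \<Rightarrow> nat \<Rightarrow> ('g list set \<Rightarrow> 'm::ab_group_add) set" where
  "ccycles G T act q = {\<mu> \<in> cchains T q. cbd G T act q \<mu> = (\<lambda>_. 0)}"

definition cboundaries :: "'g monoid \<Rightarrow> 'g topology \<Rightarrow> ('g \<Rightarrow> 'm \<Rightarrow> 'm) \<Rightarrow> nat \<Rightarrow> ('g list set \<Rightarrow> 'm::ab_group_add) set" where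
  "cboundaries G T act q = cbd G T act (Suc q) ` cchains T (Suc q)"

definition chrel :: "'g monoid \<Rightarrow> 'g topology \<Rightarrow> ('g \<Rightarrow> 'm \<Rightarrow> 'm) \<Rightarrow> nat
     \<Rightarrow> (('g list set \<Rightarrow> 'm::ab_group_add) \<times> ('g list set \<Rightarrow> 'm)) set" where
  "chrel G T act q = {(\<mu>, \<nu>). \<mu> \<in> ccycles G T act q \<and> \<nu> \<in> ccycles G T act q \<and> \<mu> - \<nu> \<in> cboundaries G T act q}"

definition Hc_hom :: "'g monoid \<Rightarrow> 'g topology \<Rightarrow> ('g \<Rightarrow> 'm \<Rightarrow> 'm) \<Rightarrow> nat \<Rightarrow> ('g list set \<Rightarrow> 'm::ab_group_add) set set" where
  "Hc_hom G T act q = ccycles G T act q // chrel G T act q"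

definition dirac_chain :: "'g topology \<Rightarrow> nat \<Rightarrow> ('g list \<Rightarrow> 'm::ab_group_add) \<Rightarrow> ('g list set \<Rightarrow> 'm)" where
  "dirac_chain T q c = (\<lambda>V. if clopenL T q V then \<Sum>gs\<in>{gs. c gs \<noteq> 0} \<inter> V. c gs else 0)"

definition phi_hom :: "'g monoid \<Rightarrow> 'g topology \<Rightarrow> ('g \<Rightarrow> 'm \<Rightarrow> 'm) \<Rightarrow> nat
     \<Rightarrow> ('g list \<Rightarrow> 'm::ab_group_add) set \<Rightarrow> ('g list set \<Rightarrow> 'm) set" where
  "phi_hom G T act q X = chrel G T act q `` (dirac_chain T q ` X)"

text \<open>Q/Z is represented by the rationals in [0,1) with addition modulo 1.\<close>
definition dual :: "('m::ab_group_add \<Rightarrow> rat) set" where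
  "dual = {ch. (\<forall>x. 0 \<le> ch x \<and> ch x < 1) \<and> (\<forall>x y. ch (x + y) = frac (ch x + ch y))}"

definition dcochains :: "'g monoid \<Rightarrow> nat \<Rightarrow> ('g list \<Rightarrow> 'm::ab_group_add \<Rightarrow> rat) set" where
  "dcochains G q = {f. (\<forall>gs. gs \<notin> gtuples G q \<longrightarrow> f gs = (\<lambda>_. 0)) \<and> (\<forall>gs\<in>gtuples G q. f gs \<in> dual)}"

definition ccochains :: "'g monoid \<Rightarrow> 'g topology \<Rightarrow> nat \<Rightarrow> ('g list \<Rightarrow> 'm::ab_group_add \<Rightarrow> rat) set" where
  "ccochains G T q = {f \<in> dcochains G q. \<forall>S. openL T q {gs \<in> gtuples G q. f gs \<in> S}}"

text \<open>Coboundary C^q \<rightarrow> C^{q+1}; contragredient action (gch)(x) = ch(g^{-1}x).\<close>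
definition cobd :: "'g monoid \<Rightarrow> ('g \<Rightarrow> 'm \<Rightarrow> 'm) \<Rightarrow> nat
     \<Rightarrow> ('g list \<Rightarrow> 'm::ab_group_add \<Rightarrow> rat) \<Rightarrow> ('g list \<Rightarrow> 'm \<Rightarrow> rat)" where
  "cobd G act q f = (\<lambda>gs. if gs \<in> gtuples G (Suc q) then
     (\<lambda>x. frac (f (tl gs) (act (inv\<^bsub>G\<^esub> (hd gs)) x)
                + (\<Sum>i\<in>{1..Suc q}. (-1) ^ i * f (face G i gs) x)))
     else (\<lambda>_. 0))"

definition cocycles_of :: "'g monoid \<Rightarrow> ('g \<Rightarrow> 'm \<Rightarrow> 'm) \<Rightarrow> nat
     \<Rightarrow> ('g list \<Rightarrow> 'm::ab_group_add \<Rightarrow> rat) set \<Rightarrow> ('g list \<Rightarrow> 'm \<Rightarrow> rat) set" where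
  "cocycles_of G act q C = {f \<in> C. cobd G act q f = (\<lambda>_ _. 0)}"

definition coboundaries_of :: "'g monoid \<Rightarrow> ('g \<Rightarrow> 'm \<Rightarrow> 'm) \<Rightarrow> nat
     \<Rightarrow> ('g list \<Rightarrow> 'm::ab_group_add \<Rightarrow> rat) set \<Rightarrow> ('g list \<Rightarrow> 'm \<Rightarrow> rat) set" where
  "coboundaries_of G act q C = (if q = 0 then {(\<lambda>_ _. 0)} else cobd G act (q - 1) ` C)"

definition cohrel :: "('g list \<Rightarrow> 'm::ab_group_add \<Rightarrow> rat) set \<Rightarrow> ('g list \<Rightarrow> 'm \<Rightarrow> rat) set
     \<Rightarrow> (('g list \<Rightarrow> 'm \<Rightarrow> rat) \<times> ('g list \<Rightarrow> 'm \<Rightarrow> rat)) set" where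
  "cohrel Z B = {(f, f'). f \<in> Z \<and> f' \<in> Z \<and> (\<lambda>gs x. frac (f gs x - f' gs x)) \<in> B}"

definition Hd_coh :: "'g monoid \<Rightarrow> ('g \<Rightarrow> 'm \<Rightarrow> 'm) \<Rightarrow> nat \<Rightarrow> ('g list \<Rightarrow> 'm::ab_group_add \<Rightarrow> rat) set set" where
  "Hd_coh G act q = cocycles_of G act q (dcochains G q) //
     cohrel (cocycles_of G act q (dcochains G q)) (coboundaries_of G act q (dcochains G (q - 1)))"

definition Hc_coh :: "'g monoid \<Rightarrow> 'g topology \<Rightarrow> ('g \<Rightarrow> 'm \<Rightarrow> 'm) \<Rightarrow> nat \<Rightarrow> ('g list \<Rightarrow> 'm::ab_group_add \<Rightarrow> rat) set set" where
  "Hc_coh G T act q = cocycles_of G act q (ccochains G T q) //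
     cohrel (cocycles_of G act q (ccochains G T q)) (coboundaries_of G act q (ccochains G T (q - 1)))"

definition phi_coh :: "'g monoid \<Rightarrow> ('g \<Rightarrow> 'm \<Rightarrow> 'm) \<Rightarrow> nat
     \<Rightarrow> ('g list \<Rightarrow> 'm::ab_group_add \<Rightarrow> rat) set \<Rightarrow> ('g list \<Rightarrow> 'm \<Rightarrow> rat) set" where
  "phi_coh G act q X = cohrel (cocycles_of G act q (dcochains G q))
      (coboundaries_of G act q (dcochains G (q - 1))) `` X"

end

theory Submission
  imports Defs "HOL-Library.Function_Algebras"
begin

text \<open>Abstract cochains are the full character group of abstract chains. Dually, a finitely additive
  \<open>M\<close>-valued measure is the same as a character of the discrete group of locally constant cochains,
  because a finite module is its own double dual. Both identifications turn the boundary into the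
  adjoint of the coboundary, and the two pairings agree on Dirac measures. As \<open>\<rat>/\<int>\<close> is injective,
  \<open>H\<^sup>q\<^sub>d\<close> is the dual of \<open>H\<^sub>q\<^sup>d\<close>, \<open>H\<^sub>q\<^sup>c\<close> is the dual of \<open>H\<^sup>q\<^sub>c\<close>, and the two comparison maps are
  adjoint to each other. Part (i) is then orthogonality. In part (ii), finiteness upgrades injectivity
  to surjectivity of the adjoint because a finite group of characters contains every character that
  vanishes on its annihilator; conversely, if both maps are isomorphisms then \<open>H\<^sub>q\<^sup>d\<close> is a group of
  finite exponent that is its own double dual, and such a group is finite.\<close>

section \<open>The group of rationals modulo one\<close>

\<comment> \<open>The duality is purely algebraic: in the abstract complex the chains are the
  discrete side, in the continuous complex the cochains are, and each time the other side consists
  of all homomorphisms from the discrete side to Q/Z. Topology enters only through local constancy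
  and clopen sets. The delicate implication is finiteness from two isomorphisms. Instead of
  comparing cardinalities of a group and its double dual, the proof uses surjectivity of both maps
  to show that every functional on the characters of \<open>Hd_hom\<close> is an evaluation, and an
  explicit functional contradicts this for an infinite group. The integer \<open>n\<close> that
  recurs is the order of the module. It kills all chains, so the values of characters lie in the
  finite cyclic group generated by 1/n; this cyclicity stands in for any structure theory of finite
  abelian groups. Subgroups and homomorphisms are relative to sets because the chain groups of all
  degrees share one function type. The rationals in [0,1) of the definitions are replaced by a
  genuine quotient group, so that sums and homomorphisms make sense.\<close>
quotient_type qz = rat / "\<lambda>x y. x - y \<in> \<int>"
proof (rule equivpI)
  show "reflp (\<lambda>x y::rat. x - y \<in> \<int>)" by (simp add: reflp_def)
  show "symp (\<lambda>x y::rat. x - y \<in> \<int>)"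
    unfolding symp_def by (metis Ints_minus minus_diff_eq)
  show "transp (\<lambda>x y::rat. x - y \<in> \<int>)"
    unfolding transp_def by (metis Ints_add diff_add_cancel add_diff_eq)
qed

instantiation qz :: ab_group_add
begin

lift_definition zero_qz :: qz is 0 .

lift_definition plus_qz :: "qz \<Rightarrow> qz \<Rightarrow> qz" is "(+)"
  by (metis Ints_add add_diff_add)

lift_definition uminus_qz :: "qz \<Rightarrow> qz" is uminus
  by (metis Ints_minus minus_diff_minus)

lift_definition minus_qz :: "qz \<Rightarrow> qz \<Rightarrow> qz" is "(-)"
proof -
  fix a b c d :: rat
  assume "a - b \<in> \<int>" "c - d \<in> \<int>"
  then have "(a - b) - (c - d) \<in> \<int>" by (rule Ints_diff)
  then show "a - c - (b - d) \<in> \<int>" by (simp add: algebra_simps)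
qed

instance
  by standard (transfer; simp add: algebra_simps)+

end

lift_definition qz_of :: "rat \<Rightarrow> qz" is "\<lambda>x. x" .

text \<open>The canonical representative lies in [0,1), which is the encoding of Q/Z used by
  \<open>dual\<close>; together with \<open>qz_of\<close> it later translates between
  \<open>dual\<close> and honest characters.\<close>

lift_definition qz_rep :: "qz \<Rightarrow> rat" is frac
proof -
  fix x y :: rat
  assume "x - y \<in> \<int>"
  then obtain k where "x = y + of_int k" by (metis Ints_cases add_diff_cancel_left' diff_add_cancel add.commute)
  then show "frac x = frac y" by (simp add: frac_def)
qed

lemma qz_of_add: "qz_of (x + y) = qz_of x + qz_of y"
  and qz_of_diff: "qz_of (x - y) = qz_of x - qz_of y"
  and qz_of_minus: "qz_of (- x) = - qz_of x"
  and qz_of_0: "qz_of 0 = 0"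
  by (transfer; simp)+

lemma qz_of_eq_0_iff: "qz_of x = 0 \<longleftrightarrow> x \<in> \<int>"
  by transfer simp

lemma qz_of_sum: "qz_of (sum f A) = (\<Sum>i\<in>A. qz_of (f i))"
  by (induction A rule: infinite_finite_induct) (simp_all add: qz_of_add qz_of_0)

lemma qz_rep_of: "qz_rep (qz_of x) = frac x"
  by transfer simp

lemma qz_of_rep [simp]: "qz_of (qz_rep y) = y"
  by transfer (simp add: frac_def)

lemma qz_of_frac [simp]: "qz_of (frac x) = qz_of x"
  by transfer (simp add: frac_def)

lemma qz_rep_ge_0: "0 \<le> qz_rep y" and qz_rep_less_1: "qz_rep y < 1"
  by (transfer; simp add: frac_ge_0 frac_lt_1)+

lemma qz_rep_add: "qz_rep (x + y) = frac (qz_rep x + qz_rep y)"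
  by (metis qz_of_add qz_of_rep qz_rep_of)

section \<open>Abelian groups and their characters\<close>

text \<open>Both branches are built from sums of a constant, so closure of subgroups and
  compatibility with homomorphisms come from the corresponding facts on sums.\<close>

definition zmul :: "int \<Rightarrow> 'a::ab_group_add \<Rightarrow> 'a" where
  "zmul k x = (if k \<ge> 0 then \<Sum>i<nat k. x else - (\<Sum>i<nat (- k). x))"

lemma zmul_0 [simp]: "zmul 0 x = 0" and zmul_1 [simp]: "zmul 1 x = x"
  by (simp_all add: zmul_def)

lemma zmul_succ: "zmul (k + 1) x = zmul k x + x"
proof (cases "k \<ge> 0")
  case True
  then have "nat (k + 1) = Suc (nat k)" by simp
  with True show ?thesis by (simp add: zmul_def)
next
  case False
  then have "nat (- k) = Suc (nat (- (k + 1)))" by simp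
  with False show ?thesis by (simp add: zmul_def)
qed

lemma zmul_pred: "zmul (k - 1) x = zmul k x - x"
  using zmul_succ[of "k - 1" x] by simp

lemma zmul_add: "zmul (j + k) x = zmul j x + zmul k x"
proof (induction k rule: int_induct[where k = 0])
  case (step1 i)
  then show ?case
    using zmul_succ[of "j + i" x] zmul_succ[of i x] by (simp flip: add.assoc)
next
  case (step2 i)
  have "j + (i - 1) = (j + i) - 1" by simp
  then show ?case using zmul_pred[of "j + i" x] zmul_pred[of i x] step2 by (metis add_diff_eq)
qed simp

lemma zmul_minus: "zmul (- k) x = - zmul k x"
  using zmul_add[of "- k" k x] by (simp add: eq_neg_iff_add_eq_0)

lemma zmul_diff: "zmul (j - k) x = zmul j x - zmul k x"
  using zmul_add[of j "- k" x] by (simp add: zmul_minus)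

lemma zmul_mult: "zmul (j * k) x = zmul j (zmul k x)"
proof (induction j rule: int_induct[where k = 0])
  case (step1 i)
  then show ?case by (simp add: distrib_right zmul_add)
next
  case (step2 i)
  then show ?case by (simp add: left_diff_distrib zmul_diff)
qed simp

lemma zmul_zero_right [simp]: "zmul k 0 = 0"
  by (simp add: zmul_def)

lemma zmul_fun_apply: "zmul k f x = zmul k (f x)"
proof (induction k rule: int_induct[where k = 0])
  case (step1 i)
  then show ?case by (simp add: zmul_add)
next
  case (step2 i)
  then show ?case by (simp add: zmul_diff)
qed simp

lemma zmul_qz_of: "zmul k (qz_of x) = qz_of (of_int k * x)"
proof (induction k rule: int_induct[where k = 0])
  case (step1 i)
  then show ?case by (simp add: zmul_add qz_of_add distrib_right)
next
  case (step2 i)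
  then show ?case by (simp add: zmul_diff qz_of_diff left_diff_distrib)
qed (simp add: qz_of_0)

section \<open>Divisibility and torsion of the rationals modulo one\<close>

lemma qz_divisible:
  assumes "m \<noteq> 0"
  obtains y where "zmul m y = (z::qz)"
proof
  show "zmul m (qz_of (qz_rep z / of_int m)) = z"
    using assms by (simp add: zmul_qz_of)
qed

text \<open>The representative \<open>r\<close> in [0,1) of such an element has \<open>n * r\<close>
  integral, and this integer lies in [0,n). Cyclicity is what later turns a character of the torsion
  into a multiplication.\<close>

lemma qz_torsion_cyclic:
  assumes "n > 0" and "zmul n z = (0::qz)"
  shows "\<exists>j. 0 \<le> j \<and> j < n \<and> z = zmul j (qz_of (1 / of_int n))"
proof -
  have "qz_of (of_int n * qz_rep z) = 0"
    using assms(2) zmul_qz_of[of n "qz_rep z"] by simp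
  then obtain j where j: "of_int n * qz_rep z = of_int j"
    by (auto simp: qz_of_eq_0_iff elim: Ints_cases)
  then have rep: "qz_rep z = of_int j * (1 / of_int n)"
    using assms(1) by (simp add: field_simps)
  have "of_int j \<ge> (0::rat)"
    using assms(1) qz_rep_ge_0[of z] by (simp flip: j)
  moreover have "of_int j < (of_int n :: rat)"
    using assms(1) qz_rep_less_1[of z] by (simp flip: j)
  moreover have "z = zmul j (qz_of (1 / of_int n))"
    by (metis zmul_qz_of rep qz_of_rep)
  ultimately show ?thesis by auto
qed

lemma finite_qz_torsion:
  assumes "n > 0"
  shows "finite {z::qz. zmul n z = 0}"
proof (rule finite_subset)
  show "{z::qz. zmul n z = 0} \<subseteq> (\<lambda>j. zmul j (qz_of (1 / of_int n))) ` {0..<n}"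
    using qz_torsion_cyclic[OF assms] by force
qed simp

lemma sum_const_zmul: "(\<Sum>i\<in>A. x) = zmul (int (card A)) x"
  by (induction A rule: infinite_finite_induct) (simp_all add: zmul_add)

text \<open>Translation by \<open>x\<close> permutes the group, so it does not change the sum of all elements.\<close>

lemma zmul_CARD: "zmul (int CARD('m)) (x::'m::{ab_group_add,finite}) = 0"
proof -
  have "(\<Sum>y\<in>UNIV. y) = (\<Sum>y\<in>UNIV. x + y)"
    by (rule sum.reindex_bij_witness[of _ "\<lambda>y. x + y" "\<lambda>y. y - x"]) auto
  also have "\<dots> = zmul (int CARD('m)) x + (\<Sum>y\<in>UNIV. y)"
    by (simp add: sum.distrib sum_const_zmul)
  finally show ?thesis by simp
qed

section \<open>Subgroups, and homomorphisms defined on subgroups\<close>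

definition subgrp :: "'a::ab_group_add set \<Rightarrow> bool" where
  "subgrp H \<longleftrightarrow> 0 \<in> H \<and> (\<forall>x\<in>H. \<forall>y\<in>H. x - y \<in> H)"

lemma subgrpI: "0 \<in> H \<Longrightarrow> (\<And>x y. x \<in> H \<Longrightarrow> y \<in> H \<Longrightarrow> x - y \<in> H) \<Longrightarrow> subgrp H"
  by (simp add: subgrp_def)

lemma subgrp_0: "subgrp H \<Longrightarrow> 0 \<in> H"
  and subgrp_diff: "subgrp H \<Longrightarrow> x \<in> H \<Longrightarrow> y \<in> H \<Longrightarrow> x - y \<in> H"
  by (simp_all add: subgrp_def)

lemma subgrp_minus: "subgrp H \<Longrightarrow> x \<in> H \<Longrightarrow> - x \<in> H"
  using subgrp_diff[of H 0 x] by (simp add: subgrp_0)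

lemma subgrp_add: "subgrp H \<Longrightarrow> x \<in> H \<Longrightarrow> y \<in> H \<Longrightarrow> x + y \<in> H"
  using subgrp_diff[of H x "- y"] by (simp add: subgrp_minus)

lemma subgrp_sum: "subgrp H \<Longrightarrow> (\<And>i. i \<in> A \<Longrightarrow> f i \<in> H) \<Longrightarrow> sum f A \<in> H"
  by (induction A rule: infinite_finite_induct) (auto simp: subgrp_0 subgrp_add)

lemma subgrp_zmul: "subgrp H \<Longrightarrow> x \<in> H \<Longrightarrow> zmul k x \<in> H"
  by (simp add: zmul_def subgrp_sum subgrp_minus)

lemma subgrp_UNIV: "subgrp UNIV"
  by (simp add: subgrp_def)

lemma subgrp_Int: "subgrp H \<Longrightarrow> subgrp K \<Longrightarrow> subgrp (H \<inter> K)"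
  by (simp add: subgrp_def)

lemma subgrp_Times: "subgrp H \<Longrightarrow> subgrp K \<Longrightarrow> subgrp (H \<times> K)"
  by (auto simp: subgrp_def zero_prod_def)

lemmas subgrp_intros = subgrp_0 subgrp_diff subgrp_minus subgrp_add subgrp_sum subgrp_zmul

text \<open>Additivity on \<open>H\<close> only: chain groups are subsets of a function type, and
  the values of boundary maps or pairings at other functions, such as those of infinite support,
  carry no meaning.\<close>

definition hom_on :: "'a::ab_group_add set \<Rightarrow> ('a \<Rightarrow> 'b::ab_group_add) \<Rightarrow> bool" where
  "hom_on H f \<longleftrightarrow> (\<forall>x\<in>H. \<forall>y\<in>H. f (x + y) = f x + f y)"

lemma hom_onI: "(\<And>x y. x \<in> H \<Longrightarrow> y \<in> H \<Longrightarrow> f (x + y) = f x + f y) \<Longrightarrow> hom_on H f"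
  by (simp add: hom_on_def)

lemma hom_on_add: "hom_on H f \<Longrightarrow> x \<in> H \<Longrightarrow> y \<in> H \<Longrightarrow> f (x + y) = f x + f y"
  by (simp add: hom_on_def)

lemma hom_on_mono: "hom_on H f \<Longrightarrow> K \<subseteq> H \<Longrightarrow> hom_on K f"
  unfolding hom_on_def by blast

lemma hom_on_0: "subgrp H \<Longrightarrow> hom_on H f \<Longrightarrow> f 0 = 0"
  using hom_on_add[of H f 0 0] by (simp add: subgrp_0)

lemma hom_on_diff: "subgrp H \<Longrightarrow> hom_on H f \<Longrightarrow> x \<in> H \<Longrightarrow> y \<in> H \<Longrightarrow> f (x - y) = f x - f y"
  using hom_on_add[of H f "x - y" y] by (simp add: subgrp_diff)

lemma hom_on_minus: "subgrp H \<Longrightarrow> hom_on H f \<Longrightarrow> x \<in> H \<Longrightarrow> f (- x) = - f x"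
  using hom_on_diff[of H f 0 x] by (simp add: subgrp_0 hom_on_0)

lemma hom_on_sum:
  assumes "subgrp H" "hom_on H f" "\<And>i. i \<in> A \<Longrightarrow> g i \<in> H"
  shows "f (sum g A) = (\<Sum>i\<in>A. f (g i))"
  using assms(3)
  by (induction A rule: infinite_finite_induct)
    (auto simp: hom_on_0[OF assms(1,2)] hom_on_add[OF assms(2)] subgrp_sum[OF assms(1)])

lemma hom_on_zmul:
  assumes "subgrp H" "hom_on H f" "x \<in> H"
  shows "f (zmul k x) = zmul k (f x)"
  using assms
  by (simp add: zmul_def hom_on_sum hom_on_minus subgrp_sum del: sum_constant)

lemma subgrp_image:
  assumes H: "subgrp H" and f: "hom_on H f"
  shows "subgrp (f ` H)"
proof (rule subgrpI)
  show "0 \<in> f ` H" using hom_on_0[OF H f] subgrp_0[OF H] by (metis imageI)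
  fix u v assume "u \<in> f ` H" "v \<in> f ` H"
  then obtain x y where "u = f x" "v = f y" "x \<in> H" "y \<in> H" by blast
  then show "u - v \<in> f ` H" using hom_on_diff[OF H f, of x y] subgrp_diff[OF H] by (metis imageI)
qed

lemma subgrp_kernel: "subgrp H \<Longrightarrow> hom_on H f \<Longrightarrow> subgrp {x \<in> H. f x = 0}"
  by (rule subgrpI) (auto simp: hom_on_0 hom_on_diff subgrp_intros)

definition adjoin :: "'a::ab_group_add set \<Rightarrow> 'a \<Rightarrow> 'a set" where
  "adjoin H x = {h + zmul k x | h k. h \<in> H}"

lemma adjoin_superset: "H \<subseteq> adjoin H x"
proof
  fix h assume "h \<in> H"
  then have "h = h + zmul 0 x \<and> h \<in> H" by simp
  then show "h \<in> adjoin H x" unfolding adjoin_def by blast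
qed

lemma adjoin_mem: "subgrp H \<Longrightarrow> x \<in> adjoin H x"
proof -
  assume "subgrp H"
  then have "x = 0 + zmul 1 x \<and> 0 \<in> H" by (simp add: subgrp_0)
  then show ?thesis unfolding adjoin_def by blast
qed

lemma subgrp_adjoin:
  assumes "subgrp H"
  shows "subgrp (adjoin H x)"
proof (rule subgrpI)
  show "0 \<in> adjoin H x" using adjoin_superset subgrp_0[OF assms] by blast
next
  fix u v assume "u \<in> adjoin H x" "v \<in> adjoin H x"
  then obtain h k h' k' where "u = h + zmul k x" "v = h' + zmul k' x" "h \<in> H" "h' \<in> H"
    unfolding adjoin_def by blast
  then have "u - v = (h - h') + zmul (k - k') x" "h - h' \<in> H"
    using assms by (simp_all add: zmul_diff subgrp_diff)
  then show "u - v \<in> adjoin H x" unfolding adjoin_def by blast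
qed

lemma adjoin_subset: "subgrp K \<Longrightarrow> H \<subseteq> K \<Longrightarrow> x \<in> K \<Longrightarrow> adjoin H x \<subseteq> K"
  unfolding adjoin_def by (auto intro!: subgrp_add subgrp_zmul)

text \<open>The only candidate sends \<open>h + zmul k x\<close> to \<open>f h + zmul k y\<close>.
  Two such expressions of one element differ by a multiple of \<open>x\<close> that lies in
  \<open>H\<close>, where the assumption on \<open>y\<close> makes the values agree.\<close>

lemma hom_on_extend_adjoin:
  fixes f :: "'a::ab_group_add \<Rightarrow> 'b::ab_group_add"
  assumes H: "subgrp H" and f: "hom_on H f"
    and y: "\<And>k. zmul k x \<in> H \<Longrightarrow> f (zmul k x) = zmul k y"
  obtains f' where "hom_on (adjoin H x) f'" "\<And>h. h \<in> H \<Longrightarrow> f' h = f h" "f' x = y"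
proof -
  define f' where "f' u = (SOME v. \<exists>h k. h \<in> H \<and> u = h + zmul k x \<and> v = f h + zmul k y)" for u
  have f': "f' (h + zmul k x) = f h + zmul k y" if "h \<in> H" for h k
  proof -
    have "\<exists>h' k'. h' \<in> H \<and> h + zmul k x = h' + zmul k' x \<and> f' (h + zmul k x) = f h' + zmul k' y"
      unfolding f'_def by (rule someI_ex) (use that in blast)
    then obtain h' k' where h': "h' \<in> H" and e: "h + zmul k x = h' + zmul k' x"
      and v: "f' (h + zmul k x) = f h' + zmul k' y" by blast
    have d: "h' - h = zmul (k - k') x"
      using e by (simp add: zmul_diff algebra_simps)
    then have "f (h' - h) = zmul (k - k') y"
      using y subgrp_diff[OF H h' that] by metis
    then show ?thesis
      using v hom_on_diff[OF H f h' that] by (simp add: zmul_diff algebra_simps)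
  qed
  show ?thesis
  proof
    show "hom_on (adjoin H x) f'"
    proof (rule hom_onI)
      fix u v assume "u \<in> adjoin H x" "v \<in> adjoin H x"
      then obtain h k h' k' where uv: "u = h + zmul k x" "v = h' + zmul k' x" "h \<in> H" "h' \<in> H"
        unfolding adjoin_def by blast
      then have "u + v = (h + h') + zmul (k + k') x" by (simp add: zmul_add)
      then have "f' (u + v) = f (h + h') + zmul (k + k') y"
        using f' subgrp_add[OF H] uv by metis
      also have "\<dots> = f' u + f' v"
        using uv f' hom_on_add[OF f] by (simp add: zmul_add)
      finally show "f' (u + v) = f' u + f' v" .
    qed
    show "f' h = f h" if "h \<in> H" for h
      using f'[OF that, of 0] by simp
    show "f' x = y"
      using f'[OF subgrp_0[OF H], of 1] hom_on_0[OF H f] by simp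
  qed
qed

text \<open>The integers \<open>k\<close> with \<open>zmul k x\<close> in \<open>H\<close> form an
  ideal, and \<open>m\<close> is its generator; \<open>m = 0\<close> records that no nonzero
  multiple index leads into \<open>H\<close>.\<close>

lemma subgrp_int_generator:
  assumes "subgrp H"
  obtains m where "m \<ge> 0" "\<And>k. zmul k x \<in> H \<longleftrightarrow> m dvd k"
proof (cases "\<exists>k>0. zmul k x \<in> H")
  case True
  define P where "P n \<longleftrightarrow> n > 0 \<and> zmul (int n) x \<in> H" for n
  obtain k where "k > 0" "zmul k x \<in> H" using True by blast
  then have "P (nat k)" by (simp add: P_def)
  define m where "m = (LEAST n. P n)"
  have m: "P m" and least: "\<And>n. P n \<Longrightarrow> m \<le> n"
    unfolding m_def using \<open>P (nat k)\<close> by (auto intro: LeastI Least_le)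
  have "zmul k x \<in> H \<longleftrightarrow> int m dvd k" for k
  proof
    assume "zmul k x \<in> H"
    then have "zmul k x - zmul (k div int m) (zmul (int m) x) \<in> H"
      using m assms by (simp add: P_def subgrp_intros)
    then have r: "zmul (k mod int m) x \<in> H"
      by (simp flip: zmul_mult zmul_diff minus_div_mult_eq_mod)
    have "k mod int m = 0"
    proof (rule ccontr)
      assume "k mod int m \<noteq> 0"
      moreover have "0 < int m" using m by (simp add: P_def)
      ultimately have "k mod int m > 0" using pos_mod_sign[of "int m" k] by linarith
      then have "P (nat (k mod int m))" using r by (simp add: P_def)
      then have "int m \<le> k mod int m" using least \<open>k mod int m > 0\<close> by fastforce
      then show False using pos_mod_bound[of "int m" k] \<open>0 < int m\<close> by linarith
    qed
    then show "int m dvd k" by presburger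
  next
    assume "int m dvd k"
    then obtain j where "k = j * int m" by (metis dvd_def mult.commute)
    then show "zmul k x \<in> H"
      using m assms by (simp add: P_def zmul_mult subgrp_zmul)
  qed
  with that[of "int m"] show ?thesis by simp
next
  case False
  have "zmul k x \<in> H \<longleftrightarrow> 0 dvd k" for k
  proof
    assume k: "zmul k x \<in> H"
    then have "zmul (- k) x \<in> H" using assms by (simp add: zmul_minus subgrp_minus)
    with k False show "0 dvd k" by (metis dvd_0_left_iff linorder_neqE neg_0_less_iff_less)
  qed (use assms in \<open>simp add: subgrp_0\<close>)
  with that[of 0] show ?thesis by simp
qed

text \<open>The rationals modulo one are divisible, hence injective. Zorn's lemma is applied to the
  graphs of partial homomorphisms, which are subgroups of the product.\<close>

lemma extend_character:
  fixes f :: "'a::ab_group_add \<Rightarrow> qz"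
  assumes H: "subgrp H" and f: "hom_on H f"
  obtains F where "hom_on UNIV F" "\<And>x. x \<in> H \<Longrightarrow> F x = f x"
proof -
  \<comment> \<open>For a subgroup of the product, being the graph of a function need only be tested
    over 0.\<close>
  define A where "A = {\<Gamma>. subgrp \<Gamma> \<and> (\<forall>y. (0, y) \<in> \<Gamma> \<longrightarrow> y = 0) \<and> (\<lambda>x. (x, f x)) ` H \<subseteq> \<Gamma>}"
  have graph: "(\<lambda>x. (x, g x)) ` K \<in> A"
    if "subgrp K" "hom_on K g" "H \<subseteq> K" "\<And>x. x \<in> H \<Longrightarrow> g x = f x" for g K
    unfolding A_def
  proof (intro CollectI conjI)
    show "subgrp ((\<lambda>x. (x, g x)) ` K)"
      using that(1,2) by (intro subgrp_image hom_onI) (auto simp: hom_on_add)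
    show "\<forall>y. (0, y) \<in> (\<lambda>x. (x, g x)) ` K \<longrightarrow> y = 0"
      using hom_on_0[OF that(1,2)] by auto
    show "(\<lambda>x. (x, f x)) ` H \<subseteq> (\<lambda>x. (x, g x)) ` K"
      using that(3,4) by (auto simp: image_iff)
  qed
  have "\<exists>\<Gamma>\<in>A. \<forall>X\<in>A. \<Gamma> \<subseteq> X \<longrightarrow> X = \<Gamma>"
  proof (rule subset_Zorn_nonempty)
    show "A \<noteq> {}" using graph[OF H f] by blast
    fix \<C> assume "\<C> \<noteq> {}" and chain: "subset.chain A \<C>"
    show "\<Union>\<C> \<in> A"
      unfolding A_def
    proof (intro CollectI conjI)
      obtain \<Gamma>0 where \<Gamma>0: "\<Gamma>0 \<in> \<C>" using \<open>\<C> \<noteq> {}\<close> by blast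
      have sub: "\<C> \<subseteq> A" using chain by (simp add: subset_chain_def)
      show "subgrp (\<Union>\<C>)"
      proof (rule subgrpI)
        show "0 \<in> \<Union>\<C>" using \<Gamma>0 sub unfolding A_def by (auto intro: subgrp_0)
        fix u v assume "u \<in> \<Union>\<C>" "v \<in> \<Union>\<C>"
        then obtain U V where UV: "U \<in> \<C>" "V \<in> \<C>" "u \<in> U" "v \<in> V" by blast
        then have "U \<subseteq> V \<or> V \<subseteq> U" using chain unfolding subset_chain_def by blast
        then obtain W where "W \<in> \<C>" "u \<in> W" "v \<in> W" using UV by blast
        moreover have "subgrp W" using sub \<open>W \<in> \<C>\<close> unfolding A_def by blast
        ultimately show "u - v \<in> \<Union>\<C>" using subgrp_diff by blast
      qed
      show "\<forall>y. (0, y) \<in> \<Union>\<C> \<longrightarrow> y = 0" using sub unfolding A_def by blast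
      show "(\<lambda>x. (x, f x)) ` H \<subseteq> \<Union>\<C>" using sub \<Gamma>0 unfolding A_def by blast
    qed
  qed
  then obtain \<Gamma> where \<Gamma>: "\<Gamma> \<in> A" and max: "\<And>X. X \<in> A \<Longrightarrow> \<Gamma> \<subseteq> X \<Longrightarrow> X = \<Gamma>" by blast
  have sg: "subgrp \<Gamma>" and sv: "\<And>y. (0, y) \<in> \<Gamma> \<Longrightarrow> y = 0"
    and ext: "\<And>x. x \<in> H \<Longrightarrow> (x, f x) \<in> \<Gamma>"
    using \<Gamma> unfolding A_def by auto
  have uniq: "y = z" if "(x, y) \<in> \<Gamma>" "(x, z) \<in> \<Gamma>" for x y z
    using subgrp_diff[OF sg that] sv[of "y - z"] by simp
  define K where "K = fst ` \<Gamma>"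
  define g where "g x = (THE y. (x, y) \<in> \<Gamma>)" for x
  have g: "g x = y" if "(x, y) \<in> \<Gamma>" for x y
    unfolding g_def using that uniq by blast
  have gK: "(x, g x) \<in> \<Gamma>" if "x \<in> K" for x
    using that g unfolding K_def by force
  have K: "subgrp K"
    unfolding K_def by (rule subgrp_image[OF sg]) (simp add: hom_on_def)
  have homg: "hom_on K g"
  proof (rule hom_onI)
    fix x y assume "x \<in> K" "y \<in> K"
    then show "g (x + y) = g x + g y"
      using g subgrp_add[OF sg gK gK] by fastforce
  qed
  have HK: "H \<subseteq> K" using ext unfolding K_def by force
  have gf: "g x = f x" if "x \<in> H" for x using g ext that by blast
  have "x \<in> K" for x
  proof -
    obtain m where m: "\<And>k. zmul k x \<in> K \<longleftrightarrow> m dvd k" using subgrp_int_generator[OF K] by blast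
    \<comment> \<open>The value \<open>y\<close> at the new element has to satisfy a single
      equation, \<open>zmul m y = g (zmul m x)\<close>, which divisibility solves; for
      \<open>m = 0\<close> there is no constraint and 0 will do.\<close>
    have "\<exists>y. \<forall>k. zmul k x \<in> K \<longrightarrow> g (zmul k x) = zmul k y"
    proof (cases "m = 0")
      case True
      then have "k = 0" if "zmul k x \<in> K" for k using m that by simp
      then have "\<forall>k. zmul k x \<in> K \<longrightarrow> g (zmul k x) = zmul k 0"
        using hom_on_0[OF K homg] by (metis zmul_0)
      then show ?thesis by blast
    next
      case False
      then obtain y where y: "zmul m y = g (zmul m x)" using qz_divisible by blast
      have "g (zmul k x) = zmul k y" if k: "zmul k x \<in> K" for k
      proof -
        obtain j where j: "k = j * m" using k m by (metis dvd_def mult.commute)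
        have "g (zmul k x) = zmul j (g (zmul m x))"
          using hom_on_zmul[OF K homg] m by (simp add: j zmul_mult)
        then show ?thesis by (simp add: j zmul_mult y)
      qed
      then show ?thesis by blast
    qed
    then obtain y where y: "\<And>k. zmul k x \<in> K \<Longrightarrow> g (zmul k x) = zmul k y" by blast
    obtain g' where g': "hom_on (adjoin K x) g'" "\<And>h. h \<in> K \<Longrightarrow> g' h = g h"
      using hom_on_extend_adjoin[OF K homg, of x y] y by blast
    have "(\<lambda>x. (x, g' x)) ` adjoin K x \<in> A"
      by (rule graph[OF subgrp_adjoin[OF K] g'(1)])
        (use HK adjoin_superset[of K x] g'(2) gf in auto)
    moreover have "\<Gamma> \<subseteq> (\<lambda>x. (x, g' x)) ` adjoin K x"
    proof
      fix u assume "u \<in> \<Gamma>"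
      then obtain a b where u: "u = (a, b)" "(a, b) \<in> \<Gamma>" by (cases u) auto
      then have "a \<in> K" unfolding K_def by force
      then have "u = (a, g' a)" using u g g' by auto
      then show "u \<in> (\<lambda>x. (x, g' x)) ` adjoin K x"
        using \<open>a \<in> K\<close> adjoin_superset by blast
    qed
    ultimately have "(\<lambda>x. (x, g' x)) ` adjoin K x = \<Gamma>" by (rule max)
    then show "x \<in> K" using adjoin_mem[OF K, of x] unfolding K_def by force
  qed
  then have "K = UNIV" by blast
  then show ?thesis using that homg gf by blast
qed

lemma separating_character:
  fixes x :: "'a::ab_group_add"
  assumes H: "subgrp H" and x: "x \<notin> H"
  obtains F :: "'a \<Rightarrow> qz" where "hom_on UNIV F" "\<And>h. h \<in> H \<Longrightarrow> F h = 0" "F x \<noteq> 0"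
proof -
  obtain m where m: "m \<ge> 0" "\<And>k. zmul k x \<in> H \<longleftrightarrow> m dvd k"
    using subgrp_int_generator[OF H] by blast
  have "m \<noteq> 1" using m(2)[of 1] x by auto
  \<comment> \<open>\<open>m\<close> is the order of \<open>x\<close> modulo \<open>H\<close>, so
    1/m is nonzero and killed by the right multiples. For infinite order any nonzero value would
    serve; 1/2 is one.\<close>
  define y where "y = qz_of (if m = 0 then 1 / 2 else 1 / of_int m)"
  have "y \<noteq> 0"
  proof
    assume "y = 0"
    then have "(if m = 0 then 1 / 2 else 1 / of_int m :: rat) \<in> \<int>" by (simp add: y_def qz_of_eq_0_iff)
    then obtain j where j: "(if m = 0 then 1 / 2 else 1 / of_int m :: rat) = of_int j"
      by (auto elim: Ints_cases)
    define m' where "m' = (if m = 0 then 2 else m)"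
    have "(1::rat) = of_int (j * m')" using j m(1) by (auto simp: m'_def field_simps split: if_splits)
    then have "j * m' = 1" by (metis of_int_eq_1_iff)
    then have "m' = 1" using m(1) by (auto simp: m'_def zmult_eq_1_iff split: if_splits)
    then show False using \<open>m \<noteq> 1\<close> by (auto simp: m'_def split: if_splits)
  qed
  have y: "zmul k y = 0" if k: "zmul k x \<in> H" for k
  proof -
    have "m dvd k" using k m(2) by simp
    then obtain j where "k = m * j" by (rule dvdE)
    then show ?thesis by (auto simp: y_def zmul_qz_of qz_of_eq_0_iff)
  qed
  have h0: "hom_on H (\<lambda>_. 0 :: qz)" by (simp add: hom_on_def)
  obtain f' :: "'a \<Rightarrow> qz" where f': "hom_on (adjoin H x) f'" "\<And>h. h \<in> H \<Longrightarrow> f' h = 0" "f' x = y"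
  proof (rule hom_on_extend_adjoin[OF H h0, of x y])
    show "0 = zmul k y" if "zmul k x \<in> H" for k using y[OF that] by simp
  qed (rule that)
  obtain F where "hom_on UNIV F" "\<And>u. u \<in> adjoin H x \<Longrightarrow> F u = f' u"
    using extend_character[OF subgrp_adjoin[OF H] f'(1)] by blast
  then show ?thesis
    using that[of F] f' \<open>y \<noteq> 0\<close> adjoin_mem[OF H] adjoin_superset[of H x] by (metis subsetD)
qed

text \<open>Exactness of Hom(-,Q/Z): a character that kills the kernel of \<open>d\<close> descends
  to the image of \<open>d\<close> and extends from there by injectivity.\<close>

lemma character_factors:
  fixes d :: "'a::ab_group_add \<Rightarrow> 'b::ab_group_add" and \<psi> :: "'a \<Rightarrow> qz"
  assumes K: "subgrp K" and d: "hom_on K d" and \<psi>: "hom_on K \<psi>"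
    and ker: "\<And>k. k \<in> K \<Longrightarrow> d k = 0 \<Longrightarrow> \<psi> k = 0"
  obtains F where "hom_on UNIV F" "\<And>k. k \<in> K \<Longrightarrow> \<psi> k = F (d k)"
proof -
  define f where "f = \<psi> \<circ> inv_into K d"
  have f: "f (d k) = \<psi> k" if "k \<in> K" for k
  proof -
    define k' where "k' = inv_into K d (d k)"
    have k': "k' \<in> K" "d k' = d k" using that by (auto simp: k'_def inv_into_into f_inv_into_f)
    then have "\<psi> (k' - k) = 0"
      using ker[of "k' - k"] that K d by (simp add: subgrp_diff hom_on_diff)
    then show ?thesis
      using k' that K \<psi> by (simp add: f_def hom_on_diff flip: k'_def)
  qed
  have "hom_on (d ` K) f"
  proof (rule hom_onI, elim imageE)
    fix x y k l assume "x = d k" "y = d l" "k \<in> K" "l \<in> K"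
    then show "f (x + y) = f x + f y"
      using f[of "k + l"] f K d \<psi> by (simp add: hom_on_add subgrp_add)
  qed
  from extend_character[OF subgrp_image[OF K d] this] that show ?thesis
    using f by (metis imageI)
qed

text \<open>The character (h,b) -> \<xi> h on \<open>H \<times> N\<close> kills the kernel of the
  sum map, whose elements are pairs (h,-h) with h in the intersection, so it factors through the
  sum. \<open>H\<close> and \<open>N\<close> are unrelated because they will be cycles and
  boundaries in a setting where the latter need not be contained in the former.\<close>

lemma extend_character_by_0:
  fixes \<xi> :: "'a::ab_group_add \<Rightarrow> qz"
  assumes H: "subgrp H" and N: "subgrp N" and \<xi>: "hom_on H \<xi>"
    and zero: "\<And>x. x \<in> H \<Longrightarrow> x \<in> N \<Longrightarrow> \<xi> x = 0"
  obtains F where "hom_on UNIV F" "\<And>x. x \<in> H \<Longrightarrow> F x = \<xi> x" "\<And>x. x \<in> N \<Longrightarrow> F x = 0"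
proof -
  have a: "hom_on (H \<times> N) (\<lambda>(h, b). h + b)" by (auto simp: hom_on_def algebra_simps)
  have b: "hom_on (H \<times> N) (\<lambda>(h, b). \<xi> h)" using \<xi> by (auto simp: hom_on_def)
  have c: "(case k of (h, b) \<Rightarrow> \<xi> h) = 0"
    if "k \<in> H \<times> N" "(case k of (h, b) \<Rightarrow> h + b) = 0" for k
  proof -
    from that(1) obtain h b where k: "k = (h, b)" "h \<in> H" "b \<in> N" by blast
    then have "h = - b" using that(2) by (simp add: eq_neg_iff_add_eq_0)
    then show ?thesis using k zero N by (simp add: subgrp_minus)
  qed
  obtain F where F: "hom_on UNIV F"
    "\<And>k. k \<in> H \<times> N \<Longrightarrow> (case k of (h, b) \<Rightarrow> \<xi> h) = F (case k of (h, b) \<Rightarrow> h + b)"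
    using character_factors[OF subgrp_Times[OF H N] a b c] by blast
  show ?thesis
  proof (rule that[OF F(1)])
    show "F x = \<xi> x" if "x \<in> H" for x
      using F(2)[of "(x, 0)"] that N by (simp add: subgrp_0)
    show "F x = 0" if "x \<in> N" for x
      using F(2)[of "(0, x)"] that H \<xi> by (simp add: subgrp_0 hom_on_0)
  qed
qed

text \<open>By factoring, \<open>\<psi>\<close> is \<open>F\<close> after \<open>\<xi>\<close>. All
  values of \<open>\<xi>\<close> are multiples of 1/n, and \<open>F\<close> sends 1/n to an
  \<open>n\<close>-torsion element, hence to some multiple \<open>j\<close> of 1/n; this
  \<open>j\<close> works for all values at once.\<close>

lemma character_multiple:
  fixes \<xi> \<psi> :: "'a::ab_group_add \<Rightarrow> qz"
  assumes K: "subgrp K" and \<xi>: "hom_on K \<xi>" and \<psi>: "hom_on K \<psi>"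
    and n: "n > 0" and tors: "\<And>k. k \<in> K \<Longrightarrow> zmul n (\<xi> k) = 0"
    and ker: "\<And>k. k \<in> K \<Longrightarrow> \<xi> k = 0 \<Longrightarrow> \<psi> k = 0"
  obtains j where "\<And>k. k \<in> K \<Longrightarrow> \<psi> k = zmul j (\<xi> k)"
proof -
  obtain F where F: "hom_on UNIV F" "\<And>k. k \<in> K \<Longrightarrow> \<psi> k = F (\<xi> k)"
    using character_factors[OF K \<xi> \<psi> ker] by blast
  note F_zmul = hom_on_zmul[OF subgrp_UNIV F(1) UNIV_I]
  define z where "z = qz_of (1 / of_int n)"
  have "zmul n z = 0" using n by (simp add: z_def zmul_qz_of qz_of_eq_0_iff)
  then have "zmul n (F z) = 0"
    using F_zmul[of n z] hom_on_0[OF subgrp_UNIV F(1)] by simp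
  then obtain j where j: "F z = zmul j z" using qz_torsion_cyclic[OF n] unfolding z_def by blast
  show ?thesis
  proof (rule that)
    fix k assume k: "k \<in> K"
    then obtain s where s: "\<xi> k = zmul s z" using qz_torsion_cyclic[OF n tors] unfolding z_def by blast
    show "\<psi> k = zmul j (\<xi> k)"
      using F(2)[OF k] j by (simp add: s F_zmul mult.commute flip: zmul_mult)
  qed
qed

text \<open>The characters \<open>P i\<close> are finite in number only after restriction to
  \<open>K\<close>, while additivity in \<open>i\<close> lets sums and multiples of characters be
  formed on indices. The induction runs over a finite set \<open>S\<close> of indices such that
  \<open>\<psi>\<close> vanishes on their common kernel.\<close>

lemma character_in_finite_family:
  fixes P :: "'i::ab_group_add \<Rightarrow> 'a::ab_group_add \<Rightarrow> qz"
  assumes K: "subgrp K" and I: "subgrp I"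
    and homK: "\<And>i. i \<in> I \<Longrightarrow> hom_on K (P i)" and homI: "\<And>k. k \<in> K \<Longrightarrow> hom_on I (\<lambda>i. P i k)"
    and n: "n > 0" and tors: "\<And>i k. i \<in> I \<Longrightarrow> k \<in> K \<Longrightarrow> zmul n (P i k) = 0"
    and fin: "finite ((\<lambda>i. restrict (P i) K) ` I)"
    and \<psi>: "hom_on K \<psi>" and van: "\<And>k. k \<in> K \<Longrightarrow> (\<And>i. i \<in> I \<Longrightarrow> P i k = 0) \<Longrightarrow> \<psi> k = 0"
  obtains i where "i \<in> I" "\<And>k. k \<in> K \<Longrightarrow> \<psi> k = P i k"
proof -
  have step: "\<exists>i\<in>I. \<forall>k\<in>K. \<psi> k = P i k"
    if "finite S" "S \<subseteq> I" "hom_on K \<psi>" "\<And>k. k \<in> K \<Longrightarrow> (\<forall>i\<in>S. P i k = 0) \<Longrightarrow> \<psi> k = 0" for S \<psi>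
    using that
  proof (induction S arbitrary: \<psi> rule: finite_induct)
    case empty
    then show ?case using hom_on_0[OF I homI] subgrp_0[OF I] by (intro bexI[of _ 0]) auto
  next
    case (insert s S)
    \<comment> \<open>On the common kernel of the remaining indices, \<open>\<psi>\<close> kills the
      kernel of \<open>P s\<close>, so there it is a multiple of \<open>P s\<close>. Subtracting
      this multiple on all of \<open>K\<close> leaves a character that vanishes on
      \<open>K1\<close>, and \<open>s\<close> is gone.\<close>
    define K1 where "K1 = {k \<in> K. \<forall>i\<in>S. P i k = 0}"
    have s: "s \<in> I" using insert.prems by simp
    have K1: "subgrp K1" and K1K: "K1 \<subseteq> K"
      using K insert.prems(1) homK unfolding K1_def
      by (auto intro!: subgrpI simp: subgrp_0 subgrp_diff hom_on_0 hom_on_diff subset_iff)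
    obtain j where j: "\<And>k. k \<in> K1 \<Longrightarrow> \<psi> k = zmul j (P s k)"
    proof (rule character_multiple[OF K1 _ _ n])
      show "hom_on K1 (P s)" "hom_on K1 \<psi>"
        using hom_on_mono[OF _ K1K] homK[OF s] insert.prems by auto
      show "zmul n (P s k) = 0" if "k \<in> K1" for k using tors s that K1K by blast
      show "\<psi> k = 0" if "k \<in> K1" "P s k = 0" for k
        using that insert.prems(3)[of k] unfolding K1_def by auto
    qed (rule that)
    define t where "t = zmul j s"
    have t: "t \<in> I" using s I by (simp add: t_def subgrp_zmul)
    have "\<exists>i\<in>I. \<forall>k\<in>K. \<psi> k - P t k = P i k"
    proof (rule insert.IH)
      show "hom_on K (\<lambda>k. \<psi> k - P t k)"
        using insert.prems(2) homK[OF t] by (simp add: hom_on_def algebra_simps)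
      show "\<psi> k - P t k = 0" if "k \<in> K" "\<forall>i\<in>S. P i k = 0" for k
        using j[of k] that hom_on_zmul[OF I homI[OF that(1)] s] unfolding K1_def t_def by simp
    qed (use insert.prems in auto)
    then obtain i where i: "i \<in> I" "\<And>k. k \<in> K \<Longrightarrow> \<psi> k - P t k = P i k" by blast
    have "\<psi> k = P (i + t) k" if "k \<in> K" for k
      using i(2)[OF that] hom_on_add[OF homI[OF that] i(1) t] by (simp add: algebra_simps)
    then show ?case using subgrp_add[OF I i(1) t] by blast
  qed
  \<comment> \<open>One index per restriction suffices, since vanishing at a point of
    \<open>K\<close> depends on the restriction only.\<close>
  obtain S where S: "S \<subseteq> I" "finite S" "(\<lambda>i. restrict (P i) K) ` I = (\<lambda>i. restrict (P i) K) ` S"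
    using finite_subset_image[OF fin subset_refl] by metis
  have "\<psi> k = 0" if k: "k \<in> K" and S0: "\<forall>i\<in>S. P i k = 0" for k
  proof (rule van[OF k])
    fix i assume "i \<in> I"
    then obtain s where "s \<in> S" "restrict (P i) K = restrict (P s) K" using S(3) by blast
    then show "P i k = 0" using S0 k by (metis restrict_apply')
  qed
  then show ?thesis using step[OF S(2,1) \<psi>] that by blast
qed

text \<open>Finite index, with neither \<open>N\<close> nor the representatives required to lie in
  \<open>K\<close>; passing to a smaller \<open>K\<close> is then immediate.\<close>

definition fin_mod :: "'a::ab_group_add set \<Rightarrow> 'a set \<Rightarrow> bool" where
  "fin_mod K N \<longleftrightarrow> (\<exists>S. finite S \<and> (\<forall>k\<in>K. \<exists>s\<in>S. k - s \<in> N))"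

lemma fin_modI: "finite S \<Longrightarrow> (\<And>k. k \<in> K \<Longrightarrow> \<exists>s\<in>S. k - s \<in> N) \<Longrightarrow> fin_mod K N"
  unfolding fin_mod_def by blast

lemma fin_mod_mono: "fin_mod K N \<Longrightarrow> L \<subseteq> K \<Longrightarrow> fin_mod L N"
  unfolding fin_mod_def by blast

text \<open>Each representative that is used at all is traded for an element of \<open>K\<close> in
  the same class modulo \<open>N\<close>.\<close>

lemma fin_modE:
  assumes "fin_mod K N" "subgrp N"
  obtains S where "finite S" "S \<subseteq> K" "\<And>k. k \<in> K \<Longrightarrow> \<exists>s\<in>S. k - s \<in> N"
proof -
  obtain S where S: "finite S" "\<And>k. k \<in> K \<Longrightarrow> \<exists>s\<in>S. k - s \<in> N"
    using assms(1) unfolding fin_mod_def by blast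
  define T where "T = {s \<in> S. \<exists>k\<in>K. k - s \<in> N}"
  define r where "r s = (SOME k. k \<in> K \<and> k - s \<in> N)" for s
  have r: "r s \<in> K \<and> r s - s \<in> N" if "s \<in> T" for s
    unfolding r_def by (rule someI_ex) (use that T_def in blast)
  show ?thesis
  proof
    show "finite (r ` T)" using S(1) by (simp add: T_def)
    show "r ` T \<subseteq> K" using r by blast
    fix k assume "k \<in> K"
    then obtain s where s: "s \<in> S" "k - s \<in> N" using S(2) by blast
    then have "s \<in> T" using \<open>k \<in> K\<close> unfolding T_def by blast
    then have "(k - s) - (r s - s) \<in> N" using s r assms(2) by (blast intro: subgrp_diff)
    then show "\<exists>t\<in>r ` T. k - t \<in> N" using \<open>s \<in> T\<close> by auto
  qed
qed

text \<open>Multiples of \<open>a\<close> may be reduced modulo \<open>n\<close>, so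
  \<open>n\<close> translates of the old representatives are enough.\<close>

lemma fin_mod_adjoin:
  assumes "fin_mod A N" "n > 0" "zmul n a = 0"
  shows "fin_mod (adjoin A a) N"
proof -
  obtain S where S: "finite S" "\<And>k. k \<in> A \<Longrightarrow> \<exists>s\<in>S. k - s \<in> N"
    using assms(1) unfolding fin_mod_def by blast
  show ?thesis
  proof (rule fin_modI[of "(\<lambda>(s, j). s + zmul j a) ` (S \<times> {0..<n})"])
    fix k assume "k \<in> adjoin A a"
    then obtain h j where h: "h \<in> A" "k = h + zmul j a" unfolding adjoin_def by blast
    have "zmul j a = zmul ((j div n) * n + j mod n) a" by simp
    also have "\<dots> = zmul (j mod n) a" unfolding zmul_add zmul_mult using assms(3) by simp
    finally have j: "zmul j a = zmul (j mod n) a" .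
    obtain s where s: "s \<in> S" "h - s \<in> N" using S h by blast
    then have "(s, j mod n) \<in> S \<times> {0..<n}" using assms(2) by simp
    moreover have "k - (s + zmul (j mod n) a) \<in> N" using s h j by simp
    ultimately show "\<exists>s\<in>(\<lambda>(s, j). s + zmul j a) ` (S \<times> {0..<n}). k - s \<in> N" by force
  qed (use S in simp)
qed

text \<open>Subtracting a chosen preimage of \<open>\<xi> k\<close> moves \<open>k\<close> into the
  kernel, and only finitely many preimages have to be chosen.\<close>

lemma fin_mod_kernel:
  assumes L: "subgrp L" and \<xi>: "hom_on L \<xi>" and fin: "finite (\<xi> ` L)"
    and ker: "fin_mod {x \<in> L. \<xi> x = 0} N"
  shows "fin_mod L N"
proof -
  obtain S where S: "finite S" "\<And>k. k \<in> L \<Longrightarrow> \<xi> k = 0 \<Longrightarrow> \<exists>s\<in>S. k - s \<in> N"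
    using ker unfolding fin_mod_def by blast
  show ?thesis
  proof (rule fin_modI[of "(\<lambda>(s, v). s + inv_into L \<xi> v) ` (S \<times> \<xi> ` L)"])
    fix k assume k: "k \<in> L"
    define l where "l = inv_into L \<xi> (\<xi> k)"
    have l: "l \<in> L" "\<xi> l = \<xi> k" using k by (auto simp: l_def inv_into_into f_inv_into_f)
    then obtain s where s: "s \<in> S" "(k - l) - s \<in> N"
      using S(2)[of "k - l"] k by (auto simp: subgrp_diff[OF L] hom_on_diff[OF L \<xi>])
    then have "k - (s + l) \<in> N" by (simp add: algebra_simps)
    then show "\<exists>s\<in>(\<lambda>(s, v). s + inv_into L \<xi> v) ` (S \<times> \<xi> ` L). k - s \<in> N"
      using s(1) k by (force simp: l_def)
  qed (use S fin in simp)
qed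

text \<open>An infinite group of finite exponent is not its own double dual. Elements \<open>a i\<close> and characters
  \<open>\<xi> i\<close> are chosen recursively so that \<open>\<xi> i (a j) \<noteq> 0\<close> exactly for \<open>i = j\<close>; the functional is the
  formal infinite sum of the \<open>a i\<close>, defined where that sum is finite and then extended.\<close>

lemma non_evaluation_functional:
  fixes K N :: "'a::ab_group_add set"
  assumes K: "subgrp K" and N: "subgrp N" and NK: "N \<subseteq> K"
    and n: "n > 0" and tors: "\<And>x. x \<in> K \<Longrightarrow> zmul n x = 0" and inf: "\<not> fin_mod K N"
  obtains F :: "('a \<Rightarrow> qz) \<Rightarrow> qz" where "hom_on UNIV F"
    "\<forall>\<xi>. (\<forall>x\<in>K. \<xi> x = 0) \<longrightarrow> F \<xi> = 0"
    "\<forall>a\<in>K. \<exists>\<xi>. hom_on UNIV \<xi> \<and> (\<forall>x\<in>N. \<xi> x = 0) \<and> F \<xi> \<noteq> \<xi> a"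
proof -
  \<comment> \<open>\<open>A\<close> is the part spanned so far, finite modulo \<open>N\<close>;
    \<open>L\<close> is the part on which all characters chosen so far vanish, still infinite modulo
    \<open>N\<close>.\<close>
  define I where "I A L \<longleftrightarrow> subgrp A \<and> N \<subseteq> A \<and> A \<subseteq> K \<and> fin_mod A N \<and>
    subgrp L \<and> L \<subseteq> K \<and> \<not> fin_mod L N" for A L
  define P where "P \<equiv> \<lambda>(A, L, a, \<xi> :: 'a \<Rightarrow> qz). I A L \<and> a \<in> L \<and> hom_on UNIV \<xi> \<and>
    (\<forall>x\<in>A. \<xi> x = 0) \<and> \<xi> a \<noteq> 0"
  define Q where "Q \<equiv> \<lambda>(A :: 'a set, L, a, \<xi> :: 'a \<Rightarrow> qz) (A', L', a' :: 'a, \<xi>' :: 'a \<Rightarrow> qz).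
    A' = adjoin A a \<and> L' = {x \<in> L. \<xi> x = 0}"
  have choice: "\<exists>a \<xi>. P (A, L, a, \<xi>)" if "I A L" for A L
  proof -
    \<comment> \<open>Being infinite modulo \<open>N\<close>, \<open>L\<close> cannot fit into
      \<open>A\<close>. An element of \<open>L\<close> outside \<open>A\<close> is then separated
      from \<open>A\<close> by a character.\<close>
    have "\<not> L \<subseteq> A" using that fin_mod_mono unfolding I_def by blast
    then obtain a where a: "a \<in> L" "a \<notin> A" by blast
    have "subgrp A" using that unfolding I_def by blast
    from separating_character[OF this a(2)] a(1) that show ?thesis
      unfolding P_def prod.case by metis
  qed
  have "\<exists>f. \<forall>k::nat. P (f k) \<and> Q (f k) (f (Suc k))"
  proof (rule dependent_nat_choice)
    have "fin_mod N N" by (rule fin_modI[of "{0}"]) auto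
    then have "I N K" using assms unfolding I_def by blast
    then show "\<exists>x. P x" using choice by blast
  next
    fix x and k :: nat assume x: "P x"
    obtain A L a \<xi> where xe: "x = (A, L, a, \<xi>)" by (cases x) auto
    have i: "I A L" "a \<in> L" "hom_on UNIV \<xi>" using x unfolding xe P_def by auto
    have aK: "a \<in> K" using i unfolding I_def by blast
    have LK: "subgrp L" "L \<subseteq> K" "\<not> fin_mod L N" using i unfolding I_def by auto
    have \<xi>L: "hom_on L \<xi>" using hom_on_mono[OF i(3)] by simp
    \<comment> \<open>Exponent \<open>n\<close> leaves only finitely many values on
      \<open>L\<close>, so the kernel of \<open>\<xi>\<close> in \<open>L\<close> stays infinite
      modulo \<open>N\<close> and the recursion can go on.\<close>
    have "\<xi> ` L \<subseteq> {z. zmul n z = 0}"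
    proof clarify
      fix l assume "l \<in> L"
      then have "\<xi> (zmul n l) = \<xi> 0" using tors LK by auto
      then show "zmul n (\<xi> l) = 0"
        using hom_on_zmul[OF LK(1) \<xi>L \<open>l \<in> L\<close>] hom_on_0[OF LK(1) \<xi>L] by simp
    qed
    then have "finite (\<xi> ` L)" using finite_qz_torsion[OF n] finite_subset by blast
    then have "\<not> fin_mod {x \<in> L. \<xi> x = 0} N"
      using fin_mod_kernel[OF LK(1) \<xi>L] LK(3) by blast
    moreover have "subgrp {x \<in> L. \<xi> x = 0}" using subgrp_kernel[OF LK(1) \<xi>L] .
    moreover have "fin_mod (adjoin A a) N"
      using fin_mod_adjoin[OF _ n tors[OF aK]] i(1) unfolding I_def by blast
    moreover have "subgrp (adjoin A a)" "N \<subseteq> adjoin A a" "adjoin A a \<subseteq> K"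
      using i(1) aK subgrp_adjoin adjoin_superset[of A a] adjoin_subset[OF K] unfolding I_def by blast+
    ultimately have "I (adjoin A a) {x \<in> L. \<xi> x = 0}" using LK unfolding I_def by blast
    from choice[OF this] obtain a' \<xi>' where "P (adjoin A a, {x \<in> L. \<xi> x = 0}, a', \<xi>')" by blast
    moreover have "Q x (adjoin A a, {x \<in> L. \<xi> x = 0}, a', \<xi>')"
      unfolding xe Q_def by simp
    ultimately show "\<exists>y. P y \<and> Q x y" by blast
  qed
  then obtain f where f: "\<And>k. P (f k)" "\<And>k. Q (f k) (f (Suc k))" by blast
  define A where "A k = fst (f k)" for k
  define L where "L k = fst (snd (f k))" for k
  define a where "a k = fst (snd (snd (f k)))" for k
  define \<xi> where "\<xi> k = snd (snd (snd (f k)))" for k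
  have Pk: "I (A k) (L k)" "a k \<in> L k" "hom_on UNIV (\<xi> k)" "\<And>x. x \<in> A k \<Longrightarrow> \<xi> k x = 0"
    "\<xi> k (a k) \<noteq> 0" for k
    using f(1)[of k] unfolding A_def L_def a_def \<xi>_def P_def by (auto split: prod.splits)
  have Qk: "A (Suc k) = adjoin (A k) (a k)" "L (Suc k) = {x \<in> L k. \<xi> k x = 0}" for k
    using f(2)[of k] unfolding A_def L_def a_def \<xi>_def Q_def by (auto split: prod.splits)
  have Asub: "subgrp (A k)" "N \<subseteq> A k" "L k \<subseteq> K" for k using Pk(1)[of k] unfolding I_def by auto
  have Amono: "A i \<subseteq> A j" if "i \<le> j" for i j
    by (rule lift_Suc_mono_le[of A, OF _ that]) (simp add: Qk adjoin_superset)
  have Lmono: "L j \<subseteq> L i" if "i \<le> j" for i j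
    by (rule lift_Suc_antimono_le[of L, OF _ that]) (auto simp: Qk)
  have aA: "a i \<in> A j" if "i < j" for i j
    using Amono[of "Suc i" j] that adjoin_mem[OF Asub(1)] by (auto simp: Qk)
  \<comment> \<open>For \<open>j < i\<close> the element \<open>a j\<close> lies in
    \<open>A i\<close>, which \<open>\<xi> i\<close> kills; for \<open>j > i\<close> it lies in
    \<open>L (Suc i)\<close>, the kernel of \<open>\<xi> i\<close>.\<close>
  have ortho: "\<xi> i (a j) = 0" if "i \<noteq> j" for i j
  proof (cases "j < i")
    case True
    then show ?thesis using Pk(4) aA by blast
  next
    case False
    then have "a j \<in> L (Suc i)" using that Lmono[of "Suc i" j] Pk(2)[of j] by auto
    then show ?thesis by (simp add: Qk)
  qed
  define H where "H = {\<xi>::'a \<Rightarrow> qz. finite {i. \<xi> (a i) \<noteq> 0}}"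
  define F0 where "F0 \<xi> = (\<Sum>i | \<xi> (a i) \<noteq> 0. \<xi> (a i))" for \<xi> :: "'a \<Rightarrow> qz"
  have H: "subgrp H"
  proof (rule subgrpI)
    show "0 \<in> H" by (simp add: H_def)
    fix \<alpha> \<beta> assume "\<alpha> \<in> H" "\<beta> \<in> H"
    moreover have "{i. (\<alpha> - \<beta>) (a i) \<noteq> 0} \<subseteq> {i. \<alpha> (a i) \<noteq> 0} \<union> {i. \<beta> (a i) \<noteq> 0}" by auto
    ultimately show "\<alpha> - \<beta> \<in> H" unfolding H_def using finite_subset by blast
  qed
  have "hom_on H F0"
  proof (rule hom_onI)
    fix \<alpha> \<beta> assume ab: "\<alpha> \<in> H" "\<beta> \<in> H"
    define U where "U = {i. \<alpha> (a i) \<noteq> 0} \<union> {i. \<beta> (a i) \<noteq> 0}"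
    have U: "finite U" using ab by (simp add: U_def H_def)
    have *: "F0 \<gamma> = (\<Sum>i\<in>U. \<gamma> (a i))" if "{i. \<gamma> (a i) \<noteq> 0} \<subseteq> U" for \<gamma>
      unfolding F0_def by (rule sum.mono_neutral_left[OF U that]) auto
    show "F0 (\<alpha> + \<beta>) = F0 \<alpha> + F0 \<beta>"
      by (subst (1 2 3) *) (auto simp: U_def sum.distrib)
  qed
  from extend_character[OF H this] obtain F where F: "hom_on UNIV F" "\<And>\<alpha>. \<alpha> \<in> H \<Longrightarrow> F \<alpha> = F0 \<alpha>"
    by blast
  have F_null: "F \<alpha> = 0" if "\<And>i. \<alpha> (a i) = 0" for \<alpha>
    using F(2)[of \<alpha>] that by (simp add: H_def F0_def)
  show ?thesis
  proof (rule that[OF F(1)])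
    show "\<forall>\<alpha>. (\<forall>x\<in>K. \<alpha> x = 0) \<longrightarrow> F \<alpha> = 0"
      using Pk(2) Asub(3) F_null by blast
    show "\<forall>b\<in>K. \<exists>\<xi>. hom_on UNIV \<xi> \<and> (\<forall>x\<in>N. \<xi> x = 0) \<and> F \<xi> \<noteq> \<xi> b"
    proof
      fix b assume "b \<in> K"
      show "\<exists>\<xi>. hom_on UNIV \<xi> \<and> (\<forall>x\<in>N. \<xi> x = 0) \<and> F \<xi> \<noteq> \<xi> b"
      \<comment> \<open>If \<open>b\<close> lies in \<open>A k\<close>, then \<open>\<xi> k\<close>
        kills it although \<open>F (\<xi> k) = \<xi> k (a k)\<close> is nonzero. Any other
        \<open>b\<close> is separated from the union by a character that kills every
        \<open>a i\<close>, so that \<open>F\<close> vanishes on it.\<close>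
      proof (cases "b \<in> (\<Union>k. A k)")
        case True
        then obtain k where k: "b \<in> A k" by blast
        have "i = k" if "\<xi> k (a i) \<noteq> 0" for i using ortho[of k i] that by auto
        then have "{i. \<xi> k (a i) \<noteq> 0} = {k}" using Pk(5)[of k] by auto
        then have "F (\<xi> k) = \<xi> k (a k)" using F(2)[of "\<xi> k"] by (simp add: H_def F0_def)
        then have "F (\<xi> k) \<noteq> \<xi> k b" using Pk(4,5) k by metis
        moreover have "\<forall>x\<in>N. \<xi> k x = 0" using Pk(4) Asub(2) by blast
        ultimately show ?thesis using Pk(3) by blast
      next
        case False
        have "subgrp (\<Union>k. A k)"
        proof (rule subgrpI)
          show "0 \<in> (\<Union>k. A k)" using Asub(1) subgrp_0 by blast
          fix x y assume "x \<in> (\<Union>k. A k)" "y \<in> (\<Union>k. A k)"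
          then obtain i j where "x \<in> A i" "y \<in> A j" by blast
          then have "x \<in> A (max i j)" "y \<in> A (max i j)"
            using Amono[of i "max i j"] Amono[of j "max i j"] by auto
          then show "x - y \<in> (\<Union>k. A k)" using subgrp_diff[OF Asub(1)] by blast
        qed
        from separating_character[OF this False] obtain \<alpha> :: "'a \<Rightarrow> qz" where
          \<alpha>: "hom_on UNIV \<alpha>" "\<And>x. x \<in> (\<Union>k. A k) \<Longrightarrow> \<alpha> x = 0" "\<alpha> b \<noteq> 0" by blast
        have "F \<alpha> = 0" using \<alpha>(2) aA by (intro F_null) blast
        then show ?thesis using \<alpha> Asub(2) by (metis UN_I UNIV_I subsetD)
      qed
    qed
  qed
qed

section \<open>Complexes and their duals\<close>

text \<open>\<open>Y\<close> is the group of all characters of \<open>X\<close>. Quantifying over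
  characters of the whole type is enough, as every character of \<open>X\<close> extends by
  injectivity; the last clause makes the representing element unique.\<close>

definition full_dual :: "'x::ab_group_add set \<Rightarrow> 'y::ab_group_add set \<Rightarrow> ('x \<Rightarrow> 'y \<Rightarrow> qz) \<Rightarrow> bool" where
  "full_dual X Y p \<longleftrightarrow> subgrp X \<and> subgrp Y \<and>
     (\<forall>y\<in>Y. hom_on X (\<lambda>x. p x y)) \<and> (\<forall>x\<in>X. hom_on Y (p x)) \<and>
     (\<forall>F. hom_on UNIV F \<longrightarrow> (\<exists>y\<in>Y. \<forall>x\<in>X. p x y = F x)) \<and>
     (\<forall>y\<in>Y. (\<forall>x\<in>X. p x y = 0) \<longrightarrow> y = 0)"

lemma full_dualD:
  assumes "full_dual X Y p"
  shows "subgrp X" "subgrp Y" "y \<in> Y \<Longrightarrow> hom_on X (\<lambda>x. p x y)" "x \<in> X \<Longrightarrow> hom_on Y (p x)"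
    "hom_on UNIV F \<Longrightarrow> \<exists>y\<in>Y. \<forall>x\<in>X. p x y = F x"
    "y \<in> Y \<Longrightarrow> (\<And>x. x \<in> X \<Longrightarrow> p x y = 0) \<Longrightarrow> y = 0"
  using assms by (simp_all add: full_dual_def)

text \<open>The pairing determines \<open>e y\<close>, and both sides of the additivity equation
  pair equally with every \<open>x\<close>.\<close>

lemma full_dual_adjoint_hom:
  assumes XY: "full_dual X Y p" and XY': "full_dual X' Y' p'"
    and d: "\<And>x. x \<in> X \<Longrightarrow> d x \<in> X'" and e: "\<And>y. y \<in> Y' \<Longrightarrow> e y \<in> Y"
    and adj: "\<And>x y. x \<in> X \<Longrightarrow> y \<in> Y' \<Longrightarrow> p' (d x) y = p x (e y)"
  shows "hom_on Y' e"
proof (rule hom_onI)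
  fix y z assume yz: "y \<in> Y'" "z \<in> Y'"
  note D = full_dualD[OF XY] and D' = full_dualD[OF XY']
  have yz': "y + z \<in> Y'" using yz D'(2) by (rule_tac subgrp_add)
  have "e (y + z) - (e y + e z) = 0"
  proof (rule D(6))
    show "e (y + z) - (e y + e z) \<in> Y" using e yz yz' D(2) by (simp add: subgrp_intros)
    fix x assume x: "x \<in> X"
    have "p x (e (y + z) - (e y + e z)) = p x (e (y + z)) - (p x (e y) + p x (e z))"
      using e yz yz' D(2) by (simp add: hom_on_diff[OF D(2) D(4)[OF x]] hom_on_add[OF D(4)[OF x]] subgrp_add)
    also have "\<dots> = 0"
      using yz yz' x d by (simp add: hom_on_add[OF D'(4)] flip: adj)
    finally show "p x (e (y + z) - (e y + e z)) = 0" .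
  qed
  then show "e (y + z) = e y + e z" by simp
qed

text \<open>A degree with its two neighbours: the maps go from \<open>X1\<close> through
  \<open>X0\<close> to \<open>Xm\<close>, their adjoints the opposite way. Homology is read as
  cycles modulo those boundaries that are cycles.\<close>

locale dual_complex =
  fixes X1 X0 Xm :: "'x::ab_group_add set" and d1 d0 :: "'x \<Rightarrow> 'x"
    and Y1 Y0 Ym :: "'y::ab_group_add set" and e1 e0 :: "'y \<Rightarrow> 'y"
    and p1 p0 pm :: "'x \<Rightarrow> 'y \<Rightarrow> qz"
  assumes dual1: "full_dual X1 Y1 p1" and dual0: "full_dual X0 Y0 p0" and dualm: "full_dual Xm Ym pm"
    and d1_mem: "x \<in> X1 \<Longrightarrow> d1 x \<in> X0" and d0_mem: "x \<in> X0 \<Longrightarrow> d0 x \<in> Xm"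
    and d1_hom: "hom_on X1 d1" and d0_hom: "hom_on X0 d0"
    and e1_mem: "y \<in> Y0 \<Longrightarrow> e1 y \<in> Y1" and e0_mem: "y \<in> Ym \<Longrightarrow> e0 y \<in> Y0"
    and adj1: "x \<in> X1 \<Longrightarrow> y \<in> Y0 \<Longrightarrow> p0 (d1 x) y = p1 x (e1 y)"
    and adj0: "x \<in> X0 \<Longrightarrow> y \<in> Ym \<Longrightarrow> pm (d0 x) y = p0 x (e0 y)"
begin

definition "ZX = {x \<in> X0. d0 x = 0}"
definition "BX = d1 ` X1"
definition "ZY = {y \<in> Y0. e1 y = 0}"
definition "BY = e0 ` Ym"

lemma e0_hom: "hom_on Ym e0"
  by (rule full_dual_adjoint_hom[OF dual0 dualm, of d0]) (auto simp: d0_mem e0_mem adj0)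

lemma subgrp_ZX: "subgrp ZX" and subgrp_BX: "subgrp BX"
  and subgrp_BY: "subgrp BY"
  unfolding ZX_def BX_def BY_def
  using subgrp_kernel subgrp_image full_dualD(1,2) dual1 dual0 dualm d1_hom d0_hom e0_hom
  by metis+

lemma ZX_sub: "ZX \<subseteq> X0" and BX_sub: "BX \<subseteq> X0" and ZY_sub: "ZY \<subseteq> Y0" and BY_sub: "BY \<subseteq> Y0"
  unfolding ZX_def BX_def ZY_def BY_def using d1_mem e0_mem by auto

lemma pair_left: "y \<in> Y0 \<Longrightarrow> hom_on X0 (\<lambda>x. p0 x y)" and pair_right: "x \<in> X0 \<Longrightarrow> hom_on Y0 (p0 x)"
  using full_dualD(3,4)[OF dual0] by auto

lemma pair_BX_ZY: "x \<in> BX \<Longrightarrow> y \<in> ZY \<Longrightarrow> p0 x y = 0"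
  unfolding BX_def ZY_def
  using adj1 hom_on_0[OF full_dualD(2)[OF dual1] full_dualD(4)[OF dual1]] by auto

lemma pair_ZX_BY: "x \<in> ZX \<Longrightarrow> y \<in> BY \<Longrightarrow> p0 x y = 0"
  unfolding BY_def ZX_def
  using hom_on_0[OF full_dualD(1)[OF dualm] full_dualD(3)[OF dualm]] by (auto simp flip: adj0)

text \<open>Pairing \<open>e1 y\<close> with \<open>x\<close> is pairing \<open>y\<close> with the
  boundary of \<open>x\<close>, and nondegeneracy turns the vanishing of all these values into
  \<open>e1 y = 0\<close>.\<close>

lemma cocycle_of_annihilator:
  assumes "y \<in> Y0" "\<And>x. x \<in> BX \<Longrightarrow> p0 x y = 0"
  shows "y \<in> ZY"
proof -
  have "e1 y = 0"
  proof (rule full_dualD(6)[OF dual1 e1_mem[OF assms(1)]])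
    fix x assume "x \<in> X1"
    then show "p1 x (e1 y) = 0" using assms by (simp add: BX_def flip: adj1)
  qed
  then show ?thesis using assms by (simp add: ZY_def)
qed

text \<open>The character given by \<open>y\<close> kills the kernel of \<open>d0\<close>, hence
  factors through \<open>d0\<close>. Fullness of the dual of \<open>Xm\<close> represents the factor
  by some \<open>z\<close>, and adjointness gives \<open>e0 z = y\<close>.\<close>

lemma annihilates_ZX_imp_BY:
  assumes y: "y \<in> Y0" and ann: "\<And>x. x \<in> ZX \<Longrightarrow> p0 x y = 0"
  shows "y \<in> BY"
proof -
  obtain F where F: "hom_on UNIV F" "\<And>x. x \<in> X0 \<Longrightarrow> p0 x y = F (d0 x)"
    using character_factors[OF full_dualD(1)[OF dual0] d0_hom pair_left[OF y]] ann
    by (auto simp: ZX_def)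
  then obtain z where z: "z \<in> Ym" "\<And>x. x \<in> Xm \<Longrightarrow> pm x z = F x" using full_dualD(5)[OF dualm] by blast
  have "y - e0 z = 0"
  proof (rule full_dualD(6)[OF dual0])
    show "y - e0 z \<in> Y0" using y z e0_mem full_dualD(2)[OF dual0] by (simp add: subgrp_diff)
    fix x assume x: "x \<in> X0"
    then have "p0 x (y - e0 z) = p0 x y - p0 x (e0 z)"
      using y z e0_mem by (simp add: hom_on_diff[OF full_dualD(2)[OF dual0] pair_right])
    then show "p0 x (y - e0 z) = 0" using x z F d0_mem by (simp flip: adj0)
  qed
  then show ?thesis using z unfolding BY_def by auto
qed

text \<open>A character separating \<open>x\<close> from the boundaries is represented by an element
  that annihilates them, hence by a cocycle, and this cocycle does not annihilate
  \<open>x\<close>.\<close>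

lemma annihilates_ZY_imp_BX:
  assumes x: "x \<in> X0" and ann: "\<And>y. y \<in> ZY \<Longrightarrow> p0 x y = 0"
  shows "x \<in> BX"
proof (rule ccontr)
  assume "x \<notin> BX"
  from separating_character[OF subgrp_BX this] obtain F :: "'x \<Rightarrow> qz" where
    F: "hom_on UNIV F" "\<And>h. h \<in> BX \<Longrightarrow> F h = 0" "F x \<noteq> 0" by blast
  then obtain y where y: "y \<in> Y0" "\<And>x. x \<in> X0 \<Longrightarrow> p0 x y = F x" using full_dualD(5)[OF dual0] by blast
  have "y \<in> ZY" using y F BX_sub by (intro cocycle_of_annihilator) auto
  then show False using ann y x F by metis
qed

text \<open>This is surjectivity of the map from the cohomology of the dual to the dual of the
  homology. Extending by 0 over all boundaries is what makes the representing element a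
  cocycle.\<close>

lemma character_of_homology:
  assumes "hom_on ZX \<xi>" "\<And>x. x \<in> ZX \<Longrightarrow> x \<in> BX \<Longrightarrow> \<xi> x = 0"
  obtains y where "y \<in> ZY" "\<And>x. x \<in> ZX \<Longrightarrow> p0 x y = \<xi> x"
proof -
  obtain F where F: "hom_on UNIV F" "\<And>x. x \<in> ZX \<Longrightarrow> F x = \<xi> x" "\<And>x. x \<in> BX \<Longrightarrow> F x = 0"
    using extend_character_by_0[OF subgrp_ZX subgrp_BX assms] by blast
  then obtain y where y: "y \<in> Y0" "\<And>x. x \<in> X0 \<Longrightarrow> p0 x y = F x" using full_dualD(5)[OF dual0] by blast
  have "y \<in> ZY" using y F BX_sub by (intro cocycle_of_annihilator) auto
  then show ?thesis
  proof (rule that)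
    fix x assume "x \<in> ZX"
    then show "p0 x y = \<xi> x" using y(2) F(2) ZX_sub by auto
  qed
qed

end

text \<open>\<open>X\<close>, \<open>V\<close> are the abstract chains and cochains, \<open>W\<close>, \<open>M\<close> the continuous cochains and profinite
  chains. In the continuous complex the cochains play the role of the discrete group and the chains
  that of its dual.\<close>

locale comparison =
  D: dual_complex X1 X0 Xm d1 d0 V1 V0 Vm e1 e0 pD1 pD0 pDm +
  C: dual_complex Wm W0 W1 e0 e1 Mm M0 M1 b0 b1 pCm pC0 pC1
  for X1 X0 Xm :: "'a::ab_group_add set" and d1 d0
    and V1 V0 Vm :: "'c::ab_group_add set" and e1 e0 and pD1 pD0 pDm
    and Wm W0 W1 :: "'c set" and Mm M0 M1 :: "'b::ab_group_add set" and b0 b1 and pCm pC0 pC1 +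
  fixes \<delta> :: "'a \<Rightarrow> 'b" and n :: int
  assumes W0V0: "W0 \<subseteq> V0" and WmVm: "Wm \<subseteq> Vm"
    and \<delta>_mem: "c \<in> X0 \<Longrightarrow> \<delta> c \<in> M0"
    and compat: "g \<in> W0 \<Longrightarrow> c \<in> X0 \<Longrightarrow> pC0 g (\<delta> c) = pD0 c g"
    and n: "n > 0" and torsX: "x \<in> X0 \<Longrightarrow> zmul n x = 0" and torsM: "\<mu> \<in> M0 \<Longrightarrow> zmul n \<mu> = 0"
begin

lemma cocycles_sub: "C.ZX \<subseteq> D.ZY" and coboundaries_sub: "C.BX \<subseteq> D.BY"
  unfolding C.ZX_def D.ZY_def C.BX_def D.BY_def using W0V0 WmVm by auto

text \<open>Only the pairing of \<open>\<delta> c\<close> with continuous cochains is prescribed. It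
  determines \<open>\<delta> c\<close> by nondegeneracy, and additivity follows.\<close>

lemma \<delta>_diff:
  assumes "c \<in> X0" "c' \<in> X0"
  shows "\<delta> (c - c') = \<delta> c - \<delta> c'"
proof -
  have XM: "subgrp X0" "subgrp M0" using full_dualD(1,2) D.dual0 C.dual0 by blast+
  have cc: "c - c' \<in> X0" using assms XM by (simp add: subgrp_diff)
  have "\<delta> (c - c') - (\<delta> c - \<delta> c') = 0"
  proof (rule full_dualD(6)[OF C.dual0])
    show "\<delta> (c - c') - (\<delta> c - \<delta> c') \<in> M0" using XM cc assms \<delta>_mem by (simp add: subgrp_diff)
    fix g assume g: "g \<in> W0"
    have "pC0 g (\<delta> (c - c') - (\<delta> c - \<delta> c')) = pD0 (c - c') g - (pD0 c g - pD0 c' g)"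
      using g XM cc assms \<delta>_mem by (simp add: hom_on_diff[OF XM(2) C.pair_right] subgrp_diff compat)
    then show "pC0 g (\<delta> (c - c') - (\<delta> c - \<delta> c')) = 0"
      using g W0V0 assms by (simp add: hom_on_diff[OF XM(1) D.pair_left] subset_iff)
  qed
  then show ?thesis by simp
qed

text \<open>Compatibility with the boundary maps is obtained by duality: continuous coboundaries are
  abstract coboundaries, and cycles annihilate those. The companion on boundaries uses the inclusion
  of cocycles in the same way.\<close>

lemma \<delta>_cycle: "c \<in> D.ZX \<Longrightarrow> \<delta> c \<in> C.ZY"
  using D.pair_ZX_BY coboundaries_sub D.ZX_sub C.BX_sub
  by (intro C.cocycle_of_annihilator) (auto simp: \<delta>_mem compat subset_iff)

lemma \<delta>_boundary: "c \<in> D.BX \<Longrightarrow> \<delta> c \<in> C.BY"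
  using D.pair_BX_ZY cocycles_sub D.BX_sub C.ZX_sub
  by (intro C.annihilates_ZX_imp_BY) (auto simp: \<delta>_mem compat subset_iff)

text \<open>The properties of the maps on classes, expressed by representatives; injectivity appears
  as triviality of the kernel.\<close>

definition "coh_surj \<longleftrightarrow> (\<forall>f\<in>D.ZY. \<exists>g\<in>C.ZX. f - g \<in> D.BY)"
definition "coh_inj \<longleftrightarrow> (\<forall>g\<in>C.ZX. g \<in> D.BY \<longrightarrow> g \<in> C.BX)"
definition "hom_surj \<longleftrightarrow> (\<forall>\<mu>\<in>C.ZY. \<exists>c\<in>D.ZX. \<mu> - \<delta> c \<in> C.BY)"
definition "hom_inj \<longleftrightarrow> (\<forall>c\<in>D.ZX. \<delta> c \<in> C.BY \<longrightarrow> c \<in> D.BX)"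

lemma compat_cocycle: "g \<in> C.ZX \<Longrightarrow> c \<in> D.ZX \<Longrightarrow> pC0 g (\<delta> c) = pD0 c g"
  using C.ZX_sub D.ZX_sub compat by blast

lemma pair_D_cong:
  assumes "c \<in> D.ZX" "f \<in> V0" "g \<in> V0" "f - g \<in> D.BY"
  shows "pD0 c f = pD0 c g"
  using D.pair_ZX_BY[OF assms(1,4)] assms D.ZX_sub
    hom_on_diff[OF full_dualD(2)[OF D.dual0] D.pair_right[of c] assms(2,3)] by auto

lemma pair_C_cong:
  assumes "g \<in> C.ZX" "\<mu> \<in> M0" "\<nu> \<in> M0" "\<mu> - \<nu> \<in> C.BY"
  shows "pC0 g \<mu> = pC0 g \<nu>"
  using C.pair_ZX_BY[OF assms(1,4)] assms C.ZX_sub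
    hom_on_diff[OF full_dualD(2)[OF C.dual0] C.pair_right[of g] assms(2,3)] by auto

text \<open>Up to a coboundary every cocycle is continuous, and a continuous cocycle pairs with
  \<open>c\<close> as it does with \<open>\<delta> c\<close>. If the latter is a boundary, then
  \<open>c\<close> annihilates all cocycles.\<close>

lemma coh_surj_imp_hom_inj:
  assumes "coh_surj"
  shows "hom_inj"
  unfolding hom_inj_def
proof (intro ballI impI)
  fix c assume c: "c \<in> D.ZX" "\<delta> c \<in> C.BY"
  show "c \<in> D.BX"
  proof (rule D.annihilates_ZY_imp_BX)
    show "c \<in> X0" using c D.ZX_sub by blast
    fix f assume f: "f \<in> D.ZY"
    then obtain g where g: "g \<in> C.ZX" "f - g \<in> D.BY" using assms unfolding coh_surj_def by blast
    then have "pD0 c f = pD0 c g"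
      using pair_D_cong[OF c(1)] f cocycles_sub D.ZY_sub by blast
    also have "\<dots> = pC0 g (\<delta> c)" using compat_cocycle g c by simp
    finally show "pD0 c f = 0" using C.pair_ZX_BY g c by simp
  qed
qed

lemma hom_surj_imp_coh_inj:
  assumes "hom_surj"
  shows "coh_inj"
  unfolding coh_inj_def
proof (intro ballI impI)
  fix g assume g: "g \<in> C.ZX" "g \<in> D.BY"
  show "g \<in> C.BX"
  proof (rule C.annihilates_ZY_imp_BX)
    show "g \<in> W0" using g C.ZX_sub by blast
    fix \<mu> assume \<mu>: "\<mu> \<in> C.ZY"
    then obtain c where c: "c \<in> D.ZX" "\<mu> - \<delta> c \<in> C.BY" using assms unfolding hom_surj_def by blast
    then have "pC0 g \<mu> = pC0 g (\<delta> c)"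
      using pair_C_cong[OF g(1)] \<mu> \<delta>_cycle C.ZY_sub by blast
    also have "\<dots> = pD0 c g" using compat_cocycle g c by simp
    finally show "pC0 g \<mu> = 0" using D.pair_ZX_BY g c by simp
  qed
qed

lemma pair_D_tors:
  assumes "c \<in> X0" "f \<in> V0"
  shows "zmul n (pD0 c f) = 0"
proof -
  have X: "subgrp X0" using full_dualD(1)[OF D.dual0] .
  show ?thesis
    using hom_on_zmul[OF X D.pair_left[OF assms(2)] assms(1), of n] torsX[OF assms(1)]
      hom_on_0[OF X D.pair_left[OF assms(2)]] by simp
qed

lemma pair_C_tors:
  assumes "g \<in> W0" "\<mu> \<in> M0"
  shows "zmul n (pC0 g \<mu>) = 0"
proof -
  have M: "subgrp M0" using full_dualD(2)[OF C.dual0] .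
  show ?thesis
    using hom_on_zmul[OF M C.pair_right[OF assms(1)] assms(2), of n] torsM[OF assms(2)]
      hom_on_0[OF M C.pair_right[OF assms(1)]] by simp
qed

text \<open>For infinite homology take a functional \<open>F\<close> on its characters that is no
  evaluation. Through the pairing it gives a character \<open>E\<close> of cochains. On continuous
  cocycles \<open>E\<close> is pairing with a profinite cycle, which \<open>hom_surj\<close>
  replaces by \<open>\<delta> c\<close>; then \<open>coh_surj\<close> shows that \<open>F\<close> is
  evaluation at \<open>c\<close> after all.\<close>

lemma surj_imp_finite:
  assumes cs: "coh_surj" and hs: "hom_surj"
  shows "fin_mod D.ZX D.BX"
proof (rule ccontr)
  assume inf: "\<not> fin_mod D.ZX D.BX"
  \<comment> \<open>\<open>non_evaluation_functional\<close> asks for a subgroup of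
    \<open>D.ZX\<close>, and the locale does not place \<open>D.BX\<close> inside it.\<close>
  let ?N = "D.ZX \<inter> D.BX"
  have N: "subgrp ?N" using subgrp_Int D.subgrp_ZX D.subgrp_BX by blast
  have inf': "\<not> fin_mod D.ZX ?N" using inf unfolding fin_mod_def by blast
  have tors: "zmul n x = 0" if "x \<in> D.ZX" for x using torsX D.ZX_sub that by blast
  obtain F :: "('a \<Rightarrow> qz) \<Rightarrow> qz" where F: "hom_on UNIV F"
    and F0: "\<forall>\<xi>. (\<forall>x\<in>D.ZX. \<xi> x = 0) \<longrightarrow> F \<xi> = 0"
    and F1: "\<forall>a\<in>D.ZX. \<exists>\<xi>. hom_on UNIV \<xi> \<and> (\<forall>x\<in>?N. \<xi> x = 0) \<and> F \<xi> \<noteq> \<xi> a"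
    by (rule non_evaluation_functional[OF D.subgrp_ZX N Int_lower1 n tors inf'])
  have F_cong: "F \<alpha> = F \<beta>" if "\<And>x. x \<in> D.ZX \<Longrightarrow> \<alpha> x = \<beta> x" for \<alpha> \<beta>
    using F0[rule_format, of "\<alpha> - \<beta>"] that hom_on_diff[OF subgrp_UNIV F] by simp
  define E where "E g = F (\<lambda>c. pD0 c g)" for g
  have E_hom: "hom_on V0 E"
  proof (rule hom_onI)
    fix g h assume gh: "g \<in> V0" "h \<in> V0"
    have "E (g + h) = F ((\<lambda>c. pD0 c g) + (\<lambda>c. pD0 c h))"
      unfolding E_def using gh D.ZX_sub
      by (intro F_cong) (auto simp: subset_iff hom_on_add[OF D.pair_right])
    then show "E (g + h) = E g + E h" by (simp add: E_def hom_on_add[OF F])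
  qed
  have E_cong: "E f = E g" if "f \<in> V0" "g \<in> V0" "f - g \<in> D.BY" for f g
    unfolding E_def using pair_D_cong that by (intro F_cong) blast
  have ZW: "C.ZX \<subseteq> V0" using C.ZX_sub W0V0 by blast
  have "E g = 0" if "g \<in> C.ZX" "g \<in> C.BX" for g
    unfolding E_def using that coboundaries_sub D.pair_ZX_BY by (intro F0[rule_format]) blast
  then obtain \<mu> where \<mu>: "\<mu> \<in> C.ZY" "\<And>g. g \<in> C.ZX \<Longrightarrow> pC0 g \<mu> = E g"
    using C.character_of_homology[OF hom_on_mono[OF E_hom ZW]] by blast
  then obtain c where c: "c \<in> D.ZX" "\<mu> - \<delta> c \<in> C.BY" using hs unfolding hom_surj_def by blast
  have E_eval: "E f = pD0 c f" if f: "f \<in> D.ZY" for f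
  proof -
    obtain g where g: "g \<in> C.ZX" "f - g \<in> D.BY" using cs f unfolding coh_surj_def by blast
    have V: "f \<in> V0" "g \<in> V0" using f g ZW D.ZY_sub by auto
    have "E f = pC0 g \<mu>" using E_cong V g \<mu> by simp
    also have "\<dots> = pC0 g (\<delta> c)" using pair_C_cong g c \<mu> \<delta>_cycle C.ZY_sub by blast
    also have "\<dots> = pD0 c f" using compat_cocycle g c pair_D_cong V by simp
    finally show ?thesis .
  qed
  obtain \<xi> where \<xi>: "hom_on UNIV \<xi>" "\<And>x. x \<in> ?N \<Longrightarrow> \<xi> x = 0" "F \<xi> \<noteq> \<xi> c"
    using F1 c(1) by blast
  \<comment> \<open>Characters of the homology are pairings with cocycles, so \<open>E_eval\<close>
    applies to the very character on which \<open>F\<close> differs from evaluation at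
    \<open>c\<close>.\<close>
  obtain f where f: "f \<in> D.ZY" "\<And>x. x \<in> D.ZX \<Longrightarrow> pD0 x f = \<xi> x"
    using D.character_of_homology[of \<xi>] \<xi> hom_on_mono[OF \<xi>(1)] by auto
  have "F \<xi> = E f" unfolding E_def using f(2) by (intro F_cong) simp
  then show False using \<xi>(3) E_eval[OF f(1)] f(2)[OF c(1)] by simp
qed

text \<open>The pairings with continuous cocycles form a finite group of characters of the cycles. A
  cycle killed by all of them is sent to a boundary by \<open>\<delta>\<close>, hence is a boundary
  by \<open>hom_inj\<close>, and so the pairing with \<open>f\<close> kills it too.\<close>

lemma hom_inj_finite_imp_coh_surj:
  assumes hi: "hom_inj" and fin: "fin_mod D.ZX D.BX"
  shows "coh_surj"
  unfolding coh_surj_def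
proof
  fix f assume f: "f \<in> D.ZY"
  have ZV: "C.ZX \<subseteq> V0" using C.ZX_sub W0V0 by blast
  have fV: "f \<in> V0" using f D.ZY_sub by blast
  obtain R where R: "finite R" "R \<subseteq> D.ZX" "\<And>c. c \<in> D.ZX \<Longrightarrow> \<exists>r\<in>R. c - r \<in> D.BX"
    using fin_modE[OF fin D.subgrp_BX] by blast
  let ?res = "\<lambda>g. restrict (\<lambda>c. pD0 c g) D.ZX"
  define rep where "rep c = (SOME r. r \<in> R \<and> c - r \<in> D.BX)" for c
  have rep: "rep c \<in> R" "c - rep c \<in> D.BX" if "c \<in> D.ZX" for c
    using someI_ex[of "\<lambda>r. r \<in> R \<and> c - r \<in> D.BX"] R(3)[OF that] unfolding rep_def by blast+
  \<comment> \<open>A character of the homology is determined by its values on the representatives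
    \<open>R\<close>, and each value is \<open>n\<close>-torsion; this leaves finitely many.\<close>
  have "?res ` C.ZX \<subseteq> (\<lambda>t. restrict (t \<circ> rep) D.ZX) ` (R \<rightarrow>\<^sub>E {z. zmul n z = 0})"
  proof
    fix u assume "u \<in> ?res ` C.ZX"
    then obtain g where g: "g \<in> C.ZX" "u = ?res g" by blast
    have gV: "g \<in> V0" "g \<in> D.ZY" using g ZV cocycles_sub by auto
    have eq: "pD0 c g = pD0 (rep c) g" if c: "c \<in> D.ZX" for c
    proof -
      have X: "c \<in> X0" "rep c \<in> X0" using rep c R D.ZX_sub by blast+
      have "pD0 c g - pD0 (rep c) g = pD0 (c - rep c) g"
        using hom_on_diff[OF full_dualD(1)[OF D.dual0] D.pair_left[OF gV(1)] X] by simp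
      then show ?thesis using D.pair_BX_ZY[OF rep(2)[OF c] gV(2)] by simp
    qed
    have "u = restrict ((\<lambda>c\<in>R. pD0 c g) \<circ> rep) D.ZX"
      unfolding g(2) using rep eq by (intro restrict_ext) simp
    moreover have "(\<lambda>c\<in>R. pD0 c g) \<in> R \<rightarrow>\<^sub>E {z. zmul n z = 0}"
      using R(2) D.ZX_sub pair_D_tors gV by auto
    ultimately show "u \<in> (\<lambda>t. restrict (t \<circ> rep) D.ZX) ` (R \<rightarrow>\<^sub>E {z. zmul n z = 0})" by blast
  qed
  moreover have "finite (R \<rightarrow>\<^sub>E {z::qz. zmul n z = 0})"
    using R(1) finite_qz_torsion[OF n] by (simp add: finite_PiE)
  ultimately have finres: "finite (?res ` C.ZX)" by (meson finite_imageI finite_subset)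
  obtain g where g: "g \<in> C.ZX" "\<And>c. c \<in> D.ZX \<Longrightarrow> pD0 c f = pD0 c g"
  proof (rule character_in_finite_family[OF D.subgrp_ZX C.subgrp_ZX _ _ n _ finres])
    show "hom_on D.ZX (\<lambda>c. pD0 c g)" if "g \<in> C.ZX" for g
      using that ZV hom_on_mono[OF D.pair_left D.ZX_sub] by blast
    show "hom_on C.ZX (\<lambda>g. pD0 c g)" if "c \<in> D.ZX" for c
      using that D.ZX_sub hom_on_mono[OF D.pair_right ZV] by blast
    show "zmul n (pD0 c g) = 0" if "g \<in> C.ZX" "c \<in> D.ZX" for g c
      using that D.ZX_sub ZV pair_D_tors by blast
    show "hom_on D.ZX (\<lambda>c. pD0 c f)"
      using fV hom_on_mono[OF D.pair_left D.ZX_sub] by blast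
    show "pD0 c f = 0" if c: "c \<in> D.ZX" "\<And>g. g \<in> C.ZX \<Longrightarrow> pD0 c g = 0" for c
    proof -
      have "\<delta> c \<in> C.BY"
        using c D.ZX_sub \<delta>_mem compat_cocycle by (intro C.annihilates_ZX_imp_BY) auto
      then have "c \<in> D.BX" using hi c unfolding hom_inj_def by blast
      then show ?thesis using D.pair_BX_ZY f by blast
    qed
  qed (rule that)
  have gV: "g \<in> V0" using g ZV by blast
  have "f - g \<in> D.BY"
  proof (rule D.annihilates_ZX_imp_BY)
    show "f - g \<in> V0" using fV gV subgrp_diff full_dualD(2)[OF D.dual0] by blast
    show "pD0 c (f - g) = 0" if "c \<in> D.ZX" for c
      using g(2)[OF that] that D.ZX_sub
        hom_on_diff[OF full_dualD(2)[OF D.dual0] D.pair_right fV gV] by auto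
  qed
  then show "\<exists>g\<in>C.ZX. f - g \<in> D.BY" using g by blast
qed

text \<open>The roles are exchanged: profinite cycles act as characters of continuous cocycles, and
  the finite family consists of the images \<open>\<delta> c\<close>. A continuous cocycle killed by
  all of them is an abstract coboundary, hence a continuous one by \<open>coh_inj\<close>.\<close>

lemma coh_inj_finite_imp_hom_surj:
  assumes ci: "coh_inj" and fin: "fin_mod C.ZY C.BY"
  shows "hom_surj"
  unfolding hom_surj_def
proof
  fix \<mu> assume \<mu>: "\<mu> \<in> C.ZY"
  have \<mu>M: "\<mu> \<in> M0" using \<mu> C.ZY_sub by blast
  obtain R where R: "finite R" "R \<subseteq> C.ZY" "\<And>\<nu>. \<nu> \<in> C.ZY \<Longrightarrow> \<exists>r\<in>R. \<nu> - r \<in> C.BY"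
    using fin_modE[OF fin C.subgrp_BY] by blast
  let ?res = "\<lambda>\<nu>. restrict (\<lambda>g. pC0 g \<nu>) C.ZX"
  \<comment> \<open>Modulo boundaries \<open>\<delta> c\<close> is one of the cycles in
    \<open>R\<close>, and boundaries do not change the pairing with cocycles.\<close>
  have "(\<lambda>c. ?res (\<delta> c)) ` D.ZX \<subseteq> ?res ` R"
  proof
    fix u assume "u \<in> (\<lambda>c. ?res (\<delta> c)) ` D.ZX"
    then obtain c where c: "c \<in> D.ZX" "u = ?res (\<delta> c)" by blast
    then obtain r where r: "r \<in> R" "\<delta> c - r \<in> C.BY" using R(3) \<delta>_cycle by blast
    have "\<delta> c \<in> M0" "r \<in> M0" using c r R \<delta>_cycle C.ZY_sub by auto
    then have "?res (\<delta> c) = ?res r" using pair_C_cong r by (intro restrict_ext) blast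
    then show "u \<in> ?res ` R" using c r by blast
  qed
  then have finres: "finite ((\<lambda>c. ?res (\<delta> c)) ` D.ZX)" using R(1) by (meson finite_imageI finite_subset)
  obtain c where c: "c \<in> D.ZX" "\<And>g. g \<in> C.ZX \<Longrightarrow> pC0 g \<mu> = pC0 g (\<delta> c)"
  proof (rule character_in_finite_family[OF C.subgrp_ZX D.subgrp_ZX _ _ n _ finres])
    show "hom_on C.ZX (\<lambda>g. pC0 g (\<delta> c))" if "c \<in> D.ZX" for c
      using that \<delta>_mem D.ZX_sub hom_on_mono[OF C.pair_left C.ZX_sub] by blast
    show "hom_on D.ZX (\<lambda>c. pC0 g (\<delta> c))" if "g \<in> C.ZX" for g
    proof -
      have "hom_on D.ZX (\<lambda>c. pD0 c g)"
        using that C.ZX_sub W0V0 hom_on_mono[OF D.pair_left D.ZX_sub] by blast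
      then show ?thesis
        using that compat_cocycle subgrp_add[OF D.subgrp_ZX] by (simp add: hom_on_def)
    qed
    show "zmul n (pC0 g (\<delta> c)) = 0" if "c \<in> D.ZX" "g \<in> C.ZX" for c g
      using that D.ZX_sub C.ZX_sub \<delta>_mem pair_C_tors by blast
    show "hom_on C.ZX (\<lambda>g. pC0 g \<mu>)"
      using \<mu>M hom_on_mono[OF C.pair_left C.ZX_sub] by blast
    show "pC0 g \<mu> = 0" if g: "g \<in> C.ZX" "\<And>c. c \<in> D.ZX \<Longrightarrow> pC0 g (\<delta> c) = 0" for g
    proof -
      have "g \<in> D.BY"
        using g C.ZX_sub W0V0 compat_cocycle by (intro D.annihilates_ZX_imp_BY) auto
      then have "g \<in> C.BX" using ci g unfolding coh_inj_def by blast
      then show ?thesis using C.pair_BX_ZY \<mu> by blast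
    qed
  qed (rule that)
  have cM: "\<delta> c \<in> M0" using c \<delta>_cycle C.ZY_sub by blast
  have "\<mu> - \<delta> c \<in> C.BY"
  proof (rule C.annihilates_ZX_imp_BY)
    show "\<mu> - \<delta> c \<in> M0" using \<mu>M cM subgrp_diff full_dualD(2)[OF C.dual0] by blast
    show "pC0 g (\<mu> - \<delta> c) = 0" if "g \<in> C.ZX" for g
      using c(2)[OF that] that C.ZX_sub
        hom_on_diff[OF full_dualD(2)[OF C.dual0] C.pair_right \<mu>M cM] by auto
  qed
  then show "\<exists>c\<in>D.ZX. \<mu> - \<delta> c \<in> C.BY" using c by blast
qed

end

section \<open>The dual of a finite module\<close>

definition chars :: "('m::ab_group_add \<Rightarrow> qz) set" where
  "chars = {\<xi>. hom_on UNIV \<xi>}"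

lemma charsD: "\<xi> \<in> chars \<Longrightarrow> hom_on UNIV \<xi>"
  by (simp add: chars_def)

lemma chars_add: "\<xi> \<in> chars \<Longrightarrow> \<xi> (x + y) = \<xi> x + \<xi> y"
  by (simp add: chars_def hom_on_def)

lemma chars_0: "\<xi> \<in> chars \<Longrightarrow> \<xi> 0 = 0"
  by (rule hom_on_0[OF subgrp_UNIV charsD])

lemma chars_minus: "\<xi> \<in> chars \<Longrightarrow> \<xi> (- x) = - \<xi> x"
  by (rule hom_on_minus[OF subgrp_UNIV charsD UNIV_I])

lemma chars_sum: "\<xi> \<in> chars \<Longrightarrow> \<xi> (sum f A) = (\<Sum>i\<in>A. \<xi> (f i))"
  by (rule hom_on_sum[OF subgrp_UNIV charsD UNIV_I])

lemma chars_alt: "\<xi> \<in> chars \<Longrightarrow> \<xi> (alt i x) = alt i (\<xi> x)"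
  by (simp add: alt_def chars_minus)

lemma subgrp_chars: "subgrp chars"
  by (rule subgrpI) (auto simp: chars_def hom_on_def algebra_simps)

lemma chars_tors:
  fixes \<xi> :: "'m::{ab_group_add,finite} \<Rightarrow> qz"
  assumes "\<xi> \<in> chars"
  shows "zmul (int CARD('m)) (\<xi> x) = 0"
  using hom_on_zmul[OF subgrp_UNIV charsD[OF assms] UNIV_I, of "int CARD('m)" x] chars_0[OF assms]
  by (simp add: zmul_CARD)

lemma CARD_pos: "int CARD('m::finite) > 0"
  by simp

lemma finite_chars: "finite (chars :: ('m::{ab_group_add,finite} \<Rightarrow> qz) set)"
proof (rule finite_subset)
  show "chars \<subseteq> (UNIV :: 'm set) \<rightarrow>\<^sub>E {z::qz. zmul (int CARD('m)) z = 0}"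
    using chars_tors by auto
  show "finite ((UNIV :: 'm set) \<rightarrow>\<^sub>E {z::qz. zmul (int CARD('m)) z = 0})"
    by (intro finite_PiE finite_qz_torsion CARD_pos) simp
qed

lemma chars_separate:
  assumes "\<And>\<xi>. \<xi> \<in> chars \<Longrightarrow> \<xi> x = \<xi> y"
  shows "x = y"
proof (rule ccontr)
  assume "x \<noteq> y"
  then have "x - y \<notin> {0}" by simp
  moreover have "subgrp {0::'a}" by (simp add: subgrp_def)
  ultimately obtain F :: "'a \<Rightarrow> qz" where "hom_on UNIV F" "F (x - y) \<noteq> 0"
    using separating_character by metis
  then show False using assms[of F] by (simp add: chars_def hom_on_diff[OF subgrp_UNIV])
qed

text \<open>The evaluations at elements of the module are a finite family of characters of the dual,
  and only the zero character is killed by all of them.\<close>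

lemma double_dual:
  fixes F :: "('m::{ab_group_add,finite} \<Rightarrow> qz) \<Rightarrow> qz"
  assumes "hom_on chars F"
  obtains x where "\<And>\<xi>. \<xi> \<in> chars \<Longrightarrow> \<xi> x = F \<xi>"
proof -
  obtain x where "\<And>\<xi>. \<xi> \<in> chars \<Longrightarrow> F \<xi> = \<xi> x"
  proof (rule character_in_finite_family[where I = UNIV and P = "\<lambda>x \<xi>. \<xi> x" and K = chars])
    show "hom_on UNIV \<xi>" if "\<xi> \<in> chars" for \<xi> :: "'m \<Rightarrow> qz" using charsD that .
    show "zmul (int CARD('m)) (\<xi> x) = 0" if "\<xi> \<in> chars" for \<xi> and x :: 'm using chars_tors that .
    show "F \<xi> = 0" if "\<xi> \<in> chars" "\<And>i. i \<in> UNIV \<Longrightarrow> \<xi> i = 0" for \<xi>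
    proof -
      have "\<xi> = 0" using that by (simp add: fun_eq_iff)
      then show ?thesis using hom_on_0[OF subgrp_chars assms] by simp
    qed
    show "hom_on chars F" using assms .
  qed (auto simp: subgrp_chars subgrp_UNIV hom_on_def intro: that)
  then show ?thesis using that by metis
qed

lemma alt_add: "alt i (x + y) = alt i x + alt i y"
  and alt_0 [simp]: "alt i 0 = 0"
  by (simp_all add: alt_def)

lemma alt_sum: "alt i (sum f A) = (\<Sum>j\<in>A. alt i (f j))"
  by (simp add: alt_def sum_negf)

lemma subgrp_alt: "subgrp H \<Longrightarrow> x \<in> H \<Longrightarrow> alt i x \<in> H"
  by (simp add: alt_def subgrp_minus)

lemma hom_on_alt: "subgrp H \<Longrightarrow> hom_on H f \<Longrightarrow> x \<in> H \<Longrightarrow> f (alt i x) = alt i (f x)"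
  by (simp add: alt_def hom_on_minus)

lemma sum_fun_apply: "(\<Sum>i\<in>A. f i) x = (\<Sum>i\<in>A. f i x)"
  by (induction A rule: infinite_finite_induct) auto

lemma alt_fun_apply: "alt i f x = alt i (f x)"
  by (simp add: alt_def)

section \<open>Abstract chains and cochains\<close>

definition qcochains :: "'g monoid \<Rightarrow> nat \<Rightarrow> ('g list \<Rightarrow> 'm::ab_group_add \<Rightarrow> qz) set" where
  "qcochains G q = {f. (\<forall>gs. gs \<notin> gtuples G q \<longrightarrow> f gs = 0) \<and> (\<forall>gs. f gs \<in> chars)}"

text \<open>Only face 0 involves the module. The right action of the boundary and the contragredient
  action of the coboundary contribute the same operator, which is the reason for their
  adjointness.\<close>

definition twist :: "'g monoid \<Rightarrow> ('g \<Rightarrow> 'm \<Rightarrow> 'm) \<Rightarrow> nat \<Rightarrow> 'g list \<Rightarrow> 'm \<Rightarrow> 'm" where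
  "twist G act i gs x = (if i = 0 then act (inv\<^bsub>G\<^esub> (hd gs)) x else x)"

definition qcoface :: "'g monoid \<Rightarrow> ('g \<Rightarrow> 'm \<Rightarrow> 'm) \<Rightarrow> nat \<Rightarrow> nat
    \<Rightarrow> ('g list \<Rightarrow> 'm::ab_group_add \<Rightarrow> qz) \<Rightarrow> ('g list \<Rightarrow> 'm \<Rightarrow> qz)" where
  "qcoface G act q i f = (\<lambda>gs. if gs \<in> gtuples G (Suc q)
     then (\<lambda>x. f (face G i gs) (twist G act i gs x)) else 0)"

definition qcobd :: "'g monoid \<Rightarrow> ('g \<Rightarrow> 'm \<Rightarrow> 'm) \<Rightarrow> nat
    \<Rightarrow> ('g list \<Rightarrow> 'm::ab_group_add \<Rightarrow> qz) \<Rightarrow> ('g list \<Rightarrow> 'm \<Rightarrow> qz)" where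
  "qcobd G act q f = (\<Sum>i\<in>{0..Suc q}. alt i (qcoface G act q i f))"

definition dpair :: "('g list \<Rightarrow> 'm::ab_group_add) \<Rightarrow> ('g list \<Rightarrow> 'm \<Rightarrow> qz) \<Rightarrow> qz" where
  "dpair c f = (\<Sum>gs | c gs \<noteq> 0. f gs (c gs))"

definition single :: "'a \<Rightarrow> 'm::zero \<Rightarrow> 'a \<Rightarrow> 'm" where
  "single a x = (\<lambda>b. if b = a then x else 0)"

lemma single_add: "single a (x + y) = single a x + single a (y::'m::ab_group_add)"
  by (auto simp: single_def)

lemma dpair_superset:
  assumes "\<And>gs. f gs \<in> chars" "finite S" "{gs. c gs \<noteq> 0} \<subseteq> S"
  shows "dpair c f = (\<Sum>gs\<in>S. f gs (c gs))"
  unfolding dpair_def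
  by (rule sum.mono_neutral_left[OF assms(2,3)]) (auto simp: chars_0[OF assms(1)])

lemma qcochainsD: "f \<in> qcochains G q \<Longrightarrow> f gs \<in> chars"
  "f \<in> qcochains G q \<Longrightarrow> gs \<notin> gtuples G q \<Longrightarrow> f gs = 0"
  by (simp_all add: qcochains_def)

lemma subgrp_qcochains: "subgrp (qcochains G q)"
  by (rule subgrpI) (auto simp: qcochains_def intro: subgrp_intros subgrp_chars)

lemma subgrp_dchains: "subgrp (dchains G q)"
proof (rule subgrpI)
  fix c c' :: "'a list \<Rightarrow> 'b" assume c: "c \<in> dchains G q" "c' \<in> dchains G q"
  have "{gs. (c - c') gs \<noteq> 0} \<subseteq> {gs. c gs \<noteq> 0} \<union> {gs. c' gs \<noteq> 0}" by auto
  moreover have "finite ({gs. c gs \<noteq> 0} \<union> {gs. c' gs \<noteq> 0})" using c by (simp add: dchains_def)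
  ultimately have "finite {gs. (c - c') gs \<noteq> 0}" using finite_subset by blast
  moreover have "gs \<in> gtuples G q" if "(c - c') gs \<noteq> 0" for gs
    using that c unfolding dchains_def by (cases "c gs = 0") auto
  ultimately show "c - c' \<in> dchains G q" by (simp add: dchains_def)
qed (simp add: dchains_def)

lemma single_dchains: "gs \<in> gtuples G q \<Longrightarrow> single gs x \<in> dchains G q"
  unfolding dchains_def single_def
  by (auto intro: finite_subset[of _ "{gs}"])

lemma dchains_decompose:
  assumes "c \<in> dchains G q"
  shows "c = (\<Sum>gs | c gs \<noteq> 0. single gs (c gs))"
proof
  fix hs
  have fin: "finite {gs. c gs \<noteq> 0}" using assms by (simp add: dchains_def)
  have "(\<Sum>gs | c gs \<noteq> 0. single gs (c gs)) hs = (\<Sum>gs | c gs \<noteq> 0. if hs = gs then c gs else 0)"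
    by (simp add: sum_fun_apply single_def)
  also have "\<dots> = c hs" using fin by (simp add: sum.delta')
  finally show "c hs = (\<Sum>gs | c gs \<noteq> 0. single gs (c gs)) hs" by simp
qed

lemma dpair_single:
  assumes "f gs \<in> chars"
  shows "dpair (single gs x) f = f gs x"
proof (cases "x = 0")
  case True
  then show ?thesis by (simp add: dpair_def single_def chars_0[OF assms])
next
  case False
  then have "{hs. single gs x hs \<noteq> 0} = {gs}" by (auto simp: single_def)
  then show ?thesis by (simp add: dpair_def single_def)
qed

lemma dpair_hom_left:
  assumes "\<And>gs. f gs \<in> chars"
  shows "hom_on (dchains G q) (\<lambda>c. dpair c f)"
proof (rule hom_onI)
  fix c c' :: "'a list \<Rightarrow> 'b" assume c: "c \<in> dchains G q" "c' \<in> dchains G q"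
  define S where "S = {gs. c gs \<noteq> 0} \<union> {gs. c' gs \<noteq> 0}"
  have S: "finite S" using c by (simp add: S_def dchains_def)
  show "dpair (c + c') f = dpair c f + dpair c' f"
    by (subst (1 2 3) dpair_superset[OF assms S])
      (auto simp: S_def chars_add[OF assms] sum.distrib)
qed

lemma full_dual_dchains: "full_dual (dchains G q) (qcochains G q) dpair"
  unfolding full_dual_def
proof (intro conjI ballI allI impI)
  show "subgrp (dchains G q :: ('a list \<Rightarrow> 'b) set)" by (rule subgrp_dchains)
  show "subgrp (qcochains G q :: ('a list \<Rightarrow> 'b \<Rightarrow> qz) set)" by (rule subgrp_qcochains)
  show "hom_on (dchains G q) (\<lambda>c. dpair c f)" if "f \<in> qcochains G q" for f :: "'a list \<Rightarrow> 'b \<Rightarrow> qz"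
    using that by (intro dpair_hom_left qcochainsD)
  show "hom_on (qcochains G q) (dpair c)" for c :: "'a list \<Rightarrow> 'b"
    by (rule hom_onI) (simp add: dpair_def sum.distrib)
next
  fix F :: "('a list \<Rightarrow> 'b) \<Rightarrow> qz" assume F: "hom_on UNIV F"
  \<comment> \<open>Abstract chains are a direct sum of copies of the module, one for each tuple;
    \<open>f gs\<close> is the restriction of \<open>F\<close> to the copy at
    \<open>gs\<close>.\<close>
  define f where "f gs = (if gs \<in> gtuples G q then (\<lambda>x. F (single gs x)) else 0)" for gs
  have f: "f \<in> qcochains G q"
    unfolding qcochains_def
  proof (intro CollectI conjI allI impI)
    show "f gs \<in> chars" for gs
      using subgrp_0[OF subgrp_chars] by (auto simp: f_def chars_def hom_on_def single_add hom_on_add[OF F])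
  qed (simp add: f_def)
  have "dpair c f = F c" if c: "c \<in> dchains G q" for c
  proof -
    have "dpair c f = (\<Sum>gs | c gs \<noteq> 0. F (single gs (c gs)))"
      unfolding dpair_def using c by (intro sum.cong) (auto simp: f_def dchains_def)
    also have "\<dots> = F (\<Sum>gs | c gs \<noteq> 0. single gs (c gs))"
      by (rule hom_on_sum[OF subgrp_UNIV F UNIV_I, symmetric])
    finally show ?thesis using dchains_decompose[OF c] by simp
  qed
  then show "\<exists>f\<in>qcochains G q. \<forall>c\<in>dchains G q. dpair c f = F c" using f by blast
next
  fix f :: "'a list \<Rightarrow> 'b \<Rightarrow> qz" assume f: "f \<in> qcochains G q" and 0: "\<forall>c\<in>dchains G q. dpair c f = 0"
  have "f gs x = 0" for gs x
  proof (cases "gs \<in> gtuples G q")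
    case True
    then show ?thesis using 0 single_dchains dpair_single qcochainsD(1)[OF f] by metis
  qed (simp add: qcochainsD(2)[OF f])
  then show "f = 0" by (simp add: fun_eq_iff)
qed

lemma face_gtuples:
  assumes "group G" "gs \<in> gtuples G (Suc q)" "i \<le> Suc q"
  shows "face G i gs \<in> gtuples G q"
proof -
  interpret group G by fact
  have gs: "length gs = Suc q" "set gs \<subseteq> carrier G" using assms by (auto simp: gtuples_def)
  consider "i = 0" | "0 < i" "i < length gs" | "i = length gs" using assms gs by linarith
  then show ?thesis
  proof cases
    case 1
    then show ?thesis using gs by (cases gs) (auto simp: face_def gtuples_def)
  next
    case 2
    have "gs ! (i - 1) \<in> carrier G" "gs ! i \<in> carrier G"
      using gs 2 by (auto intro!: subsetD[OF gs(2)] nth_mem)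
    then show ?thesis
      using 2 gs set_take_subset[of "i - 1" gs] set_drop_subset[of "i + 1" gs]
      by (auto simp: face_def gtuples_def)
  next
    case 3
    then show ?thesis
      using gs by (auto simp: face_def gtuples_def dest: in_set_butlastD)
  qed
qed

locale gmodule =
  fixes G :: "'g monoid" and T :: "'g topology" and act :: "'g \<Rightarrow> 'm::{ab_group_add,finite} \<Rightarrow> 'm"
  assumes profinite: "profinite_group G T" and module: "finite_G_module G T act"
begin

lemma group_G: "group G" and topspace_T: "topspace T = carrier G"
  using profinite by (auto simp: profinite_group_def)

lemma act_add: "g \<in> carrier G \<Longrightarrow> act g (x + y) = act g x + act g y"
  using module by (simp add: finite_G_module_def)

lemma hd_carrier: "gs \<in> gtuples G (Suc q) \<Longrightarrow> hd gs \<in> carrier G"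
  by (cases gs) (auto simp: gtuples_def)

lemma twist_add:
  assumes "gs \<in> gtuples G (Suc q)"
  shows "twist G act i gs (x + y) = twist G act i gs x + twist G act i gs y"
  using act_add[OF group.inv_closed[OF group_G hd_carrier[OF assms]]] by (simp add: twist_def)

lemma twist_0:
  assumes "gs \<in> gtuples G (Suc q)"
  shows "twist G act i gs 0 = 0"
  using twist_add[OF assms, of i 0 0] by simp

lemma qcoface_qcochains:
  assumes "f \<in> qcochains G q"
  shows "qcoface G act q i f \<in> qcochains G (Suc q)"
  unfolding qcochains_def
proof (intro CollectI conjI allI impI)
  show "qcoface G act q i f gs \<in> chars" for gs
    using subgrp_0[OF subgrp_chars] qcochainsD(1)[OF assms]
    by (auto simp: qcoface_def chars_def hom_on_def twist_add)
qed (simp add: qcoface_def)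

lemma qcobd_qcochains: "f \<in> qcochains G q \<Longrightarrow> qcobd G act q f \<in> qcochains G (Suc q)"
  unfolding qcobd_def by (intro subgrp_sum subgrp_alt subgrp_qcochains qcoface_qcochains)

lemma qcobd_apply:
  "gs \<in> gtuples G (Suc q) \<Longrightarrow>
    qcobd G act q f gs x = (\<Sum>i\<in>{0..Suc q}. alt i (f (face G i gs) (twist G act i gs x)))"
  by (simp add: qcobd_def sum_fun_apply alt_fun_apply qcoface_def)

lemma qcobd_hom: "hom_on UNIV (qcobd G act q)"
proof (rule hom_onI)
  fix f g :: "'g list \<Rightarrow> 'm \<Rightarrow> qz"
  have "qcoface G act q i (f + g) = qcoface G act q i f + qcoface G act q i g" for i
    by (auto simp: qcoface_def fun_eq_iff)
  then show "qcobd G act q (f + g) = qcobd G act q f + qcobd G act q g"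
    by (simp add: qcobd_def alt_add sum.distrib)
qed

lemma dbd_superset:
  fixes c :: "'g list \<Rightarrow> 'm"
  assumes "finite S" "{gs. c gs \<noteq> 0} \<subseteq> S" "S \<subseteq> gtuples G (Suc q)"
  shows "dbd G act (Suc q) c hs = (\<Sum>gs\<in>S. \<Sum>i\<in>{0..Suc q}.
     if face G i gs = hs then alt i (twist G act i gs (c gs)) else 0)"
proof -
  have "dbd G act (Suc q) c hs = (\<Sum>gs | c gs \<noteq> 0. \<Sum>i\<in>{0..Suc q}.
     if face G i gs = hs then alt i (twist G act i gs (c gs)) else 0)"
    unfolding dbd_def twist_def by simp
  also have "\<dots> = (\<Sum>gs\<in>S. \<Sum>i\<in>{0..Suc q}.
     if face G i gs = hs then alt i (twist G act i gs (c gs)) else 0)"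
  proof (rule sum.mono_neutral_left[OF assms(1,2)], rule ballI)
    fix gs assume gs: "gs \<in> S - {gs. c gs \<noteq> 0}"
    then have "twist G act i gs (c gs) = 0" for i using twist_0 assms(3) by auto
    then show "(\<Sum>i\<in>{0..Suc q}. if face G i gs = hs then alt i (twist G act i gs (c gs)) else 0) = 0"
      by (intro sum.neutral) simp
  qed
  finally show ?thesis .
qed

lemma dbd_hom: "hom_on (dchains G (Suc q)) (dbd G act (Suc q))"
proof (rule hom_onI, rule ext)
  fix c c' :: "'g list \<Rightarrow> 'm" and hs
  assume c: "c \<in> dchains G (Suc q)" "c' \<in> dchains G (Suc q)"
  define S where "S = {gs. c gs \<noteq> 0} \<union> {gs. c' gs \<noteq> 0}"
  have S: "finite S" "S \<subseteq> gtuples G (Suc q)" using c by (auto simp: S_def dchains_def)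
  have sub: "{gs. c gs \<noteq> 0} \<subseteq> S" "{gs. c' gs \<noteq> 0} \<subseteq> S" "{gs. (c + c') gs \<noteq> 0} \<subseteq> S"
    by (auto simp: S_def)
  have tw: "twist G act i gs (x + y) = twist G act i gs x + twist G act i gs y" if "gs \<in> S" for i gs x y
    using twist_add S(2) that by blast
  show "dbd G act (Suc q) (c + c') hs = (dbd G act (Suc q) c + dbd G act (Suc q) c') hs"
    unfolding plus_fun_apply dbd_superset[OF S(1) sub(1) S(2)] dbd_superset[OF S(1) sub(2) S(2)]
      dbd_superset[OF S(1) sub(3) S(2)] sum.distrib[symmetric]
    by (intro sum.cong refl) (auto simp: tw alt_add)
qed

lemma dbd_dchains:
  assumes "c \<in> dchains G (Suc q)"
  shows "dbd G act (Suc q) c \<in> dchains G q"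
    and "{hs. dbd G act (Suc q) c hs \<noteq> 0} \<subseteq> (\<lambda>(gs, i). face G i gs) ` ({gs. c gs \<noteq> 0} \<times> {0..Suc q})"
proof -
  have c: "finite {gs. c gs \<noteq> 0}" "{gs. c gs \<noteq> 0} \<subseteq> gtuples G (Suc q)"
    using assms by (auto simp: dchains_def)
  show *: "{hs. dbd G act (Suc q) c hs \<noteq> 0} \<subseteq>
    (\<lambda>(gs, i). face G i gs) ` ({gs. c gs \<noteq> 0} \<times> {0..Suc q})"
  proof (rule subsetI, rule ccontr)
    fix hs assume hs: "hs \<in> {hs. dbd G act (Suc q) c hs \<noteq> 0}"
      and n: "hs \<notin> (\<lambda>(gs, i). face G i gs) ` ({gs. c gs \<noteq> 0} \<times> {0..Suc q})"
    have "dbd G act (Suc q) c hs = 0"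
      unfolding dbd_superset[OF c(1) subset_refl c(2)]
      using n by (intro sum.neutral ballI) force
    then show False using hs by simp
  qed
  have "face G i gs \<in> gtuples G q" if "c gs \<noteq> 0" "i \<le> Suc q" for gs i
    using that c(2) by (intro face_gtuples[OF group_G]) auto
  then have sub: "(\<lambda>(gs, i). face G i gs) ` ({gs. c gs \<noteq> 0} \<times> {0..Suc q}) \<subseteq> gtuples G q" by auto
  have fin: "finite ((\<lambda>(gs, i). face G i gs) ` ({gs. c gs \<noteq> 0} \<times> {0..Suc q}))"
    using c(1) by simp
  show "dbd G act (Suc q) c \<in> dchains G q"
    using finite_subset[OF * fin] subset_trans[OF * sub] by (simp add: dchains_def subset_iff)
qed

lemma dpair_adjoint:
  assumes c: "c \<in> dchains G (Suc q)" and f: "f \<in> qcochains G q"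
  shows "dpair (dbd G act (Suc q) c) f = dpair c (qcobd G act q f)"
proof -
  define S where "S = {gs. c gs \<noteq> 0}"
  define U where "U = (\<lambda>(gs, i). face G i gs) ` (S \<times> {0..Suc q})"
  have S: "finite S" "{gs. c gs \<noteq> 0} \<subseteq> S" "S \<subseteq> gtuples G (Suc q)"
    using c by (auto simp: dchains_def S_def)
  have U: "finite U" "{hs. dbd G act (Suc q) c hs \<noteq> 0} \<subseteq> U"
    using S dbd_dchains(2)[OF c] by (auto simp: U_def S_def)
  have fch: "\<And>gs. f gs \<in> chars" using qcochainsD(1)[OF f] .
  have "dpair (dbd G act (Suc q) c) f = (\<Sum>hs\<in>U. f hs (dbd G act (Suc q) c hs))"
    using dpair_superset[OF fch U] .
  also have "\<dots> = (\<Sum>hs\<in>U. \<Sum>gs\<in>S. \<Sum>i\<in>{0..Suc q}.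
      if face G i gs = hs then alt i (f (face G i gs) (twist G act i gs (c gs))) else 0)"
    unfolding dbd_superset[OF S] chars_sum[OF fch]
    by (intro sum.cong refl) (auto simp: chars_alt[OF fch] chars_0[OF fch])
  \<comment> \<open>After the exchange each pair of a tuple \<open>gs\<close> and an index
    \<open>i\<close> meets exactly one \<open>hs\<close> in \<open>U\<close>, namely its own
    face.\<close>
  also have "\<dots> = (\<Sum>gs\<in>S. \<Sum>i\<in>{0..Suc q}. \<Sum>hs\<in>U.
      if face G i gs = hs then alt i (f (face G i gs) (twist G act i gs (c gs))) else 0)"
    by (subst sum.swap) (intro sum.cong refl sum.swap)
  also have "\<dots> = (\<Sum>gs\<in>S. \<Sum>i\<in>{0..Suc q}. alt i (f (face G i gs) (twist G act i gs (c gs))))"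
    using U(1) by (intro sum.cong refl) (force simp: sum.delta' U_def)
  also have "\<dots> = (\<Sum>gs\<in>S. qcobd G act q f gs (c gs))"
    using S by (intro sum.cong refl) (auto simp: qcobd_apply)
  also have "\<dots> = dpair c (qcobd G act q f)" by (simp add: dpair_def S_def)
  finally show ?thesis .
qed

end

section \<open>Locally constant functions on tuples\<close>

context gmodule
begin

abbreviation PT :: "nat \<Rightarrow> (nat \<Rightarrow> 'g) topology" where
  "PT q \<equiv> product_topology (\<lambda>_. T) {..<q}"

lemma tuples_eq: "{gs. length gs = q \<and> set gs \<subseteq> topspace T} = gtuples G q"
  by (simp add: gtuples_def topspace_T)

lemma openL_iff: "openL T q U \<longleftrightarrow> U \<subseteq> gtuples G q \<and> openin (PT q) {v \<in> topspace (PT q). tup q v \<in> U}"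
  by (simp add: openL_def tuples_eq)

lemma clopenL_iff: "clopenL T q V \<longleftrightarrow> openL T q V \<and> openL T q (gtuples G q - V)"
  by (simp add: clopenL_def tuples_eq)

lemma tup_gtuples: "v \<in> topspace (PT q) \<Longrightarrow> tup q v \<in> gtuples G q"
  by (auto simp: tup_def gtuples_def topspace_T PiE_iff)

lemma openL_empty: "openL T q {}"
  by (simp add: openL_iff)

lemma openL_gtuples: "openL T q (gtuples G q)"
proof -
  have "{v \<in> topspace (PT q). tup q v \<in> gtuples G q} = topspace (PT q)" using tup_gtuples by blast
  then show ?thesis by (simp add: openL_iff del: topspace_product_topology)
qed

lemma openL_Un: "openL T q U \<Longrightarrow> openL T q W \<Longrightarrow> openL T q (U \<union> W)"
proof -
  have "{v \<in> topspace (PT q). tup q v \<in> U \<union> W} =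
    {v \<in> topspace (PT q). tup q v \<in> U} \<union> {v \<in> topspace (PT q). tup q v \<in> W}" by blast
  then show "openL T q U \<Longrightarrow> openL T q W \<Longrightarrow> ?thesis"
    unfolding openL_iff by (auto simp del: topspace_product_topology)
qed

lemma openL_Int: "openL T q U \<Longrightarrow> openL T q W \<Longrightarrow> openL T q (U \<inter> W)"
proof -
  have "{v \<in> topspace (PT q). tup q v \<in> U \<inter> W} =
    {v \<in> topspace (PT q). tup q v \<in> U} \<inter> {v \<in> topspace (PT q). tup q v \<in> W}" by blast
  then show "openL T q U \<Longrightarrow> openL T q W \<Longrightarrow> ?thesis"
    unfolding openL_iff by (auto simp del: topspace_product_topology)
qed

lemma openL_UN: "finite I \<Longrightarrow> (\<And>i. i \<in> I \<Longrightarrow> openL T q (U i)) \<Longrightarrow> openL T q (\<Union>i\<in>I. U i)"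
  by (induction I rule: finite_induct) (auto simp: openL_empty openL_Un)

lemma clopenL_subset: "clopenL T q V \<Longrightarrow> V \<subseteq> gtuples G q"
  by (simp add: clopenL_iff openL_iff)

lemma clopenL_empty: "clopenL T q {}"
  by (simp add: clopenL_iff openL_empty openL_gtuples)

lemma clopenL_Un:
  assumes "clopenL T q V" "clopenL T q W"
  shows "clopenL T q (V \<union> W)"
proof -
  have "gtuples G q - (V \<union> W) = (gtuples G q - V) \<inter> (gtuples G q - W)" by blast
  then show ?thesis using assms by (simp add: clopenL_iff openL_Un openL_Int)
qed

text \<open>Finiteness of the image is built in so that sums over the values make sense. For
  cochains it holds because the dual of the finite module is finite.\<close>

definition lconst :: "nat \<Rightarrow> ('g list \<Rightarrow> 's) \<Rightarrow> bool" where
  "lconst q k \<longleftrightarrow> finite (k ` gtuples G q) \<and> (\<forall>S. openL T q {gs \<in> gtuples G q. k gs \<in> S})"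

lemma lconst_open: "lconst q k \<Longrightarrow> openL T q {gs \<in> gtuples G q. k gs \<in> S}"
  by (simp add: lconst_def)

lemma lconst_clopen:
  assumes "lconst q k"
  shows "clopenL T q {gs \<in> gtuples G q. k gs \<in> S}"
proof -
  have "gtuples G q - {gs \<in> gtuples G q. k gs \<in> S} = {gs \<in> gtuples G q. k gs \<in> - S}" by blast
  then show ?thesis using lconst_open[OF assms] by (metis clopenL_iff)
qed

lemma lconst_fibre: "lconst q k \<Longrightarrow> clopenL T q {gs \<in> gtuples G q. k gs = i}"
  using lconst_clopen[of q k "{i}"] by simp

lemma lconst_comp:
  assumes "lconst q k"
  shows "lconst q (\<lambda>gs. \<rho> (k gs))"
proof -
  have "(\<lambda>gs. \<rho> (k gs)) ` gtuples G q = \<rho> ` (k ` gtuples G q)" by blast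
  moreover have "openL T q {gs \<in> gtuples G q. \<rho> (k gs) \<in> S}" for S
    using lconst_open[OF assms, of "\<rho> -` S"] by simp
  ultimately show ?thesis using assms by (simp add: lconst_def)
qed

lemma lconst_pair:
  assumes "lconst q k" "lconst q l"
  shows "lconst q (\<lambda>gs. (k gs, l gs))"
proof -
  have fin: "finite (k ` gtuples G q \<times> l ` gtuples G q)" using assms by (simp add: lconst_def)
  have "openL T q {gs \<in> gtuples G q. (k gs, l gs) \<in> S}" for S
  proof -
    have "{gs \<in> gtuples G q. (k gs, l gs) \<in> S} = (\<Union>(a, b)\<in>(k ` gtuples G q \<times> l ` gtuples G q) \<inter> S.
      {gs \<in> gtuples G q. k gs \<in> {a}} \<inter> {gs \<in> gtuples G q. l gs \<in> {b}})" by auto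
    moreover have "openL T q (case i of (a, b) \<Rightarrow>
      {gs \<in> gtuples G q. k gs \<in> {a}} \<inter> {gs \<in> gtuples G q. l gs \<in> {b}})" for i
    proof (cases i)
      case (Pair a b)
      show ?thesis unfolding Pair prod.case by (rule openL_Int[OF lconst_open[OF assms(1)] lconst_open[OF assms(2)]])
    qed
    ultimately show ?thesis using fin by (simp add: openL_UN)
  qed
  moreover have "finite ((\<lambda>gs. (k gs, l gs)) ` gtuples G q)"
    by (rule finite_subset[OF _ fin]) auto
  ultimately show ?thesis by (simp add: lconst_def)
qed

lemma lconst_mem:
  assumes "clopenL T q V"
  shows "lconst q (\<lambda>gs. gs \<in> V)"
proof -
  have "openL T q {gs \<in> gtuples G q. (gs \<in> V) \<in> S}" for S
  proof -
    have "{gs \<in> gtuples G q. (gs \<in> V) \<in> S} =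
      (if True \<in> S then V else {}) \<union> (if False \<in> S then gtuples G q - V else {})"
      using clopenL_subset[OF assms] by auto (metis (full_types))+
    then show ?thesis using assms by (auto intro!: openL_Un simp: openL_empty openL_gtuples clopenL_iff)
  qed
  then show ?thesis by (simp add: lconst_def)
qed

lemma lconst_cong:
  assumes "lconst q k" "\<And>gs. gs \<in> gtuples G q \<Longrightarrow> l gs = k gs"
  shows "lconst q l"
proof -
  have "l ` gtuples G q = k ` gtuples G q" using assms(2) by simp
  moreover have "{gs \<in> gtuples G q. l gs \<in> S} = {gs \<in> gtuples G q. k gs \<in> S}" for S
    using assms(2) by auto
  ultimately show ?thesis using assms(1) by (simp add: lconst_def)
qed

section \<open>Faces and the action in the product topology\<close>

lemma face_nth:
  assumes "gs \<in> gtuples G (Suc q)" "i \<le> Suc q" "j < q"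
  shows "face G i gs ! j = (if Suc j < i then gs ! j
    else if Suc j = i then gs ! j \<otimes>\<^bsub>G\<^esub> gs ! Suc j else gs ! Suc j)"
proof -
  have len: "length gs = Suc q" using assms by (simp add: gtuples_def)
  consider "i = 0" | "0 < i" "i < length gs" | "i = length gs" using assms len by linarith
  then show ?thesis
  proof cases
    case 1
    then show ?thesis using len assms by (simp add: face_def nth_tl)
  next
    case 2
    then obtain m where "i = Suc m" using gr0_implies_Suc by blast
    then show ?thesis using 2 len assms
      by (auto simp: face_def nth_append min_def nth_Cons split: nat.splits)
        (rule arg_cong[where f = "(!) gs"], arith)
  next
    case 3
    then show ?thesis using len assms by (simp add: face_def nth_butlast)
  qed
qed

text \<open>Openness of a set of lists is defined through \<open>tup\<close>, so a face has to be
  followed on coordinate functions; restricting to \<open>{..<q}\<close> keeps the result in the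
  space of the product topology.\<close>

definition theta :: "nat \<Rightarrow> nat \<Rightarrow> (nat \<Rightarrow> 'g) \<Rightarrow> nat \<Rightarrow> 'g" where
  "theta q i v = (\<lambda>j\<in>{..<q}. if Suc j < i then v j
    else if Suc j = i then v j \<otimes>\<^bsub>G\<^esub> v (Suc j) else v (Suc j))"

lemma face_tup:
  assumes "v \<in> topspace (PT (Suc q))" "i \<le> Suc q"
  shows "face G i (tup (Suc q) v) = tup q (theta q i v)"
proof (rule nth_equalityI)
  have gt: "tup (Suc q) v \<in> gtuples G (Suc q)" using tup_gtuples assms by blast
  have "length (face G i (tup (Suc q) v)) = q"
    using face_gtuples[OF group_G gt assms(2)] by (simp add: gtuples_def)
  then show "length (face G i (tup (Suc q) v)) = length (tup q (theta q i v))" by (simp add: tup_def)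
  fix j assume "j < length (face G i (tup (Suc q) v))"
  then have j: "j < q" using \<open>length (face G i (tup (Suc q) v)) = q\<close> by simp
  show "face G i (tup (Suc q) v) ! j = tup q (theta q i v) ! j"
    unfolding face_nth[OF gt assms(2) j] using j
    by (simp add: tup_def theta_def del: upt_Suc)
qed

lemma continuous_theta:
  assumes "i \<le> Suc q"
  shows "continuous_map (PT (Suc q)) (PT q) (theta q i)"
  unfolding continuous_map_componentwise
proof (intro conjI ballI)
  show "theta q i ` topspace (PT (Suc q)) \<subseteq> extensional {..<q}" by (auto simp: theta_def)
  fix j assume "j \<in> {..<q}"
  then have j: "j < q" by simp
  have proj: "continuous_map (PT (Suc q)) T (\<lambda>v. v l)" if "l < Suc q" for l
    using that continuous_map_product_projection[of l "{..<Suc q}" "\<lambda>_. T"] by simp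
  have mult: "continuous_map (prod_topology T T) T (\<lambda>(x, y). x \<otimes>\<^bsub>G\<^esub> y)"
    using profinite by (simp add: profinite_group_def)
  have "continuous_map (PT (Suc q)) T ((\<lambda>(x, y). x \<otimes>\<^bsub>G\<^esub> y) \<circ> (\<lambda>v. (v j, v (Suc j))))"
    using j by (intro continuous_map_compose[OF _ mult] continuous_map_pairedI proj) auto
  then have "continuous_map (PT (Suc q)) T (\<lambda>v. v j \<otimes>\<^bsub>G\<^esub> v (Suc j))" by (simp add: o_def)
  then show "continuous_map (PT (Suc q)) T (\<lambda>v. theta q i v j)"
    using j proj[of j] proj[of "Suc j"] by (cases "Suc j < i"; cases "Suc j = i") (auto simp: theta_def)
qed

lemma openL_face:
  assumes "openL T q U" "i \<le> Suc q"
  shows "openL T (Suc q) {gs \<in> gtuples G (Suc q). face G i gs \<in> U}"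
proof -
  have "{v \<in> topspace (PT (Suc q)). tup (Suc q) v \<in> {gs \<in> gtuples G (Suc q). face G i gs \<in> U}} =
    {v \<in> topspace (PT (Suc q)). theta q i v \<in> {w \<in> topspace (PT q). tup q w \<in> U}}"
    using face_tup[OF _ assms(2)] tup_gtuples[of _ "Suc q"] continuous_map_funspace[OF continuous_theta[OF assms(2)]]
    by (auto simp del: topspace_product_topology)
  moreover have "openin (PT (Suc q)) {v \<in> topspace (PT (Suc q)). theta q i v \<in> {w \<in> topspace (PT q). tup q w \<in> U}}"
    using assms openL_iff by (intro openin_continuous_map_preimage[OF continuous_theta]) auto
  ultimately show ?thesis by (simp add: openL_iff del: topspace_product_topology)
qed

lemma clopenL_face:
  assumes "clopenL T q V" "i \<le> Suc q"
  shows "clopenL T (Suc q) {gs \<in> gtuples G (Suc q). face G i gs \<in> V}"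
proof -
  have e: "gtuples G (Suc q) - {gs \<in> gtuples G (Suc q). face G i gs \<in> V} =
    {gs \<in> gtuples G (Suc q). face G i gs \<in> gtuples G q - V}"
    using face_gtuples[OF group_G _ assms(2)] by blast
  have o: "openL T q V" "openL T q (gtuples G q - V)" using assms(1) by (simp_all add: clopenL_iff)
  show ?thesis
    unfolding clopenL_iff e using openL_face[OF o(1) assms(2)] openL_face[OF o(2) assms(2)] by blast
qed

lemma lconst_face:
  assumes "lconst q k" "i \<le> Suc q"
  shows "lconst (Suc q) (\<lambda>gs. k (face G i gs))"
  unfolding lconst_def
proof (intro conjI allI)
  have "(\<lambda>gs. k (face G i gs)) ` gtuples G (Suc q) \<subseteq> k ` gtuples G q"
    using face_gtuples[OF group_G _ assms(2)] by blast
  then show "finite ((\<lambda>gs. k (face G i gs)) ` gtuples G (Suc q))"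
    using assms(1) finite_subset by (auto simp: lconst_def)
  fix S
  have "{gs \<in> gtuples G (Suc q). k (face G i gs) \<in> S} =
    {gs \<in> gtuples G (Suc q). face G i gs \<in> {hs \<in> gtuples G q. k hs \<in> S}}"
    using face_gtuples[OF group_G _ assms(2)] by blast
  then show "openL T (Suc q) {gs \<in> gtuples G (Suc q). k (face G i gs) \<in> S}"
    using openL_face[OF lconst_open[OF assms(1)] assms(2)] by simp
qed

text \<open>The inverses of \<open>g\<close> and \<open>g0\<close> act equally on \<open>x\<close>
  precisely when \<open>g0\<close> times the inverse of \<open>g\<close> stabilises
  \<open>x\<close>, an open condition on \<open>g\<close>. As the module is finite, the conditions
  for all \<open>x\<close> together still describe a neighbourhood of \<open>g0\<close>.\<close>

lemma openin_act_inv: "openin T {g \<in> carrier G. act (inv\<^bsub>G\<^esub> g) \<in> S}"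
proof (subst openin_subopen, intro ballI)
  interpret group G by (rule group_G)
  fix g0 assume "g0 \<in> {g \<in> carrier G. act (inv\<^bsub>G\<^esub> g) \<in> S}"
  then have g0: "g0 \<in> carrier G" "act (inv\<^bsub>G\<^esub> g0) \<in> S" by auto
  have act_one: "act \<one>\<^bsub>G\<^esub> x = x" for x using module by (simp add: finite_G_module_def)
  have act_mult: "act (g \<otimes>\<^bsub>G\<^esub> h) x = act g (act h x)" if "g \<in> carrier G" "h \<in> carrier G" for g h x
    using module that by (simp add: finite_G_module_def)
  have stab: "openin T {g \<in> carrier G. act g x = x}" for x
    using module by (simp add: finite_G_module_def)
  have cinv: "continuous_map T T (\<lambda>g. inv\<^bsub>G\<^esub> g)"
    and mult: "continuous_map (prod_topology T T) T (\<lambda>(x, y). x \<otimes>\<^bsub>G\<^esub> y)"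
    using profinite by (simp_all add: profinite_group_def)
  have "continuous_map T T ((\<lambda>(x, y). x \<otimes>\<^bsub>G\<^esub> y) \<circ> (\<lambda>g. (g0, inv\<^bsub>G\<^esub> g)))"
    using g0 by (intro continuous_map_compose[OF _ mult] continuous_map_pairedI cinv)
      (simp add: topspace_T)
  then have cont: "continuous_map T T (\<lambda>g. g0 \<otimes>\<^bsub>G\<^esub> inv\<^bsub>G\<^esub> g)" by (simp add: o_def)
  have eq: "act (g0 \<otimes>\<^bsub>G\<^esub> inv\<^bsub>G\<^esub> g) x = x \<longleftrightarrow> act (inv\<^bsub>G\<^esub> g) x = act (inv\<^bsub>G\<^esub> g0) x" if g: "g \<in> carrier G" for g x
  proof
    assume "act (g0 \<otimes>\<^bsub>G\<^esub> inv\<^bsub>G\<^esub> g) x = x"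
    then have "act (inv\<^bsub>G\<^esub> g0) x = act (inv\<^bsub>G\<^esub> g0) (act g0 (act (inv\<^bsub>G\<^esub> g) x))" using act_mult g0 g by simp
    also have "\<dots> = act (inv\<^bsub>G\<^esub> g) x" using act_mult[of "inv\<^bsub>G\<^esub> g0" g0] act_one g0 by simp
    finally show "act (inv\<^bsub>G\<^esub> g) x = act (inv\<^bsub>G\<^esub> g0) x" by simp
  next
    assume "act (inv\<^bsub>G\<^esub> g) x = act (inv\<^bsub>G\<^esub> g0) x"
    then have "act (g0 \<otimes>\<^bsub>G\<^esub> inv\<^bsub>G\<^esub> g) x = act g0 (act (inv\<^bsub>G\<^esub> g0) x)" using act_mult g0 g by simp
    also have "\<dots> = x" using act_mult[of g0 "inv\<^bsub>G\<^esub> g0"] act_one g0 by simp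
    finally show "act (g0 \<otimes>\<^bsub>G\<^esub> inv\<^bsub>G\<^esub> g) x = x" .
  qed
  define N where "N x = {g \<in> topspace T. g0 \<otimes>\<^bsub>G\<^esub> inv\<^bsub>G\<^esub> g \<in> {g \<in> carrier G. act g x = x}}" for x
  have N: "N x = {g \<in> carrier G. act (inv\<^bsub>G\<^esub> g) x = act (inv\<^bsub>G\<^esub> g0) x}" for x
    using eq g0 by (auto simp: N_def topspace_T)
  have "openin T (\<Inter>x\<in>UNIV. N x)"
    unfolding N_def by (intro openin_INT2 openin_continuous_map_preimage[OF cont stab]) auto
  moreover have "g0 \<in> (\<Inter>x\<in>UNIV. N x)" using g0 by (simp add: N)
  moreover have "(\<Inter>x\<in>UNIV. N x) \<subseteq> {g \<in> carrier G. act (inv\<^bsub>G\<^esub> g) \<in> S}"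
  proof
    fix g assume "g \<in> (\<Inter>x\<in>UNIV. N x)"
    then have "g \<in> carrier G" "act (inv\<^bsub>G\<^esub> g) = act (inv\<^bsub>G\<^esub> g0)" by (auto simp: N)
    then show "g \<in> {g \<in> carrier G. act (inv\<^bsub>G\<^esub> g) \<in> S}" using g0 by simp
  qed
  ultimately show "\<exists>U. openin T U \<and> g0 \<in> U \<and> U \<subseteq> {g \<in> carrier G. act (inv\<^bsub>G\<^esub> g) \<in> S}" by blast
qed

lemma lconst_act: "lconst (Suc q) (\<lambda>gs. act (inv\<^bsub>G\<^esub> (hd gs)))"
  unfolding lconst_def
proof (intro conjI allI)
  show "finite ((\<lambda>gs. act (inv\<^bsub>G\<^esub> (hd gs))) ` gtuples G (Suc q))" by simp
  fix S
  have hd_tup: "hd (tup (Suc q) v) = v 0" for v :: "nat \<Rightarrow> 'g"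
    by (simp add: tup_def upt_conv_Cons del: upt_Suc)
  have e: "{v \<in> topspace (PT (Suc q)). tup (Suc q) v \<in> {gs \<in> gtuples G (Suc q). act (inv\<^bsub>G\<^esub> (hd gs)) \<in> S}} =
    {v \<in> topspace (PT (Suc q)). v 0 \<in> {g \<in> carrier G. act (inv\<^bsub>G\<^esub> g) \<in> S}}"
    using tup_gtuples[of _ "Suc q"] hd_carrier[of _ q] hd_tup by (auto simp del: topspace_product_topology) metis
  have o: "openin (PT (Suc q)) {v \<in> topspace (PT (Suc q)). v 0 \<in> {g \<in> carrier G. act (inv\<^bsub>G\<^esub> g) \<in> S}}"
    using continuous_map_product_projection[of 0 "{..<Suc q}" "\<lambda>_. T"]
    by (intro openin_continuous_map_preimage[OF _ openin_act_inv]) simp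
  show "openL T (Suc q) {gs \<in> gtuples G (Suc q). act (inv\<^bsub>G\<^esub> (hd gs)) \<in> S}"
    unfolding openL_iff e using o by blast
qed

section \<open>Measures and continuous cochains\<close>

definition qccochains :: "nat \<Rightarrow> ('g list \<Rightarrow> 'm \<Rightarrow> qz) set" where
  "qccochains q = {f \<in> qcochains G q. lconst q f}"

text \<open>The integral of the character-valued function \<open>\<gamma> (k gs)\<close> against
  \<open>\<mu>\<close>, as a sum over the fibres of \<open>k\<close>. Keeping
  \<open>\<gamma>\<close> apart from \<open>k\<close> allows the partition to be refined.\<close>

definition integ :: "nat \<Rightarrow> ('g list set \<Rightarrow> 'm) \<Rightarrow> ('g list \<Rightarrow> 's) \<Rightarrow> ('s \<Rightarrow> 'm \<Rightarrow> qz) \<Rightarrow> qz" where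
  "integ q \<mu> k \<gamma> = (\<Sum>i\<in>k ` gtuples G q. \<gamma> i (\<mu> {gs \<in> gtuples G q. k gs = i}))"

definition cpair :: "nat \<Rightarrow> ('g list \<Rightarrow> 'm \<Rightarrow> qz) \<Rightarrow> ('g list set \<Rightarrow> 'm) \<Rightarrow> qz" where
  "cpair q g \<mu> = integ q \<mu> g (\<lambda>\<xi>. \<xi>)"

lemma cchains_add:
  "\<mu> \<in> cchains T q \<Longrightarrow> clopenL T q V \<Longrightarrow> clopenL T q W \<Longrightarrow> V \<inter> W = {} \<Longrightarrow> \<mu> (V \<union> W) = \<mu> V + \<mu> W"
  by (simp add: cchains_def)

lemma cchains_empty:
  fixes \<mu> :: "'g list set \<Rightarrow> 'm"
  assumes "\<mu> \<in> cchains T q"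
  shows "\<mu> {} = 0"
  using cchains_add[OF assms clopenL_empty clopenL_empty] by simp

lemma cchains_fibres:
  fixes \<mu> :: "'g list set \<Rightarrow> 'm"
  assumes "\<mu> \<in> cchains T q" "lconst q k" "finite I"
  shows "\<mu> {gs \<in> gtuples G q. k gs \<in> I} = (\<Sum>i\<in>I. \<mu> {gs \<in> gtuples G q. k gs = i})"
  using assms(3)
proof (induction I rule: finite_induct)
  case (insert i I)
  have "{gs \<in> gtuples G q. k gs \<in> insert i I} =
    {gs \<in> gtuples G q. k gs = i} \<union> {gs \<in> gtuples G q. k gs \<in> I}" by blast
  moreover have "{gs \<in> gtuples G q. k gs = i} \<inter> {gs \<in> gtuples G q. k gs \<in> I} = {}"
    using insert.hyps by blast
  ultimately show ?case
    using cchains_add[OF assms(1) lconst_fibre[OF assms(2)] lconst_clopen[OF assms(2)]] insert by simp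
qed (simp add: cchains_empty[OF assms(1)])

lemma integ_superset:
  assumes "\<mu> \<in> cchains T q" "finite J" "k ` gtuples G q \<subseteq> J" "\<And>i. i \<in> J \<Longrightarrow> \<gamma> i \<in> chars"
  shows "integ q \<mu> k \<gamma> = (\<Sum>i\<in>J. \<gamma> i (\<mu> {gs \<in> gtuples G q. k gs = i}))"
  unfolding integ_def
proof (rule sum.mono_neutral_left[OF assms(2,3)], rule ballI)
  fix i assume i: "i \<in> J - k ` gtuples G q"
  then have e: "{gs \<in> gtuples G q. k gs = i} = {}" by blast
  show "\<gamma> i (\<mu> {gs \<in> gtuples G q. k gs = i}) = 0"
    unfolding e cchains_empty[OF assms(1)] using i assms(4) chars_0 by blast
qed

text \<open>Additivity of \<open>\<mu>\<close> collects the fibres of \<open>k\<close> over each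
  value of \<open>\<rho>\<close>. In use, \<open>k\<close> is a refinement on which all functions to
  be compared are constant.\<close>

lemma integ_comp:
  assumes \<mu>: "\<mu> \<in> cchains T q" and k: "lconst q k"
    and \<gamma>: "\<And>i. i \<in> k ` gtuples G q \<Longrightarrow> \<gamma> (\<rho> i) \<in> chars"
    and l: "\<And>gs. gs \<in> gtuples G q \<Longrightarrow> l gs = \<rho> (k gs)"
  shows "integ q \<mu> l \<gamma> = integ q \<mu> k (\<lambda>i. \<gamma> (\<rho> i))"
proof -
  let ?I = "k ` gtuples G q"
  have fin: "finite ?I" using k by (simp add: lconst_def)
  have img: "l ` gtuples G q = \<rho> ` ?I" using l by force
  have "integ q \<mu> k (\<lambda>i. \<gamma> (\<rho> i)) =
    (\<Sum>j\<in>\<rho> ` ?I. \<Sum>i\<in>{i \<in> ?I. \<rho> i = j}. \<gamma> (\<rho> i) (\<mu> {gs \<in> gtuples G q. k gs = i}))"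
    unfolding integ_def using sum.image_gen[OF fin] by fast
  also have "\<dots> = (\<Sum>j\<in>\<rho> ` ?I. \<gamma> j (\<mu> {gs \<in> gtuples G q. l gs = j}))"
  proof (rule sum.cong[OF refl])
    fix j assume "j \<in> \<rho> ` ?I"
    then have \<gamma>j: "\<gamma> j \<in> chars" using \<gamma> by blast
    have fin_j: "finite {i \<in> ?I. \<rho> i = j}" using fin by simp
    have e: "{gs \<in> gtuples G q. l gs = j} = {gs \<in> gtuples G q. k gs \<in> {i \<in> ?I. \<rho> i = j}}"
      using l by auto
    have "\<gamma> j (\<mu> {gs \<in> gtuples G q. l gs = j}) =
      (\<Sum>i\<in>{i \<in> ?I. \<rho> i = j}. \<gamma> j (\<mu> {gs \<in> gtuples G q. k gs = i}))"
      unfolding e cchains_fibres[OF \<mu> k fin_j] by (rule chars_sum[OF \<gamma>j])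
    then show "(\<Sum>i\<in>{i \<in> ?I. \<rho> i = j}. \<gamma> (\<rho> i) (\<mu> {gs \<in> gtuples G q. k gs = i})) =
      \<gamma> j (\<mu> {gs \<in> gtuples G q. l gs = j})" by simp
  qed
  finally show ?thesis by (simp add: integ_def img)
qed

lemma qccochainsD:
  assumes "g \<in> qccochains q"
  shows "g \<in> qcochains G q" "lconst q g" "g gs \<in> chars" "finite (g ` gtuples G q)"
  using assms qcochainsD(1) by (auto simp: qccochains_def lconst_def)

lemma subgrp_qccochains: "subgrp (qccochains q)"
proof (rule subgrpI)
  have "lconst q (\<lambda>gs. (\<lambda>_. 0) (gs \<in> {})) " by (rule lconst_comp[OF lconst_mem[OF clopenL_empty]])
  then have "lconst q (0 :: 'g list \<Rightarrow> 'm \<Rightarrow> qz)" by (rule lconst_cong) simp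
  then show "0 \<in> qccochains q" by (simp add: qccochains_def subgrp_0[OF subgrp_qcochains])
  fix g h assume gh: "g \<in> qccochains q" "h \<in> qccochains q"
  have "lconst q (\<lambda>gs. case_prod (-) (g gs, h gs))"
    by (rule lconst_comp[OF lconst_pair]) (use gh qccochainsD in auto)
  then have "lconst q (g - h)" by (rule lconst_cong) simp
  then show "g - h \<in> qccochains q"
    using gh subgrp_diff[OF subgrp_qcochains] by (auto simp: qccochains_def)
qed

lemma subgrp_cchains: "subgrp (cchains T q :: ('g list set \<Rightarrow> 'm) set)"
  by (rule subgrpI) (auto simp: cchains_def algebra_simps)

lemma cpair_hom_left:
  assumes \<mu>: "\<mu> \<in> cchains T q"
  shows "hom_on (qccochains q) (\<lambda>g. cpair q g \<mu>)"
proof (rule hom_onI)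
  fix g h assume g: "g \<in> qccochains q" and h: "h \<in> qccochains q"
  \<comment> \<open>The common refinement of the partitions given by \<open>g\<close> and
    \<open>h\<close>.\<close>
  define k where "k gs = (g gs, h gs)" for gs
  have k: "lconst q k" unfolding k_def by (rule lconst_pair) (use g h qccochainsD in auto)
  have kch: "fst i \<in> chars" "snd i \<in> chars" if "i \<in> k ` gtuples G q" for i
    using that g h qccochainsD(3) by (auto simp: k_def)
  have "cpair q (g + h) \<mu> = integ q \<mu> k (\<lambda>i. fst i + snd i)"
    unfolding cpair_def
    by (rule integ_comp[OF \<mu> k, where \<gamma> = "\<lambda>\<xi>. \<xi>" and \<rho> = "\<lambda>i. fst i + snd i"])
      (auto simp: k_def intro!: subgrp_add[OF subgrp_chars] qccochainsD(3)[OF g] qccochainsD(3)[OF h])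
  also have "\<dots> = integ q \<mu> k fst + integ q \<mu> k snd" by (simp add: integ_def sum.distrib)
  also have "integ q \<mu> k fst = cpair q g \<mu>"
    unfolding cpair_def using kch by (intro integ_comp[OF \<mu> k, symmetric]) (auto simp: k_def)
  also have "integ q \<mu> k snd = cpair q h \<mu>"
    unfolding cpair_def using kch by (intro integ_comp[OF \<mu> k, symmetric]) (auto simp: k_def)
  finally show "cpair q (g + h) \<mu> = cpair q g \<mu> + cpair q h \<mu>" .
qed

text \<open>The elementary cochains: every locally constant cochain is the finite sum of those on
  its fibres, and integrating them recovers the measure.\<close>

definition bump :: "'g list set \<Rightarrow> ('m \<Rightarrow> qz) \<Rightarrow> 'g list \<Rightarrow> 'm \<Rightarrow> qz" where
  "bump V \<xi> = (\<lambda>gs. if gs \<in> V then \<xi> else 0)"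

lemma bump_qccochains:
  assumes "clopenL T q V" "\<xi> \<in> chars"
  shows "bump V \<xi> \<in> qccochains q"
proof -
  have "lconst q (\<lambda>gs. (\<lambda>b. if b then \<xi> else 0) (gs \<in> V))"
    by (rule lconst_comp[OF lconst_mem[OF assms(1)]])
  moreover have "bump V \<xi> \<in> qcochains G q"
    using assms clopenL_subset[OF assms(1)] subgrp_0[OF subgrp_chars]
    by (auto simp: qcochains_def bump_def)
  ultimately show ?thesis by (simp add: qccochains_def bump_def)
qed

lemma cpair_bump:
  assumes "clopenL T q V" "\<xi> \<in> chars" "\<mu> \<in> cchains T q"
  shows "cpair q (bump V \<xi>) \<mu> = \<xi> (\<mu> V)"
proof -
  have ch: "(if b then \<xi> else 0) \<in> chars" for b using assms by (simp add: subgrp_0[OF subgrp_chars])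
  have "cpair q (bump V \<xi>) \<mu> = integ q \<mu> (\<lambda>gs. gs \<in> V) (\<lambda>b. if b then \<xi> else 0)"
    unfolding cpair_def using ch
    by (intro integ_comp[OF assms(3) lconst_mem[OF assms(1)]]) (auto simp: bump_def)
  also have "\<dots> = (\<Sum>b\<in>UNIV. (if b then \<xi> else 0) (\<mu> {gs \<in> gtuples G q. (gs \<in> V) = b}))"
    by (rule integ_superset[OF assms(3)]) (use ch in auto)
  also have "\<dots> = \<xi> (\<mu> {gs \<in> gtuples G q. gs \<in> V})" by (simp add: UNIV_bool)
  also have "{gs \<in> gtuples G q. gs \<in> V} = V" using clopenL_subset[OF assms(1)] by blast
  finally show ?thesis .
qed

lemma full_dual_cchains: "full_dual (qccochains q) (cchains T q) (cpair q)"
  unfolding full_dual_def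
proof (intro conjI ballI allI impI)
  show "subgrp (qccochains q)" by (rule subgrp_qccochains)
  show "subgrp (cchains T q :: ('g list set \<Rightarrow> 'm) set)" by (rule subgrp_cchains)
  show "hom_on (qccochains q) (\<lambda>g. cpair q g \<mu>)" if "\<mu> \<in> cchains T q" for \<mu>
    using cpair_hom_left[OF that] .
  show "hom_on (cchains T q) (cpair q g)" if g: "g \<in> qccochains q" for g
  proof (rule hom_onI)
    fix \<mu> \<nu> :: "'g list set \<Rightarrow> 'm"
    have "\<xi> \<in> chars" if "\<xi> \<in> g ` gtuples G q" for \<xi> using that g qccochainsD(3) by blast
    then show "cpair q g (\<mu> + \<nu>) = cpair q g \<mu> + cpair q g \<nu>"
      by (simp add: cpair_def integ_def chars_add flip: sum.distrib)
  qed
next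
  fix F :: "('g list \<Rightarrow> 'm \<Rightarrow> qz) \<Rightarrow> qz" assume F: "hom_on UNIV F"
  \<comment> \<open>The mass of \<open>V\<close> is the element of the module representing \<xi> ->
    \<open>F (bump V \<xi>)\<close>, which exists by \<open>double_dual\<close>; additivity in
    \<open>V\<close> holds because characters separate points.\<close>
  define \<mu> where "\<mu> V = (if clopenL T q V then SOME x. \<forall>\<xi>\<in>chars. \<xi> x = F (bump V \<xi>) else 0)" for V
  have \<mu>: "\<xi> (\<mu> V) = F (bump V \<xi>)" if V: "clopenL T q V" and \<xi>: "\<xi> \<in> chars" for V \<xi>
  proof -
    have "bump V (\<alpha> + \<beta>) = bump V \<alpha> + bump V \<beta>" for \<alpha> \<beta> by (auto simp: bump_def fun_eq_iff)
    then have "hom_on chars (\<lambda>\<xi>. F (bump V \<xi>))"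
      by (intro hom_onI) (simp add: hom_on_add[OF F])
    then have "\<exists>x. \<forall>\<xi>\<in>chars. \<xi> x = F (bump V \<xi>)" using double_dual by metis
    then have "\<forall>\<xi>\<in>chars. \<xi> (SOME x. \<forall>\<xi>\<in>chars. \<xi> x = F (bump V \<xi>)) = F (bump V \<xi>)"
      by (rule someI_ex)
    then show ?thesis using V \<xi> by (simp add: \<mu>_def)
  qed
  have \<mu>_mem: "\<mu> \<in> cchains T q"
    unfolding cchains_def
  proof (intro CollectI conjI allI impI; (elim conjE)?)
    show "\<mu> V = 0" if "\<not> clopenL T q V" for V using that by (simp add: \<mu>_def)
    fix V W assume V: "clopenL T q V" and W: "clopenL T q W" and d: "V \<inter> W = {}"
    show "\<mu> (V \<union> W) = \<mu> V + \<mu> W"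
    proof (rule chars_separate)
      fix \<xi> :: "'m \<Rightarrow> qz" assume \<xi>: "\<xi> \<in> chars"
      have "bump (V \<union> W) \<xi> = bump V \<xi> + bump W \<xi>" using d by (auto simp: bump_def fun_eq_iff)
      then show "\<xi> (\<mu> (V \<union> W)) = \<xi> (\<mu> V + \<mu> W)"
        using \<mu>[OF V \<xi>] \<mu>[OF W \<xi>] \<mu>[OF clopenL_Un[OF V W] \<xi>] \<xi>
        by (simp add: chars_add hom_on_add[OF F])
    qed
  qed
  have "cpair q g \<mu> = F g" if g: "g \<in> qccochains q" for g
  proof -
    note gD = qccochainsD[OF g]
    have "cpair q g \<mu> = (\<Sum>\<xi>\<in>g ` gtuples G q. F (bump {gs \<in> gtuples G q. g gs = \<xi>} \<xi>))"
      unfolding cpair_def integ_def using \<mu> lconst_fibre[OF gD(2)] gD(3) by (intro sum.cong) auto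
    also have "\<dots> = F (\<Sum>\<xi>\<in>g ` gtuples G q. bump {gs \<in> gtuples G q. g gs = \<xi>} \<xi>)"
      by (rule hom_on_sum[OF subgrp_UNIV F UNIV_I, symmetric])
    also have "(\<Sum>\<xi>\<in>g ` gtuples G q. bump {gs \<in> gtuples G q. g gs = \<xi>} \<xi>) = g"
    proof
      fix gs
      show "(\<Sum>\<xi>\<in>g ` gtuples G q. bump {gs \<in> gtuples G q. g gs = \<xi>} \<xi>) gs = g gs"
      proof (cases "gs \<in> gtuples G q")
        case True
        then show ?thesis using gD(4) by (simp add: sum_fun_apply[of _ _ gs] bump_def sum.delta)
      next
        case False
        then show ?thesis using qcochainsD(2)[OF gD(1)] by (simp add: sum_fun_apply[of _ _ gs] bump_def)
      qed
    qed
    finally show ?thesis .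
  qed
  then show "\<exists>\<mu>\<in>cchains T q. \<forall>g\<in>qccochains q. cpair q g \<mu> = F g" using \<mu>_mem by blast
next
  fix \<mu> :: "'g list set \<Rightarrow> 'm"
  assume \<mu>: "\<mu> \<in> cchains T q" and 0: "\<forall>g\<in>qccochains q. cpair q g \<mu> = 0"
  have "\<mu> V = 0" for V
  proof (cases "clopenL T q V")
    case True
    show ?thesis
      by (rule chars_separate) (metis 0 True \<mu> bump_qccochains cpair_bump chars_0)
  next
    case False
    then show ?thesis using \<mu> by (simp add: cchains_def)
  qed
  then show "\<mu> = 0" by (simp add: fun_eq_iff)
qed

section \<open>The boundary of measures as adjoint of the continuous coboundary\<close>

lemma qcoface_qccochains:
  assumes g: "g \<in> qccochains q" and i: "i \<le> Suc q"
  shows "qcoface G act q i g \<in> qccochains (Suc q)"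
proof -
  note gD = qccochainsD[OF g]
  have "lconst (Suc q) (\<lambda>gs. (act (inv\<^bsub>G\<^esub> (hd gs)), g (face G i gs)))"
    by (rule lconst_pair[OF lconst_act lconst_face[OF gD(2) i]])
  from lconst_comp[OF this, of "\<lambda>(\<phi>, \<xi>) x. \<xi> (if i = 0 then \<phi> x else x)"]
  have "lconst (Suc q) (qcoface G act q i g)"
    by (rule lconst_cong) (auto simp: qcoface_def twist_def)
  then show ?thesis using qcoface_qcochains[OF gD(1)] by (simp add: qccochains_def)
qed

lemma qcobd_qccochains: "g \<in> qccochains q \<Longrightarrow> qcobd G act q g \<in> qccochains (Suc q)"
  unfolding qcobd_def by (intro subgrp_sum subgrp_alt subgrp_qccochains qcoface_qccochains) auto

text \<open>The image measure under face \<open>i\<close>. For \<open>i = 0\<close> the mass is also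
  moved by an operator depending on the first entry, so the measure is first cut along the finitely
  many operators \<open>\<phi>\<close>.\<close>

definition pushface :: "nat \<Rightarrow> nat \<Rightarrow> ('g list set \<Rightarrow> 'm) \<Rightarrow> 'g list set \<Rightarrow> 'm" where
  "pushface q i \<mu> V = (if i = 0 then
     (\<Sum>\<phi>\<in>(\<lambda>g. act (inv\<^bsub>G\<^esub> g)) ` carrier G.
        \<phi> (\<mu> {gs \<in> gtuples G (Suc q). act (inv\<^bsub>G\<^esub> (hd gs)) = \<phi> \<and> face G 0 gs \<in> V}))
     else \<mu> {gs \<in> gtuples G (Suc q). face G i gs \<in> V})"

lemma cbd_eq: "cbd G T act (Suc q) \<mu> =
    (\<lambda>V. if clopenL T q V then \<Sum>i\<in>{0..Suc q}. alt i (pushface q i \<mu> V) else 0)"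
  by (intro ext) (simp add: cbd_def pushface_def face_def[of G 0] cong: if_cong)

lemma clopenL_act_face:
  assumes "clopenL T q V"
  shows "clopenL T (Suc q) {gs \<in> gtuples G (Suc q). act (inv\<^bsub>G\<^esub> (hd gs)) = \<phi> \<and> face G 0 gs \<in> V}"
  using lconst_clopen[OF lconst_pair[OF lconst_act lconst_face[OF lconst_mem[OF assms], of 0]],
      of "{(\<phi>, True)}"] by simp

lemma pushface_add:
  assumes \<mu>: "\<mu> \<in> cchains T (Suc q)" and i: "i \<le> Suc q"
    and V: "clopenL T q V" and W: "clopenL T q W" and d: "V \<inter> W = {}"
  shows "pushface q i \<mu> (V \<union> W) = pushface q i \<mu> V + pushface q i \<mu> W"
proof (cases "i = 0")
  case True
  have "\<phi> (\<mu> {gs \<in> gtuples G (Suc q). act (inv\<^bsub>G\<^esub> (hd gs)) = \<phi> \<and> face G 0 gs \<in> V \<union> W}) =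
    \<phi> (\<mu> {gs \<in> gtuples G (Suc q). act (inv\<^bsub>G\<^esub> (hd gs)) = \<phi> \<and> face G 0 gs \<in> V}) +
    \<phi> (\<mu> {gs \<in> gtuples G (Suc q). act (inv\<^bsub>G\<^esub> (hd gs)) = \<phi> \<and> face G 0 gs \<in> W})"
    if "\<phi> \<in> (\<lambda>g. act (inv\<^bsub>G\<^esub> g)) ` carrier G" for \<phi>
  proof -
    have \<phi>: "\<phi> (x + y) = \<phi> x + \<phi> y" for x y
      using that act_add group.inv_closed[OF group_G] by auto
    have e: "{gs \<in> gtuples G (Suc q). act (inv\<^bsub>G\<^esub> (hd gs)) = \<phi> \<and> face G 0 gs \<in> V \<union> W} =
      {gs \<in> gtuples G (Suc q). act (inv\<^bsub>G\<^esub> (hd gs)) = \<phi> \<and> face G 0 gs \<in> V} \<union>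
      {gs \<in> gtuples G (Suc q). act (inv\<^bsub>G\<^esub> (hd gs)) = \<phi> \<and> face G 0 gs \<in> W}" by blast
    show ?thesis
      unfolding e \<phi>[symmetric]
      using d by (subst cchains_add[OF \<mu> clopenL_act_face[OF V] clopenL_act_face[OF W]]) auto
  qed
  then show ?thesis unfolding pushface_def using True by (simp flip: sum.distrib cong: sum.cong)
next
  case False
  have e: "{gs \<in> gtuples G (Suc q). face G i gs \<in> V \<union> W} =
    {gs \<in> gtuples G (Suc q). face G i gs \<in> V} \<union> {gs \<in> gtuples G (Suc q). face G i gs \<in> W}" by blast
  show ?thesis
    using False d cchains_add[OF \<mu> clopenL_face[OF V i] clopenL_face[OF W i]]
    unfolding pushface_def e by auto
qed

lemma cbd_cchains:
  assumes \<mu>: "\<mu> \<in> cchains T (Suc q)"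
  shows "cbd G T act (Suc q) \<mu> \<in> cchains T q"
  unfolding cchains_def cbd_eq
proof (intro CollectI conjI allI impI; (elim conjE)?)
  fix V W assume VW: "clopenL T q V" "clopenL T q W" "V \<inter> W = {}"
  have "(\<Sum>i\<in>{0..Suc q}. alt i (pushface q i \<mu> (V \<union> W))) =
    (\<Sum>i\<in>{0..Suc q}. alt i (pushface q i \<mu> V) + alt i (pushface q i \<mu> W))"
    by (rule sum.cong) (auto simp: pushface_add[OF \<mu> _ VW] alt_add)
  then show "(if clopenL T q (V \<union> W) then \<Sum>i\<in>{0..Suc q}. alt i (pushface q i \<mu> (V \<union> W)) else 0) =
    (if clopenL T q V then \<Sum>i\<in>{0..Suc q}. alt i (pushface q i \<mu> V) else 0) +
    (if clopenL T q W then \<Sum>i\<in>{0..Suc q}. alt i (pushface q i \<mu> W) else 0)"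
    using VW clopenL_Un by (simp only: if_True sum.distrib)
qed simp

text \<open>Change of variables, one face at a time: the right-hand side is the integral of
  \<open>g\<close> against the image measure.\<close>

lemma cpair_qcoface:
  assumes g: "g \<in> qccochains q" and \<mu>: "\<mu> \<in> cchains T (Suc q)" and i: "i \<le> Suc q"
  shows "cpair (Suc q) (qcoface G act q i g) \<mu> =
    (\<Sum>\<xi>\<in>g ` gtuples G q. \<xi> (pushface q i \<mu> {gs \<in> gtuples G q. g gs = \<xi>}))"
proof -
  note gD = qccochainsD[OF g]
  note ft = face_gtuples[OF group_G _ i]
  show ?thesis
  proof (cases "i = 0")
    case True
    \<comment> \<open>The twisted coface depends only on the operator of the first entry and on the
      value of \<open>g\<close> at the face, so the integral may be taken over this finer
      partition.\<close>
    define k where "k gs = (act (inv\<^bsub>G\<^esub> (hd gs)), g (face G 0 gs))" for gs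
    define \<Phi> where "\<Phi> = (\<lambda>g. act (inv\<^bsub>G\<^esub> g)) ` carrier G"
    define \<gamma> where "\<gamma> = (\<lambda>(\<phi> :: 'm \<Rightarrow> 'm, \<xi> :: 'm \<Rightarrow> qz) x. \<xi> (\<phi> x))"
    have k: "lconst (Suc q) k"
      unfolding k_def by (rule lconst_pair[OF lconst_act lconst_face[OF gD(2)]]) simp
    have kJ: "k ` gtuples G (Suc q) \<subseteq> \<Phi> \<times> g ` gtuples G q"
      using hd_carrier ft True by (auto simp: k_def \<Phi>_def)
    have \<gamma>: "\<gamma> j \<in> chars" if j: "j \<in> \<Phi> \<times> g ` gtuples G q" for j
    proof -
      obtain \<phi> \<xi> where j: "j = (\<phi>, \<xi>)" "\<phi> \<in> \<Phi>" "\<xi> \<in> chars" using j gD(3) by auto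
      have "\<phi> (x + y) = \<phi> x + \<phi> y" for x y
        using j(2) act_add group.inv_closed[OF group_G] by (auto simp: \<Phi>_def)
      then show ?thesis using j by (simp add: \<gamma>_def chars_def hom_on_def)
    qed
    have "cpair (Suc q) (qcoface G act q i g) \<mu> = integ (Suc q) \<mu> k \<gamma>"
      unfolding cpair_def using kJ \<gamma> True
      by (intro integ_comp[OF \<mu> k]) (auto simp: k_def qcoface_def twist_def \<gamma>_def)
    \<comment> \<open>Pairs that do not occur have an empty fibre of mass 0. Over the full product
      the two summations can be exchanged.\<close>
    also have "\<dots> = (\<Sum>j\<in>\<Phi> \<times> g ` gtuples G q. \<gamma> j (\<mu> {gs \<in> gtuples G (Suc q). k gs = j}))"
      using gD(4) by (intro integ_superset[OF \<mu> _ kJ \<gamma>]) auto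
    also have "\<dots> = (\<Sum>\<phi>\<in>\<Phi>. \<Sum>\<xi>\<in>g ` gtuples G q. \<xi> (\<phi> (\<mu> {gs \<in> gtuples G (Suc q). k gs = (\<phi>, \<xi>)})))"
      by (simp add: \<gamma>_def sum.cartesian_product case_prod_unfold)
    also have "\<dots> = (\<Sum>\<xi>\<in>g ` gtuples G q. \<Sum>\<phi>\<in>\<Phi>. \<xi> (\<phi> (\<mu> {gs \<in> gtuples G (Suc q). k gs = (\<phi>, \<xi>)})))"
      by (rule sum.swap)
    also have "\<dots> = (\<Sum>\<xi>\<in>g ` gtuples G q. \<xi> (pushface q i \<mu> {gs \<in> gtuples G q. g gs = \<xi>}))"
    proof (rule sum.cong[OF refl])
      fix \<xi> assume "\<xi> \<in> g ` gtuples G q"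
      then have \<xi>: "\<xi> \<in> chars" using gD(3) by blast
      have "{gs \<in> gtuples G (Suc q). act (inv\<^bsub>G\<^esub> (hd gs)) = \<phi> \<and> face G 0 gs \<in> {gs \<in> gtuples G q. g gs = \<xi>}} =
        {gs \<in> gtuples G (Suc q). k gs = (\<phi>, \<xi>)}" for \<phi>
        using ft True by (auto simp: k_def)
      then show "(\<Sum>\<phi>\<in>\<Phi>. \<xi> (\<phi> (\<mu> {gs \<in> gtuples G (Suc q). k gs = (\<phi>, \<xi>)}))) =
        \<xi> (pushface q i \<mu> {gs \<in> gtuples G q. g gs = \<xi>})"
        using True by (simp add: pushface_def chars_sum[OF \<xi>] \<Phi>_def)
    qed
    finally show ?thesis .
  next
    case False
    have k: "lconst (Suc q) (\<lambda>gs. g (face G i gs))" by (rule lconst_face[OF gD(2) i])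
    have "cpair (Suc q) (qcoface G act q i g) \<mu> = integ (Suc q) \<mu> (\<lambda>gs. g (face G i gs)) (\<lambda>\<xi>. \<xi>)"
      unfolding cpair_def using False gD(3)
      by (intro integ_comp[OF \<mu> k, where \<rho> = "\<lambda>\<xi>. \<xi>"]) (auto simp: qcoface_def twist_def)
    also have "\<dots> = (\<Sum>\<xi>\<in>g ` gtuples G q. \<xi> (\<mu> {gs \<in> gtuples G (Suc q). g (face G i gs) = \<xi>}))"
      using gD(3,4) ft by (intro integ_superset[OF \<mu>]) auto
    also have "\<dots> = (\<Sum>\<xi>\<in>g ` gtuples G q. \<xi> (pushface q i \<mu> {gs \<in> gtuples G q. g gs = \<xi>}))"
    proof (rule sum.cong[OF refl])
      fix \<xi>
      have "{gs \<in> gtuples G (Suc q). face G i gs \<in> {gs \<in> gtuples G q. g gs = \<xi>}} =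
        {gs \<in> gtuples G (Suc q). g (face G i gs) = \<xi>}" using ft by auto
      then show "\<xi> (\<mu> {gs \<in> gtuples G (Suc q). g (face G i gs) = \<xi>}) =
        \<xi> (pushface q i \<mu> {gs \<in> gtuples G q. g gs = \<xi>})" using False by (simp add: pushface_def)
    qed
    finally show ?thesis .
  qed
qed

lemma cpair_adjoint:
  assumes g: "g \<in> qccochains q" and \<mu>: "\<mu> \<in> cchains T (Suc q)"
  shows "cpair (Suc q) (qcobd G act q g) \<mu> = cpair q g (cbd G T act (Suc q) \<mu>)"
proof -
  note gD = qccochainsD[OF g]
  note sg = subgrp_qccochains[of "Suc q"] and hom = cpair_hom_left[OF \<mu>]
  have mem: "qcoface G act q i g \<in> qccochains (Suc q)" if "i \<in> {0..Suc q}" for i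
    using qcoface_qccochains[OF g] that by simp
  have "cpair (Suc q) (qcobd G act q g) \<mu> =
    (\<Sum>i\<in>{0..Suc q}. cpair (Suc q) (alt i (qcoface G act q i g)) \<mu>)"
    unfolding qcobd_def by (rule hom_on_sum[OF sg hom]) (intro subgrp_alt[OF sg] mem)
  also have "\<dots> = (\<Sum>i\<in>{0..Suc q}. alt i (cpair (Suc q) (qcoface G act q i g) \<mu>))"
    by (intro sum.cong refl hom_on_alt[OF sg hom] mem)
  also have "\<dots> = (\<Sum>i\<in>{0..Suc q}. \<Sum>\<xi>\<in>g ` gtuples G q.
      alt i (\<xi> (pushface q i \<mu> {gs \<in> gtuples G q. g gs = \<xi>})))"
    by (intro sum.cong refl) (simp add: cpair_qcoface[OF g \<mu>] alt_sum)
  also have "\<dots> = (\<Sum>\<xi>\<in>g ` gtuples G q. \<Sum>i\<in>{0..Suc q}.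
      alt i (\<xi> (pushface q i \<mu> {gs \<in> gtuples G q. g gs = \<xi>})))"
    by (rule sum.swap)
  also have "\<dots> = (\<Sum>\<xi>\<in>g ` gtuples G q. \<xi> (cbd G T act (Suc q) \<mu> {gs \<in> gtuples G q. g gs = \<xi>}))"
  proof (rule sum.cong[OF refl])
    fix \<xi> assume "\<xi> \<in> g ` gtuples G q"
    then have \<xi>: "\<xi> \<in> chars" using gD(3) by blast
    show "(\<Sum>i\<in>{0..Suc q}. alt i (\<xi> (pushface q i \<mu> {gs \<in> gtuples G q. g gs = \<xi>}))) =
      \<xi> (cbd G T act (Suc q) \<mu> {gs \<in> gtuples G q. g gs = \<xi>})"
      unfolding cbd_eq using lconst_fibre[OF gD(2)] by (simp only: if_True chars_sum[OF \<xi>] chars_alt[OF \<xi>])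
  qed
  finally show ?thesis by (simp add: cpair_def integ_def)
qed

section \<open>Dirac measures of abstract chains\<close>

lemma dirac_cchains:
  fixes c :: "'g list \<Rightarrow> 'm"
  assumes c: "c \<in> dchains G q"
  shows "dirac_chain T q c \<in> cchains T q"
  unfolding cchains_def
proof (intro CollectI conjI allI impI; (elim conjE)?)
  fix V W assume VW: "clopenL T q V" "clopenL T q W" "V \<inter> W = {}"
  have "finite {gs. c gs \<noteq> 0}" using c by (simp add: dchains_def)
  then have "(\<Sum>gs\<in>{gs. c gs \<noteq> 0} \<inter> (V \<union> W). c gs) =
    (\<Sum>gs\<in>{gs. c gs \<noteq> 0} \<inter> V. c gs) + (\<Sum>gs\<in>{gs. c gs \<noteq> 0} \<inter> W. c gs)"
    unfolding Int_Un_distrib using VW by (intro sum.union_disjoint) auto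
  then show "dirac_chain T q c (V \<union> W) = dirac_chain T q c V + dirac_chain T q c W"
    using VW clopenL_Un by (simp add: dirac_chain_def)
qed (simp add: dirac_chain_def)

lemma cpair_dirac:
  assumes g: "g \<in> qccochains q" and c: "c \<in> dchains G q"
  shows "cpair q g (dirac_chain T q c) = dpair c g"
proof -
  note gD = qccochainsD[OF g]
  let ?S = "{gs. c gs \<noteq> 0}"
  have S: "finite ?S" "?S \<subseteq> gtuples G q" using c by (auto simp: dchains_def)
  have "cpair q g (dirac_chain T q c) =
    (\<Sum>\<xi>\<in>g ` gtuples G q. \<Sum>gs\<in>{gs \<in> ?S. g gs = \<xi>}. g gs (c gs))"
    unfolding cpair_def integ_def
  proof (rule sum.cong[OF refl])
    fix \<xi> assume "\<xi> \<in> g ` gtuples G q"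
    then have \<xi>: "\<xi> \<in> chars" using gD(3) by blast
    have e: "?S \<inter> {gs \<in> gtuples G q. g gs = \<xi>} = {gs \<in> ?S. g gs = \<xi>}" using S by blast
    show "\<xi> (dirac_chain T q c {gs \<in> gtuples G q. g gs = \<xi>}) = (\<Sum>gs\<in>{gs \<in> ?S. g gs = \<xi>}. g gs (c gs))"
      unfolding dirac_chain_def e using lconst_fibre[OF gD(2)] by (simp add: chars_sum[OF \<xi>])
  qed
  also have "\<dots> = dpair c g"
    unfolding dpair_def using S gD(4) by (intro sum.group) auto
  finally show ?thesis .
qed

end

section \<open>Quotients\<close>

text \<open>\<open>h\<close> will be the identity for chains and \<open>to_qz\<close> for cochains,
  whose relation lives on rational representatives.\<close>

lemma equiv_diff_rel:
  assumes "subgrp B"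
  shows "equiv Z {(x, y). x \<in> Z \<and> y \<in> Z \<and> h x - h y \<in> B}"
proof (rule equivI)
  show "sym {(x, y). x \<in> Z \<and> y \<in> Z \<and> h x - h y \<in> B}"
    by (rule symI) (use subgrp_minus[OF assms] in fastforce)
  show "trans {(x, y). x \<in> Z \<and> y \<in> Z \<and> h x - h y \<in> B}"
    by (rule transI) (use subgrp_add[OF assms] in fastforce)
qed (auto simp: refl_on_def subgrp_0[OF assms])

lemma finite_quotient_iff_fin_mod:
  assumes B: "subgrp B"
  shows "finite (Z // {(x, y). x \<in> Z \<and> y \<in> Z \<and> x - y \<in> B}) \<longleftrightarrow> fin_mod Z B"
    (is "finite (Z // ?R) \<longleftrightarrow> _")
proof
  assume fin: "finite (Z // ?R)"
  have R: "equiv Z ?R" using equiv_diff_rel[OF B, of Z "\<lambda>x. x"] .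
  show "fin_mod Z B"
  proof (rule fin_modI)
    show "finite ((\<lambda>X. SOME x. x \<in> X) ` (Z // ?R))" using fin by simp
    fix k assume k: "k \<in> Z"
    define s where "s = (SOME x. x \<in> ?R `` {k})"
    have "s \<in> ?R `` {k}" unfolding s_def
      by (rule someI[of _ k]) (use k equiv_class_self[OF R k] in simp)
    then have "k - s \<in> B" by simp
    moreover have "s \<in> (\<lambda>X. SOME x. x \<in> X) ` (Z // ?R)" unfolding s_def by (rule imageI[OF quotientI[OF k]])
    ultimately show "\<exists>s\<in>(\<lambda>X. SOME x. x \<in> X) ` (Z // ?R). k - s \<in> B" by blast
  qed
next
  assume "fin_mod Z B"
  then obtain S where S: "finite S" "\<And>k. k \<in> Z \<Longrightarrow> \<exists>s\<in>S. k - s \<in> B" unfolding fin_mod_def by blast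
  have "Z // ?R \<subseteq> (\<lambda>s. {z \<in> Z. z - s \<in> B}) ` S"
  proof
    fix X assume "X \<in> Z // ?R"
    then obtain k where k: "k \<in> Z" "X = ?R `` {k}" by (auto elim: quotientE)
    then obtain s where s: "s \<in> S" "k - s \<in> B" using S by blast
    have "k - z \<in> B \<longleftrightarrow> z - s \<in> B" for z
      using subgrp_diff[OF B s(2), of "k - z"] subgrp_diff[OF B s(2), of "z - s"] by auto
    then have "X = {z \<in> Z. z - s \<in> B}" using k by auto
    then show "X \<in> (\<lambda>s. {z \<in> Z. z - s \<in> B}) ` S" using s by blast
  qed
  then show "finite (Z // ?R)" using S(1) finite_subset by blast
qed

context
  fixes Z :: "'a set" and R :: "'a rel" and Z' :: "'b set" and R' :: "'b rel" and \<phi> :: "'a \<Rightarrow> 'b"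
  assumes R: "equiv Z R" and R': "equiv Z' R'"
    and \<phi>: "\<And>x. x \<in> Z \<Longrightarrow> \<phi> x \<in> Z'" and resp: "\<And>x y. (x, y) \<in> R \<Longrightarrow> (\<phi> x, \<phi> y) \<in> R'"
begin

lemma quotient_map_class:
  assumes "x \<in> Z"
  shows "R' `` (\<phi> ` (R `` {x})) = R' `` {\<phi> x}"
proof -
  have "R' `` {\<phi> y} = R' `` {\<phi> x}" if "(x, y) \<in> R" for y
    using equiv_class_eq[OF R' resp[OF that]] by simp
  moreover have "x \<in> R `` {x}" using equiv_class_self[OF R assms] .
  ultimately show ?thesis by blast
qed

lemma quotient_map_inj_iff:
  "inj_on (\<lambda>X. R' `` (\<phi> ` X)) (Z // R) \<longleftrightarrow> (\<forall>x\<in>Z. \<forall>y\<in>Z. (\<phi> x, \<phi> y) \<in> R' \<longrightarrow> (x, y) \<in> R)"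
proof
  assume inj: "inj_on (\<lambda>X. R' `` (\<phi> ` X)) (Z // R)"
  show "\<forall>x\<in>Z. \<forall>y\<in>Z. (\<phi> x, \<phi> y) \<in> R' \<longrightarrow> (x, y) \<in> R"
  proof (intro ballI impI)
    fix x y assume xy: "x \<in> Z" "y \<in> Z" "(\<phi> x, \<phi> y) \<in> R'"
    have "R' `` (\<phi> ` (R `` {x})) = R' `` (\<phi> ` (R `` {y}))"
      using quotient_map_class xy equiv_class_eq[OF R' xy(3)] by simp
    then have "R `` {x} = R `` {y}"
      using inj_onD[OF inj] quotientI[OF xy(1)] quotientI[OF xy(2)] by blast
    then show "(x, y) \<in> R" using eq_equiv_class[OF _ R xy(2)] by blast
  qed
next
  assume *: "\<forall>x\<in>Z. \<forall>y\<in>Z. (\<phi> x, \<phi> y) \<in> R' \<longrightarrow> (x, y) \<in> R"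
  show "inj_on (\<lambda>X. R' `` (\<phi> ` X)) (Z // R)"
  proof (rule inj_onI)
    fix X Y assume "X \<in> Z // R" "Y \<in> Z // R" and e: "R' `` (\<phi> ` X) = R' `` (\<phi> ` Y)"
    then obtain x y where xy: "x \<in> Z" "y \<in> Z" "X = R `` {x}" "Y = R `` {y}" by (metis quotientE)
    then have "R' `` {\<phi> x} = R' `` {\<phi> y}" using e quotient_map_class by simp
    then have "(\<phi> x, \<phi> y) \<in> R'" using eq_equiv_class[OF _ R' \<phi>] xy by blast
    then have "(x, y) \<in> R" using * xy by blast
    then show "X = Y" using equiv_class_eq[OF R] xy by simp
  qed
qed

lemma quotient_map_surj_iff:
  "(\<lambda>X. R' `` (\<phi> ` X)) ` (Z // R) = Z' // R' \<longleftrightarrow> (\<forall>y\<in>Z'. \<exists>x\<in>Z. (y, \<phi> x) \<in> R')"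
proof -
  have img: "(\<lambda>X. R' `` (\<phi> ` X)) ` (Z // R) = (\<lambda>x. R' `` {\<phi> x}) ` Z"
  proof -
    have "Z // R = (\<lambda>x. R `` {x}) ` Z" by (auto simp: quotient_def)
    then show ?thesis using quotient_map_class by (simp add: image_image)
  qed
  show ?thesis
  proof
    assume e: "(\<lambda>X. R' `` (\<phi> ` X)) ` (Z // R) = Z' // R'"
    show "\<forall>y\<in>Z'. \<exists>x\<in>Z. (y, \<phi> x) \<in> R'"
    proof
      fix y assume "y \<in> Z'"
      then have "R' `` {y} \<in> Z' // R'" by (rule quotientI)
      then have "R' `` {y} \<in> (\<lambda>x. R' `` {\<phi> x}) ` Z" using e img by simp
      then obtain x where "x \<in> Z" "R' `` {y} = R' `` {\<phi> x}" by blast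
      then show "\<exists>x\<in>Z. (y, \<phi> x) \<in> R'" using eq_equiv_class[OF _ R' \<phi>] by blast
    qed
  next
    assume *: "\<forall>y\<in>Z'. \<exists>x\<in>Z. (y, \<phi> x) \<in> R'"
    have "(\<lambda>x. R' `` {\<phi> x}) ` Z = Z' // R'"
    proof
      show "(\<lambda>x. R' `` {\<phi> x}) ` Z \<subseteq> Z' // R'" using \<phi> by (auto intro: quotientI)
      show "Z' // R' \<subseteq> (\<lambda>x. R' `` {\<phi> x}) ` Z"
      proof
        fix Y assume "Y \<in> Z' // R'"
        then obtain y where y: "y \<in> Z'" "Y = R' `` {y}" by (metis quotientE)
        then obtain x where "x \<in> Z" "(y, \<phi> x) \<in> R'" using * by blast
        then show "Y \<in> (\<lambda>x. R' `` {\<phi> x}) ` Z" using y equiv_class_eq[OF R'] by blast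
      qed
    qed
    then show "(\<lambda>X. R' `` (\<phi> ` X)) ` (Z // R) = Z' // R'" using img by simp
  qed
qed

end

section \<open>Rational representatives of cochains\<close>

definition to_qz :: "('a \<Rightarrow> 'm \<Rightarrow> rat) \<Rightarrow> 'a \<Rightarrow> 'm \<Rightarrow> qz" where
  "to_qz f = (\<lambda>a x. qz_of (f a x))"

definition of_qz :: "('a \<Rightarrow> 'm \<Rightarrow> qz) \<Rightarrow> 'a \<Rightarrow> 'm \<Rightarrow> rat" where
  "of_qz f = (\<lambda>a x. qz_rep (f a x))"

lemma to_of_qz [simp]: "to_qz (of_qz f) = f"
  by (simp add: to_qz_def of_qz_def)

lemma of_to_qz:
  assumes "\<And>a x. 0 \<le> f a x \<and> f a x < 1"
  shows "of_qz (to_qz f) = f"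
  using assms by (simp add: to_qz_def of_qz_def qz_rep_of frac_eq)

lemma to_qz_dual: "h \<in> dual \<Longrightarrow> (\<lambda>x. qz_of (h x)) \<in> chars"
  by (simp add: dual_def chars_def hom_on_def qz_of_add)

lemma of_qz_chars: "\<xi> \<in> chars \<Longrightarrow> (\<lambda>x. qz_rep (\<xi> x)) \<in> dual"
  by (simp add: dual_def qz_rep_ge_0 qz_rep_less_1 chars_add qz_rep_add)

lemma to_qz_dcochains: "f \<in> dcochains G q \<Longrightarrow> to_qz f \<in> qcochains G q"
proof -
  assume f: "f \<in> dcochains G q"
  have "to_qz f gs = 0" if "gs \<notin> gtuples G q" for gs
    using f that by (simp add: dcochains_def to_qz_def fun_eq_iff qz_of_0)
  moreover have "to_qz f gs \<in> chars" for gs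
  proof (cases "gs \<in> gtuples G q")
    case True
    then show ?thesis using f to_qz_dual unfolding to_qz_def dcochains_def by blast
  qed (use calculation subgrp_0[OF subgrp_chars] in simp)
  ultimately show ?thesis by (simp add: qcochains_def)
qed

lemma of_qz_dcochains: "f \<in> qcochains G q \<Longrightarrow> of_qz f \<in> dcochains G q"
proof -
  have "qz_rep 0 = 0" using qz_rep_of[of 0] by (simp add: qz_of_0)
  then show "f \<in> qcochains G q \<Longrightarrow> ?thesis"
    by (auto simp: dcochains_def qcochains_def of_qz_def of_qz_chars)
qed

lemma to_qz_image_dcochains: "to_qz ` dcochains G q = qcochains G q"
  using to_qz_dcochains of_qz_dcochains to_of_qz by (metis image_eqI image_subsetI subsetI subset_antisym)

lemma cobd_of_to: "of_qz (to_qz (cobd G act q f)) = cobd G act q f"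
  by (rule of_to_qz) (simp add: cobd_def frac_ge_0 frac_lt_1)

lemma qz_of_alt: "qz_of ((-1) ^ i * r) = alt i (qz_of r)"
  by (cases "even i") (simp_all add: alt_def qz_of_minus)

context gmodule
begin

lemma to_qz_image_ccochains: "to_qz ` ccochains G T q = (qccochains q :: ('g list \<Rightarrow> 'm \<Rightarrow> qz) set)"
proof (intro subset_antisym subsetI)
  fix h :: "'g list \<Rightarrow> 'm \<Rightarrow> qz" assume "h \<in> to_qz ` ccochains G T q"
  then obtain f where f: "f \<in> ccochains G T q" "h = to_qz f" by blast
  then have h: "h \<in> qcochains G q" using to_qz_dcochains by (auto simp: ccochains_def)
  have "h ` gtuples G q \<subseteq> chars" using qcochainsD(1)[OF h] by blast
  then have "finite (h ` gtuples G q)" using finite_chars finite_subset by blast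
  moreover have "openL T q {gs \<in> gtuples G q. h gs \<in> S}" for S
  proof -
    have "openL T q {gs \<in> gtuples G q. f gs \<in> {u. (\<lambda>x. qz_of (u x)) \<in> S}}"
      using f unfolding ccochains_def by blast
    then show ?thesis by (simp add: f(2) to_qz_def)
  qed
  ultimately show "h \<in> qccochains q" using h by (simp add: qccochains_def lconst_def)
next
  fix h :: "'g list \<Rightarrow> 'm \<Rightarrow> qz" assume h: "h \<in> qccochains q"
  have "openL T q {gs \<in> gtuples G q. of_qz h gs \<in> S}" for S
    using lconst_open[OF qccochainsD(2)[OF h], of "{u. (\<lambda>x. qz_rep (u x)) \<in> S}"] by (simp add: of_qz_def)
  then have "of_qz h \<in> ccochains G T q"
    using of_qz_dcochains[OF qccochainsD(1)[OF h]] by (simp add: ccochains_def)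
  then show "h \<in> to_qz ` ccochains G T q" by (metis image_eqI to_of_qz)
qed

lemma to_qz_cobd: "to_qz (cobd G act q f) = qcobd G act q (to_qz f)"
proof (intro ext)
  fix gs x
  show "to_qz (cobd G act q f) gs x = qcobd G act q (to_qz f) gs x"
  proof (cases "gs \<in> gtuples G (Suc q)")
    case True
    have "to_qz (cobd G act q f) gs x = qz_of (f (tl gs) (act (inv\<^bsub>G\<^esub> (hd gs)) x)) +
      (\<Sum>i\<in>{1..Suc q}. alt i (qz_of (f (face G i gs) x)))"
      by (simp only: to_qz_def cobd_def True if_True qz_of_frac qz_of_add qz_of_sum qz_of_alt)
    also have "\<dots> = (\<Sum>i\<in>{0..Suc q}. alt i (to_qz f (face G i gs) (twist G act i gs x)))"
      by (subst sum.atLeast_Suc_atMost[of 0])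
        (auto simp: to_qz_def twist_def face_def alt_def intro!: sum.cong)
    finally show ?thesis using True by (simp add: qcobd_apply)
  next
    case False
    then show ?thesis
      by (simp add: to_qz_def cobd_def qz_of_0 qcobd_def qcoface_def sum_fun_apply alt_fun_apply)
  qed
qed

text \<open>In degree \<open>0\<close> the missing term of degree \<open>-1\<close> is represented by the term of degree \<open>0 - 1 = 0\<close>
  with zero maps.\<close>

definition qcobd_into :: "nat \<Rightarrow> ('g list \<Rightarrow> 'm \<Rightarrow> qz) \<Rightarrow> 'g list \<Rightarrow> 'm \<Rightarrow> qz" where
  "qcobd_into q = (if q = 0 then (\<lambda>_. 0) else qcobd G act (q - 1))"

lemma to_qz_image_cocycles:
  assumes "to_qz ` C = Q"
  shows "to_qz ` cocycles_of G act q C = {f \<in> Q. qcobd G act q f = 0}"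
proof -
  have "cobd G act q f = (\<lambda>_ _. 0) \<longleftrightarrow> qcobd G act q (to_qz f) = 0" for f
  proof
    assume "cobd G act q f = (\<lambda>_ _. 0)"
    then have "to_qz (cobd G act q f) = 0" by (simp add: to_qz_def qz_of_0 fun_eq_iff)
    then show "qcobd G act q (to_qz f) = 0" by (simp add: to_qz_cobd)
  next
    assume "qcobd G act q (to_qz f) = 0"
    then have "cobd G act q f = of_qz 0" by (metis to_qz_cobd cobd_of_to)
    then show "cobd G act q f = (\<lambda>_ _. 0)"
      using qz_rep_of[of 0] by (simp add: of_qz_def qz_of_0)
  qed
  then show ?thesis using assms unfolding cocycles_of_def by auto
qed

lemma to_qz_image_coboundaries:
  assumes "to_qz ` C = Q" "Q \<noteq> {}"
  shows "to_qz ` coboundaries_of G act q C = qcobd_into q ` Q"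
proof (cases "q = 0")
  case True
  have "to_qz (\<lambda>_ _. 0) = (0 :: 'g list \<Rightarrow> 'm \<Rightarrow> qz)" by (simp add: to_qz_def fun_eq_iff qz_of_0)
  then show ?thesis using True assms(2) by (auto simp: coboundaries_of_def qcobd_into_def)
next
  case False
  have "to_qz ` cobd G act (q - 1) ` C = qcobd G act (q - 1) ` to_qz ` C"
    by (simp add: image_image to_qz_cobd)
  then show ?thesis using False assms(1) by (simp add: coboundaries_of_def qcobd_into_def)
qed

lemma coboundaries_of_to:
  assumes "b \<in> coboundaries_of G act q C"
  shows "of_qz (to_qz b) = b"
proof (cases "q = 0")
  case True
  then show ?thesis using assms by (intro of_to_qz) (auto simp: coboundaries_of_def)
next
  case False
  then show ?thesis using assms cobd_of_to by (auto simp: coboundaries_of_def)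
qed

text \<open>The difference in \<open>cohrel\<close> is reduced to [0,1), and so are the values of
  coboundaries. Canonical representatives are determined by their classes modulo 1, so membership
  can be tested there.\<close>

lemma cohrel_eq:
  assumes "to_qz ` C = Q" "Q \<noteq> {}"
  shows "cohrel Z (coboundaries_of G act q C) =
    {(f, f'). f \<in> Z \<and> f' \<in> Z \<and> to_qz f - to_qz f' \<in> qcobd_into q ` Q}"
proof -
  have "(\<lambda>gs x. frac (f gs x - f' gs x)) \<in> coboundaries_of G act q C \<longleftrightarrow>
    to_qz f - to_qz f' \<in> to_qz ` coboundaries_of G act q C" for f f'
  proof -
    let ?d = "\<lambda>gs x. frac (f gs x - f' gs x)"
    have d: "to_qz ?d = to_qz f - to_qz f'" by (simp add: to_qz_def fun_eq_iff qz_of_diff)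
    have od: "of_qz (to_qz ?d) = ?d" by (rule of_to_qz) (simp add: frac_ge_0 frac_lt_1)
    show ?thesis
    proof
      assume "?d \<in> coboundaries_of G act q C"
      then have "to_qz ?d \<in> to_qz ` coboundaries_of G act q C" by (rule imageI)
      then show "to_qz f - to_qz f' \<in> to_qz ` coboundaries_of G act q C" unfolding d .
    next
      assume "to_qz f - to_qz f' \<in> to_qz ` coboundaries_of G act q C"
      then obtain b where b: "to_qz f - to_qz f' = to_qz b" "b \<in> coboundaries_of G act q C" by (rule imageE)
      have "?d = of_qz (to_qz b)" unfolding b(1)[symmetric] d[symmetric] by (rule od[symmetric])
      also have "\<dots> = b" by (rule coboundaries_of_to[OF b(2)])
      finally show "?d \<in> coboundaries_of G act q C" using b(2) by simp
    qed
  qed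
  then show ?thesis using to_qz_image_coboundaries[OF assms] by (simp add: cohrel_def)
qed

lemma dchains_dual_complex:
  "dual_complex (dchains G (Suc q)) (dchains G q) (dchains G (q - 1)) (dbd G act (Suc q)) (dbd G act q)
    (qcochains G (Suc q)) (qcochains G q) (qcochains G (q - 1)) (qcobd G act q) (qcobd_into q)
    dpair dpair dpair"
proof (cases q)
  case 0
  show ?thesis
  proof (rule dual_complex.intro)
    show "dbd G act q x \<in> dchains G (q - 1)" for x
      using subgrp_0[OF subgrp_dchains] by (simp add: 0 dbd_def zero_fun_def)
    show "qcobd_into q y \<in> qcochains G q" for y
      using subgrp_0[OF subgrp_qcochains] by (simp add: 0 qcobd_into_def)
    show "hom_on (dchains G q) (dbd G act q)" by (rule hom_onI) (simp add: 0 dbd_def fun_eq_iff)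
    show "dpair (dbd G act q x) y = dpair x (qcobd_into q y)" for x y
      by (simp add: 0 dbd_def dpair_def qcobd_into_def)
  qed (simp_all add: full_dual_dchains dbd_dchains dbd_hom qcobd_qcochains dpair_adjoint)
next
  case (Suc q')
  show ?thesis
    by (rule dual_complex.intro)
      (simp_all add: Suc qcobd_into_def full_dual_dchains dbd_dchains dbd_hom qcobd_qcochains dpair_adjoint)
qed

lemma cchains_dual_complex:
  "dual_complex (qccochains (q - 1)) (qccochains q) (qccochains (Suc q)) (qcobd_into q) (qcobd G act q)
    (cchains T (q - 1)) (cchains T q) (cchains T (Suc q)) (cbd G T act q) (cbd G T act (Suc q))
    (cpair (q - 1)) (cpair q) (cpair (Suc q))"
proof (cases q)
  case 0
  show ?thesis
  proof (rule dual_complex.intro)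
    show "cbd G T act q \<mu> \<in> cchains T (q - 1)" for \<mu>
      using subgrp_0[OF subgrp_cchains] by (simp add: 0 cbd_def zero_fun_def)
    show "qcobd_into q y \<in> qccochains q" for y
      using subgrp_0[OF subgrp_qccochains] by (simp add: 0 qcobd_into_def)
    show "hom_on (qccochains (q - 1)) (qcobd_into q)" by (rule hom_onI) (simp add: 0 qcobd_into_def)
    show "cpair q (qcobd_into q x) \<mu> = cpair (q - 1) x (cbd G T act q \<mu>)"
      if "x \<in> qccochains (q - 1)" "\<mu> \<in> cchains T q" for x \<mu>
    proof -
      have "cpair q 0 \<mu> = 0" using hom_on_0[OF subgrp_qccochains cpair_hom_left[OF that(2)]] .
      moreover have "cpair (q - 1) x 0 = 0"
        using hom_on_0[OF full_dualD(2)[OF full_dual_cchains] full_dualD(4)[OF full_dual_cchains that(1)]] .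
      moreover have "cbd G T act q \<mu> = 0" by (simp add: 0 cbd_def fun_eq_iff)
      ultimately show ?thesis by (simp add: 0 qcobd_into_def)
    qed
  qed (simp_all add: full_dual_cchains cbd_cchains qcobd_qccochains cpair_adjoint
      hom_on_mono[OF qcobd_hom])
next
  case (Suc q')
  show ?thesis
    by (rule dual_complex.intro)
      (simp_all add: Suc qcobd_into_def full_dual_cchains cbd_cchains qcobd_qccochains cpair_adjoint
        hom_on_mono[OF qcobd_hom])
qed

lemma comparison_chains:
  "comparison (dchains G (Suc q)) (dchains G q) (dchains G (q - 1)) (dbd G act (Suc q)) (dbd G act q)
    (qcochains G (Suc q)) (qcochains G q) (qcochains G (q - 1)) (qcobd G act q) (qcobd_into q)
    dpair dpair dpair
    (qccochains (q - 1)) (qccochains q) (qccochains (Suc q))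
    (cchains T (q - 1)) (cchains T q) (cchains T (Suc q)) (cbd G T act q) (cbd G T act (Suc q))
    (cpair (q - 1)) (cpair q) (cpair (Suc q)) (dirac_chain T q) (int CARD('m))"
proof (intro comparison.intro comparison_axioms.intro dchains_dual_complex cchains_dual_complex)
  show "qccochains q \<subseteq> qcochains G q" "qccochains (q - 1) \<subseteq> qcochains G (q - 1)"
    by (auto simp: qccochains_def)
  \<comment> \<open>The order of the module kills every module-valued function, whatever its domain,
    and so is an exponent for both kinds of chains.\<close>
  show "zmul (int CARD('m)) x = 0" for x :: "'g list \<Rightarrow> 'm"
    by (simp add: fun_eq_iff zmul_fun_apply zmul_CARD)
  show "zmul (int CARD('m)) \<mu> = 0" for \<mu> :: "'g list set \<Rightarrow> 'm"
    by (simp add: fun_eq_iff zmul_fun_apply zmul_CARD)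
qed (simp_all add: dirac_cchains cpair_dirac)

end

theorem theorem2p4:
  fixes G :: "'g monoid" and T :: "'g topology"
    and act :: "'g \<Rightarrow> 'm::{ab_group_add,finite} \<Rightarrow> 'm" and q :: nat
  assumes "profinite_group G T" and "finite_G_module G T act"
  shows "((phi_coh G act q ` Hc_coh G T act q = Hd_coh G act q)
            \<longrightarrow> inj_on (phi_hom G T act q) (Hd_hom G act q))
       \<and> ((phi_hom G T act q ` Hd_hom G act q = Hc_hom G T act q)
            \<longrightarrow> inj_on (phi_coh G act q) (Hc_coh G T act q))
       \<and> (bij_betw (phi_hom G T act q) (Hd_hom G act q) (Hc_hom G T act q)
          \<and> bij_betw (phi_coh G act q) (Hc_coh G T act q) (Hd_coh G act q)
            \<longrightarrow> finite (Hc_hom G T act q))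
       \<and> (bij_betw (phi_hom G T act q) (Hd_hom G act q) (Hc_hom G T act q)
          \<and> finite (Hc_hom G T act q)
            \<longrightarrow> bij_betw (phi_coh G act q) (Hc_coh G T act q) (Hd_coh G act q))
       \<and> (bij_betw (phi_coh G act q) (Hc_coh G T act q) (Hd_coh G act q)
          \<and> finite (Hc_hom G T act q)
            \<longrightarrow> bij_betw (phi_hom G T act q) (Hd_hom G act q) (Hc_hom G T act q))"
proof -
  interpret gmodule G T act using assms by (rule gmodule.intro)
  interpret comparison "dchains G (Suc q)" "dchains G q" "dchains G (q - 1)" "dbd G act (Suc q)"
    "dbd G act q" "qcochains G (Suc q)" "qcochains G q" "qcochains G (q - 1)" "qcobd G act q"
    "qcobd_into q" dpair dpair dpair "qccochains (q - 1)" "qccochains q" "qccochains (Suc q)"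
    "cchains T (q - 1)" "cchains T q" "cchains T (Suc q)" "cbd G T act q" "cbd G T act (Suc q)"
    "cpair (q - 1)" "cpair q" "cpair (Suc q)" "dirac_chain T q" "int CARD('m)"
    by (rule comparison_chains)
  have cycles: "dcycles G act q = D.ZX" "ccycles G T act q = C.ZY"
    by (simp_all add: dcycles_def ccycles_def D.ZX_def C.ZY_def zero_fun_def)
  have dhrel: "dhrel G act q = {(x, y). x \<in> D.ZX \<and> y \<in> D.ZX \<and> x - y \<in> D.BX}"
    by (simp add: dhrel_def cycles dboundaries_def D.BX_def)
  have chrel: "chrel G T act q = {(x, y). x \<in> C.ZY \<and> y \<in> C.ZY \<and> x - y \<in> C.BY}"
    by (simp add: chrel_def cycles cboundaries_def C.BY_def)
  have fin: "finite (Hd_hom G act q) \<longleftrightarrow> fin_mod D.ZX D.BX"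
    "finite (Hc_hom G T act q) \<longleftrightarrow> fin_mod C.ZY C.BY"
    by (simp_all add: Hd_hom_def Hc_hom_def cycles dhrel chrel
        finite_quotient_iff_fin_mod D.subgrp_BX C.subgrp_BY)
  have ZXsub: "x \<in> dchains G q" if "x \<in> D.ZX" for x using that D.ZX_sub by blast
  have resp_hom: "(dirac_chain T q x, dirac_chain T q y) \<in> chrel G T act q" if "(x, y) \<in> dhrel G act q" for x y
  proof -
    have xy: "x \<in> D.ZX" "y \<in> D.ZX" "x - y \<in> D.BX" using that by (auto simp: dhrel)
    then have "dirac_chain T q x - dirac_chain T q y \<in> C.BY"
      using \<delta>_boundary[OF xy(3)] \<delta>_diff[OF ZXsub ZXsub] by simp
    then show ?thesis using xy \<delta>_cycle by (simp add: chrel)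
  qed
  have eq_hom: "equiv D.ZX (dhrel G act q)" "equiv C.ZY (chrel G T act q)"
    unfolding dhrel chrel using equiv_diff_rel[where h = "\<lambda>x. x"] D.subgrp_BX C.subgrp_BY by blast+
  have phi_hom_eq: "phi_hom G T act q = (\<lambda>X. chrel G T act q `` (dirac_chain T q ` X))"
    by (simp add: phi_hom_def fun_eq_iff)
  have hom_inj_iff: "inj_on (phi_hom G T act q) (Hd_hom G act q) \<longleftrightarrow> hom_inj"
  proof -
    have "inj_on (phi_hom G T act q) (Hd_hom G act q) \<longleftrightarrow> (\<forall>x\<in>D.ZX. \<forall>y\<in>D.ZX.
        (dirac_chain T q x, dirac_chain T q y) \<in> chrel G T act q \<longrightarrow> (x, y) \<in> dhrel G act q)"
      unfolding phi_hom_eq Hd_hom_def cycles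
      by (rule quotient_map_inj_iff[OF eq_hom \<delta>_cycle resp_hom])
    \<comment> \<open>By additivity of \<open>\<delta>\<close> only the difference of the two cycles
      matters; taking the second one to be 0 leads to the kernel condition.\<close>
    also have "\<dots> \<longleftrightarrow> (\<forall>x\<in>D.ZX. \<forall>y\<in>D.ZX. dirac_chain T q (x - y) \<in> C.BY \<longrightarrow> x - y \<in> D.BX)"
      by (auto simp: chrel dhrel \<delta>_cycle \<delta>_diff ZXsub)
    also have "\<dots> \<longleftrightarrow> hom_inj"
      unfolding hom_inj_def using subgrp_0[OF D.subgrp_ZX] subgrp_diff[OF D.subgrp_ZX]
      by (metis diff_zero)
    finally show ?thesis .
  qed
  have hom_surj_iff: "phi_hom G T act q ` Hd_hom G act q = Hc_hom G T act q \<longleftrightarrow> hom_surj"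
  proof -
    have "phi_hom G T act q ` Hd_hom G act q = Hc_hom G T act q \<longleftrightarrow>
        (\<forall>y\<in>C.ZY. \<exists>x\<in>D.ZX. (y, dirac_chain T q x) \<in> chrel G T act q)"
      unfolding phi_hom_eq Hd_hom_def Hc_hom_def cycles
      by (rule quotient_map_surj_iff[OF eq_hom \<delta>_cycle resp_hom])
    then show ?thesis by (auto simp: chrel hom_surj_def \<delta>_cycle)
  qed
  define ZD where "ZD = cocycles_of G act q (dcochains G q :: ('g list \<Rightarrow> 'm \<Rightarrow> rat) set)"
  define ZC where "ZC = cocycles_of G act q (ccochains G T q :: ('g list \<Rightarrow> 'm \<Rightarrow> rat) set)"
  define RD where "RD = cohrel ZD (coboundaries_of G act q (dcochains G (q - 1)))"
  define RC where "RC = cohrel ZC (coboundaries_of G act q (ccochains G T (q - 1)))"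
  have imgD: "to_qz ` ZD = D.ZY" and imgC: "to_qz ` ZC = C.ZX"
    unfolding ZD_def ZC_def D.ZY_def C.ZX_def
    by (simp_all add: to_qz_image_cocycles to_qz_image_dcochains to_qz_image_ccochains)
  have RD: "RD = {(f, f'). f \<in> ZD \<and> f' \<in> ZD \<and> to_qz f - to_qz f' \<in> D.BY}"
    unfolding RD_def D.BY_def
    using subgrp_0[OF subgrp_qcochains] by (intro cohrel_eq to_qz_image_dcochains) blast
  have RC: "RC = {(f, f'). f \<in> ZC \<and> f' \<in> ZC \<and> to_qz f - to_qz f' \<in> C.BX}"
    unfolding RC_def C.BX_def
    using subgrp_0[OF subgrp_qccochains] by (intro cohrel_eq to_qz_image_ccochains) blast
  have ZCD: "x \<in> ZD" if "x \<in> ZC" for x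
    using that by (auto simp: ZC_def ZD_def cocycles_of_def ccochains_def)
  have eq_coh: "equiv ZC RC" "equiv ZD RD"
    unfolding RC RD using equiv_diff_rel D.subgrp_BY C.subgrp_BX by blast+
  have resp_coh: "(x, y) \<in> RD" if "(x, y) \<in> RC" for x y
    using that ZCD coboundaries_sub by (auto simp: RC RD)
  \<comment> \<open>The redundant image under the identity gives \<open>phi_coh\<close> the shape of
    the general map between quotients.\<close>
  have phi_coh_eq: "phi_coh G act q = (\<lambda>X. RD `` ((\<lambda>x. x) ` X))"
    by (simp add: phi_coh_def RD_def ZD_def fun_eq_iff)
  have Hcoh: "Hd_coh G act q = ZD // RD" "Hc_coh G T act q = ZC // RC"
    by (simp_all add: Hd_coh_def Hc_coh_def ZD_def RD_def ZC_def RC_def)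
  have coh_inj_iff: "inj_on (phi_coh G act q) (Hc_coh G T act q) \<longleftrightarrow> coh_inj"
  proof -
    have "inj_on (phi_coh G act q) (Hc_coh G T act q) \<longleftrightarrow>
        (\<forall>x\<in>ZC. \<forall>y\<in>ZC. (x, y) \<in> RD \<longrightarrow> (x, y) \<in> RC)"
      unfolding phi_coh_eq Hcoh by (rule quotient_map_inj_iff[OF eq_coh ZCD resp_coh])
    also have "\<dots> \<longleftrightarrow> (\<forall>x\<in>ZC. \<forall>y\<in>ZC. to_qz x - to_qz y \<in> D.BY \<longrightarrow> to_qz x - to_qz y \<in> C.BX)"
      by (auto simp: RD RC ZCD)
    also have "\<dots> \<longleftrightarrow> (\<forall>x\<in>C.ZX. \<forall>y\<in>C.ZX. x - y \<in> D.BY \<longrightarrow> x - y \<in> C.BX)"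
      by (simp flip: imgC)
    also have "\<dots> \<longleftrightarrow> coh_inj"
      unfolding coh_inj_def using subgrp_0[OF C.subgrp_ZX] subgrp_diff[OF C.subgrp_ZX]
      by (metis diff_zero)
    finally show ?thesis .
  qed
  have coh_surj_iff: "phi_coh G act q ` Hc_coh G T act q = Hd_coh G act q \<longleftrightarrow> coh_surj"
  proof -
    have "phi_coh G act q ` Hc_coh G T act q = Hd_coh G act q \<longleftrightarrow> (\<forall>y\<in>ZD. \<exists>x\<in>ZC. (y, x) \<in> RD)"
      unfolding phi_coh_eq Hcoh by (rule quotient_map_surj_iff[OF eq_coh ZCD resp_coh])
    also have "\<dots> \<longleftrightarrow> (\<forall>y\<in>ZD. \<exists>x\<in>ZC. to_qz y - to_qz x \<in> D.BY)"
      by (auto simp: RD ZCD)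
    also have "\<dots> \<longleftrightarrow> coh_surj"
      unfolding coh_surj_def imgC[symmetric] imgD[symmetric] by simp
    finally show ?thesis .
  qed
  have bij_hom: "bij_betw (phi_hom G T act q) (Hd_hom G act q) (Hc_hom G T act q) \<longleftrightarrow> hom_inj \<and> hom_surj"
    by (simp add: bij_betw_def hom_inj_iff hom_surj_iff)
  have bij_coh: "bij_betw (phi_coh G act q) (Hc_coh G T act q) (Hd_coh G act q) \<longleftrightarrow> coh_inj \<and> coh_surj"
    by (simp add: bij_betw_def coh_inj_iff coh_surj_iff)
  \<comment> \<open>The finiteness in the statement concerns \<open>Hc_hom\<close>, while
    \<open>surj_imp_finite\<close> and \<open>hom_inj_finite_imp_coh_surj\<close> speak of the
    abstract homology; bijectivity of \<open>phi_hom\<close> carries it across.\<close>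
  have fin_iff: "fin_mod D.ZX D.BX \<longleftrightarrow> fin_mod C.ZY C.BY" if "hom_inj" "hom_surj"
    using bij_betw_finite[of "phi_hom G T act q" "Hd_hom G act q" "Hc_hom G T act q"] that bij_hom fin by blast
  show ?thesis
    unfolding bij_hom bij_coh hom_inj_iff hom_surj_iff coh_inj_iff coh_surj_iff fin
    using coh_surj_imp_hom_inj hom_surj_imp_coh_inj surj_imp_finite hom_inj_finite_imp_coh_surj
      coh_inj_finite_imp_hom_surj fin_iff by blast
qed

end
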